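(* $p(K_{2,1,1,1},\cdot)$ is perfectly stable, $i(K_{2,1,1,1})=\frac{525}{1024}$, and the unique maximiser is $(\frac18,\ldots,\frac18,0,\ldots)$, with $\frac18$ repeated $8$ times.
   Context: $K_{2,1,1,1}$ is the complete $4$-partite graph with parts of sizes $2,1,1,1$. For graphs $F,G$ with $v(F)\le v(G)$, $P(F,G)$ is the number of $v(F)$-subsets of $V(G)$ inducing a copy of $F$, and $p(F,G)=P(F,G)/\binom{v(G)}{v(F)}$. $i(F,n)=\max\{P(F,G):v(G)=n\}$ and $i(F)=\lim_{n\to\infty}i(F,n)/\binom{n}{v(F)}$. Write $\lambda=p(F,\cdot)$, $\lambda(n)=\max\{\lambda(G):v(G)=n\}$, $\lambda_{\max}=\lim_n\lambda(n)$. A graph is complete partite if its vertex set is partitioned into independent sets (parts) with all edges between distinct parts. For $n$-vertex graphs $G,H$, $\hat\delta_1(G,H)=\frac2{n^2}\min_\sigma|E(H)\triangle E(\sigma(G))|$ over bijections $\sigma:V(G)\to V(H)$. $\lambda$ is perfectly stable if there is $C>0$ such that every graph $G$ of order $n\ge C$ admits a complete partite $H$ of order $n$ with $\hat\delta_1(G,H)\le C(\lambda(n)-\lambda(G))$. A maximiser is a sequence $\mathbf x=(x_1,x_2,\ldots)$ with $x_1\ge x_2\ge\cdots\ge0$, $\sum x_i\le1$, for which there are complete partite graphs $H_n$ with $v(H_n)\to\infty$, $\lambda(H_n)\to\lambda_{\max}$, and the $i$-th largest part of $H_n$ having $(x_i+o(1))v(H_n)$ vertices for every $i\ge1$. "Unique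 maximiser" means the set of maximisers consists of exactly this sequence. *)

theory Defs
  imports Complex_Main "HOL-Library.Multiset" "HOL-Library.Disjoint_Sets"
begin

section \<open>Finite simple graphs\<close>

record 'a sgraph =
  verts :: "'a set"
  edges :: "'a set set"

definition simple_graph :: "'a sgraph \<Rightarrow> bool" where
  "simple_graph G \<longleftrightarrow> finite (verts G) \<and> (\<forall>e\<in>edges G. e \<subseteq> verts G \<and> card e = 2)"

definition order :: "'a sgraph \<Rightarrow> nat" where
  "order G = card (verts G)"

definition induced :: "'a sgraph \<Rightarrow> 'a set \<Rightarrow> 'a sgraph" where
  "induced G X = \<lparr>verts = X, edges = {e \<in> edges G. e \<subseteq> X}\<rparr>"

definition map_edges :: "('a \<Rightarrow> 'b) \<Rightarrow> 'a sgraph \<Rightarrow> 'b set set" where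
  "map_edges \<sigma> G = (\<lambda>e. \<sigma> ` e) ` edges G"

definition isomorphic :: "'a sgraph \<Rightarrow> 'b sgraph \<Rightarrow> bool" where
  "isomorphic G H \<longleftrightarrow> (\<exists>\<sigma>. bij_betw \<sigma> (verts G) (verts H) \<and> map_edges \<sigma> G = edges H)"


section \<open>Complete partite graphs\<close>

definition partite_edges :: "'a set set \<Rightarrow> 'a set set" where
  "partite_edges P = {{u, v} | u v. \<exists>A\<in>P. \<exists>B\<in>P. A \<noteq> B \<and> u \<in> A \<and> v \<in> B}"

text \<open>Parts are nonempty by \<^const>\<open>partition_on\<close>, so \<open>P\<close> is determined by \<open>G\<close>.\<close>

definition complete_partite_with :: "'a sgraph \<Rightarrow> 'a set set \<Rightarrow> bool" where
  "complete_partite_with G P \<longleftrightarrow>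
     finite (verts G) \<and> partition_on (verts G) P \<and> edges G = partite_edges P"

definition complete_partite :: "'a sgraph \<Rightarrow> bool" where
  "complete_partite G \<longleftrightarrow> (\<exists>P. complete_partite_with G P)"

definition complete_multipartite :: "nat list \<Rightarrow> (nat \<times> nat) sgraph" where
  "complete_multipartite as = (let P = (\<lambda>i. {i} \<times> {..<as ! i}) ` {..<length as}
           in \<lparr>verts = \<Union>P, edges = partite_edges P\<rparr>)"

text \<open>Indexing is from \<open>0\<close>: \<open>part_size P i\<close> is the size of the \<open>(i+1)\<close>-st largest part, and \<open>0\<close>
  if there are at most \<open>i\<close> parts.\<close>

definition part_size :: "'a set set \<Rightarrow> nat \<Rightarrow> nat" where
  "part_size P i =
     (let ks = rev (sorted_list_of_multiset (image_mset card (mset_set P)))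
      in if i < length ks then ks ! i else 0)"


section \<open>Induced densities and inducibility\<close>

definition ind_count :: "'b sgraph \<Rightarrow> 'a sgraph \<Rightarrow> nat" where
  "ind_count F G =
     card {X. X \<subseteq> verts G \<and> card X = order F \<and> isomorphic F (induced G X)}"

text \<open>Only meaningful for \<open>order F \<le> order G\<close>; otherwise the value is \<open>0 / 0 = 0\<close>.\<close>

definition ind_density :: "'b sgraph \<Rightarrow> 'a sgraph \<Rightarrow> real" where
  "ind_density F G = real (ind_count F G) / real (order G choose order F)"

text \<open>Every finite graph has an isomorphic copy with vertices in \<^typ>\<open>nat\<close>, so host graphs are
  taken over \<^typ>\<open>nat\<close>.\<close>

definition graphs_of_order :: "nat \<Rightarrow> nat sgraph set" where
  "graphs_of_order n = {G. simple_graph G \<and> order G = n}"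

definition max_ind_count :: "'b sgraph \<Rightarrow> nat \<Rightarrow> nat" where
  "max_ind_count F n = Max (ind_count F ` graphs_of_order n)"

definition max_ind_ratio :: "'b sgraph \<Rightarrow> nat \<Rightarrow> real" where
  "max_ind_ratio F n = real (max_ind_count F n) / real (n choose order F)"

definition inducibility :: "'b sgraph \<Rightarrow> real" where
  "inducibility F = lim (max_ind_ratio F)"


section \<open>Perfect stability and maximisers of a graph parameter\<close>

text \<open>The parameter \<open>L\<close> is meant to be invariant under isomorphism, so that the set under
  \<^const>\<open>Max\<close> is finite.\<close>

definition param_max :: "(nat sgraph \<Rightarrow> real) \<Rightarrow> nat \<Rightarrow> real" where
  "param_max L n = Max (L ` graphs_of_order n)"

definition param_lim :: "(nat sgraph \<Rightarrow> real) \<Rightarrow> real" where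
  "param_lim L = lim (param_max L)"

text \<open>The normalised edit distance, for \<open>order G = order H\<close>.\<close>

definition edit_dist :: "'a sgraph \<Rightarrow> 'b sgraph \<Rightarrow> real" where
  "edit_dist G H =
     2 / (real (order G))\<^sup>2 *
     real (Min {card (sym_diff (edges H) (map_edges \<sigma> G)) | \<sigma>. bij_betw \<sigma> (verts G) (verts H)})"

definition perfectly_stable :: "(nat sgraph \<Rightarrow> real) \<Rightarrow> bool" where
  "perfectly_stable L \<longleftrightarrow>
     (\<exists>C>0. \<forall>n. real n \<ge> C \<longrightarrow> (\<forall>G\<in>graphs_of_order n.
        \<exists>H\<in>graphs_of_order n. complete_partite H \<and>
          edit_dist G H \<le> C * (param_max L n - L G)))"

definition maximiser :: "(nat sgraph \<Rightarrow> real) \<Rightarrow> (nat \<Rightarrow> real) \<Rightarrow> bool" where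
  "maximiser L x \<longleftrightarrow>
     decseq x \<and> (\<forall>i. x i \<ge> 0) \<and> summable x \<and> (\<Sum>i. x i) \<le> 1 \<and>
     (\<exists>(H :: nat \<Rightarrow> nat sgraph) P.
        (\<forall>n. complete_partite_with (H n) (P n)) \<and>
        filterlim (\<lambda>n. order (H n)) at_top sequentially \<and>
        (\<lambda>n. L (H n)) \<longlonglongrightarrow> param_lim L \<and>
        (\<forall>i. (\<lambda>n. real (part_size (P n) i) / real (order (H n))) \<longlonglongrightarrow> x i))"

end

theory Submission
  imports "HOL-Analysis.Analysis" "HOL-Real_Asymp.Real_Asymp" "HOL-Combinatorics.Multiset_Permutations" Defs
begin

text \<open>
  Sample five vertices of a graph independently and count the pairs that are equal or non-adjacent: up to
  \<open>O(1/n)\<close>, the induced density of \<open>K\<^bsub>2,1,1,1\<^esub>\<close> is the probability that there is exactly one such pair. This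
  makes sense for arbitrary vertex weights. Moving weight between two non-adjacent vertices changes the probability
  by a convex quadratic (Zykov symmetrisation), so one can pass to a clique, that is to part weights \<open>w\<close>,
  without decreasing it. There the probability is \<open>60 (e\<^sub>4 - 5 e\<^sub>5)\<close> in the elementary symmetric functions of \<open>w\<close>. It is
  affine in the product of any two weights with fixed sum, so at a maximum all positive weights are equal, and eight
  parts are best. Merging tiny parts increases the value near the maximum, which bounds the number of
  parts and yields stability by compactness.

  Near the balanced complete 8-partite structure, a vertex whose neighbourhood is far from every
  part-like neighbourhood loses a constant factor, and each other misplaced pair loses a constant in first order. Hence the
  distance to the nearest 8-partite structure is at most linear in the loss. This propagates
  backwards along the symmetrisation path in small steps, because a near-optimal structure cannot lie at an
  intermediate distance from the 8-partite ones.
\<close>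

section \<open>The density of a complete partite structure in power sums\<close>

text \<open>The expression in \<open>e_4\<close> and \<open>e_5\<close> arises as follows: a counted
  tuple has one repeated part in one of ten position pairs, and the monomial symmetric function for
  the exponents 2, 1, 1, 1 equals \<open>e_1 * e_4 - 5 * e_5\<close> with \<open>e_1 = 1\<close>.
  Compactness yields closeness to the optimum but no rate, so the analysis near the optimum runs
  with explicit constants. It has two rounds: vertices with many misplaced pairs are re-attached as
  a whole, because for them the interaction of two misplaced pairs can outweigh the first-order
  gain; afterwards every vertex has few misplaced pairs and these are repaired one by one. Perfect
  stability compares graphs of the same order, so an additive error of order \<open>1 / n\<close> is
  not affordable. The sampling probability is therefore related to the induced density by an exact
  identity. Its correction term is \<open>10 / n\<close> times a density of \<open>K_4\<close>,
  which differs by at most \<open>6 * b\<close> between structures at distance \<open>b\<close>. For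
  large \<open>n\<close> this is absorbed by the gain \<open>b / 20000\<close>.\<close>

definition weighting :: "'a set \<Rightarrow> ('a \<Rightarrow> real) \<Rightarrow> bool" where
  "weighting V x \<longleftrightarrow> finite V \<and> (\<forall>v\<in>V. 0 \<le> x v) \<and> sum x V = 1"

definition psum :: "'a set \<Rightarrow> ('a \<Rightarrow> real) \<Rightarrow> nat \<Rightarrow> real" where
  "psum I w k = (\<Sum>i\<in>I. w i ^ k)"

text \<open>For weights of total \<open>1\<close>, \<open>core I w\<close> is the sum of \<open>w i ^ 2 * w j * w k * w l\<close> over distinct \<open>i, j, k, l\<close>.\<close>

definition core_poly :: "real \<Rightarrow> real \<Rightarrow> real \<Rightarrow> real \<Rightarrow> real" where
  "core_poly p2 p3 p4 p5 = p2 - 3 * p3 - 3 * p2\<^sup>2 + 5 * p2 * p3 + 6 * p4 - 6 * p5"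

definition core :: "'a set \<Rightarrow> ('a \<Rightarrow> real) \<Rightarrow> real" where
  "core I w = core_poly (psum I w 2) (psum I w 3) (psum I w 4) (psum I w 5)"

text \<open>With the sum of two weights fixed, \<open>core\<close> is affine in their product. The slope is \<open>6 (e\<^sub>2 - 5 e\<^sub>3)\<close> of the
  remaining weights, here in power sums.\<close>

definition pair_slope :: "real \<Rightarrow> real \<Rightarrow> real \<Rightarrow> real" where
  "pair_slope r1 r2 r3 = 3 * (r1\<^sup>2 - r2) - 5 * (r1 ^ 3 - 3 * r1 * r2 + 2 * r3)"

lemma weighting_le_1:
  assumes "weighting V x" "v \<in> V" shows "x v \<le> 1"
proof -
  have "x v \<le> sum x V" using assms by (intro member_le_sum) (auto simp: weighting_def)
  then show ?thesis using assms by (simp add: weighting_def)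
qed

lemma psum_remove: "finite I \<Longrightarrow> i \<in> I \<Longrightarrow> psum I w k = w i ^ k + psum (I - {i}) w k"
  by (simp add: psum_def sum.remove)

lemma psum_upd_notin: "i \<notin> I \<Longrightarrow> psum I (w(i := a)) k = psum I w k"
  unfolding psum_def by (rule sum.cong) auto

lemma psum_nonneg: "(\<And>i. i \<in> I \<Longrightarrow> 0 \<le> w i) \<Longrightarrow> 0 \<le> psum I w k"
  by (simp add: psum_def sum_nonneg)

text \<open>With the sum of the two weights fixed only their product matters, so the two sides
  differ by a multiple of \<open>a * b\<close>. Total weight 1 enters through \<open>r1\<close>,
  because \<open>core_poly\<close> has the first power sum already replaced by 1.\<close>

lemma core_poly_merge:
  assumes "r1 = 1 - a - b"
  shows "core_poly (r2 + a\<^sup>2 + b\<^sup>2) (r3 + a ^ 3 + b ^ 3) (r4 + a ^ 4 + b ^ 4) (r5 + a ^ 5 + b ^ 5) =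
    core_poly (r2 + (a + b)\<^sup>2) (r3 + (a + b) ^ 3) (r4 + (a + b) ^ 4) (r5 + (a + b) ^ 5) + a * b * pair_slope r1 r2 r3"
  unfolding assms core_poly_def pair_slope_def
  by algebra

text \<open>If \<open>i\<close> is drawn with probability \<open>w i\<close>, then
  \<open>w i\<close> has mean \<open>psum I w 2\<close> and second moment \<open>psum I w 3\<close>;
  this is nonnegativity of the variance.\<close>

lemma psum_2_sq_le:
  assumes "weighting I w"
  shows "(psum I w 2)\<^sup>2 \<le> psum I w 3"
proof -
  define p where "p = psum I w 2"
  have s1: "sum w I = 1" using assms by (simp add: weighting_def)
  have "0 \<le> (\<Sum>i\<in>I. w i * (w i - p)\<^sup>2)"
    using assms by (intro sum_nonneg) (auto simp: weighting_def)
  also have "\<dots> = (\<Sum>i\<in>I. w i ^ 3 - 2 * p * w i ^ 2 + p\<^sup>2 * w i)"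
    by (rule sum.cong) (auto simp: power2_eq_square power3_eq_cube algebra_simps)
  also have "\<dots> = psum I w 3 - 2 * p * p + p\<^sup>2"
    by (simp add: sum.distrib sum_subtractf sum_distrib_left[symmetric] s1)
       (simp add: psum_def p_def)
  finally show ?thesis by (simp add: p_def power2_eq_square)
qed

text \<open>Write \<open>s = w i + w j + w k\<close>. Then
  \<open>(1 - 2 * s)^2 = 1 - 4 * s * (1 - s)\<close>, and \<open>1 - s\<close> is the weight of a
  fourth index distinct from the three. Hence the sum is the distinct triple sum minus
  \<open>4 * 3\<close> times \<open>core\<close>, one copy for each of the three indices that may be
  squared.\<close>

lemma triple_square_identity:
  assumes "finite I" "sum w I = 1"
  shows "(\<Sum>i\<in>I. w i * (\<Sum>j\<in>I-{i}. w j * (\<Sum>k\<in>I-{i}-{j}. w k * (1 - 2 * (w i + w j + w k))\<^sup>2)))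
    = 1 - 3 * psum I w 2 + 2 * psum I w 3 - 12 * core I w"
proof -
  define p where "p = psum I w"
  have p1: "(\<Sum>k\<in>I. w k) = 1" and p2: "(\<Sum>k\<in>I. w k ^ 2) = p 2"
    and p3: "(\<Sum>k\<in>I. w k ^ 3) = p 3" and p4: "(\<Sum>k\<in>I. w k ^ 4) = p 4" and p5: "(\<Sum>k\<in>I. w k ^ 5) = p 5"
    using assms by (simp_all add: p_def psum_def)
  have poly: "(\<Sum>k\<in>I. w k * (c0 + c1 * w k + c2 * w k ^ 2 + c3 * w k ^ 3 + c4 * w k ^ 4)) = c0 + c1 * p 2 + c2 * p 3 + c3 * p 4 + c4 * p 5"
    for c0 c1 c2 c3 c4
  proof -
    have "(\<Sum>k\<in>I. w k * (c0 + c1 * w k + c2 * w k ^ 2 + c3 * w k ^ 3 + c4 * w k ^ 4))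
      = (\<Sum>k\<in>I. c0 * w k + c1 * w k ^ 2 + c2 * w k ^ 3 + c3 * w k ^ 4 + c4 * w k ^ 5)"
      by (rule sum.cong) (auto simp: power2_eq_square eval_nat_numeral algebra_simps)
    also have "\<dots> = c0 + c1 * p 2 + c2 * p 3 + c3 * p 4 + c4 * p 5"
      by (simp add: sum.distrib sum_distrib_left[symmetric] p1 p2 p3 p4 p5)
    finally show ?thesis .
  qed
  \<comment> \<open>\<open>A\<close> and \<open>B\<close> are closed forms of the two inner sums:
    each is a full sum over \<open>I\<close>, evaluated by \<open>poly\<close>, minus the excluded
    terms.\<close>
  define A where "A i j = ((1 - 2 * w i - 2 * w j)\<^sup>2 - 4 * (1 - 2 * w i - 2 * w j) * p 2 + 4 * p 3)
       - w i * (1 - 4 * w i - 2 * w j)\<^sup>2 - w j * (1 - 2 * w i - 4 * w j)\<^sup>2" for i j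
  have inner: "(\<Sum>k\<in>I-{i}-{j}. w k * (1 - 2 * (w i + w j + w k))\<^sup>2) = A i j" if "i \<in> I" "j \<in> I - {i}" for i j
  proof -
    let ?u = "1 - 2 * w i - 2 * w j"
    have "(\<Sum>k\<in>I. w k * (1 - 2 * (w i + w j + w k))\<^sup>2) = (\<Sum>k\<in>I. w k * (?u\<^sup>2 + (- 4 * ?u) * w k + 4 * w k ^ 2 + 0 * w k ^ 3 + 0 * w k ^ 4))"
      by (rule sum.cong) (auto simp: power2_eq_square algebra_simps)
    also have "\<dots> = ?u\<^sup>2 - 4 * ?u * p 2 + 4 * p 3" unfolding poly by algebra
    finally show ?thesis
      using that assms(1) by (simp add: sum_diff1 A_def algebra_simps)
  qed
  define B where "B i = (1 - w i) * ((1 - 2 * w i)\<^sup>2 - 4 * (1 - 2 * w i) * p 2 + 4 * p 3 - w i * (1 - 4 * w i)\<^sup>2)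
     + (p 2 - w i ^ 2) * (- 4 * (1 - 2 * w i) + 8 * p 2 + 4 * w i * (1 - 4 * w i) - (1 - 2 * w i)\<^sup>2)
     + (p 3 - w i ^ 3) * (4 - 4 * w i + 8 * (1 - 2 * w i)) - 16 * (p 4 - w i ^ 4)" for i
  have mid: "(\<Sum>j\<in>I-{i}. w j * A i j) = B i" if "i \<in> I" for i
  proof -
    have A: "A i j = ((1 - 2 * w i)\<^sup>2 - 4 * (1 - 2 * w i) * p 2 + 4 * p 3 - w i * (1 - 4 * w i)\<^sup>2)
      + (- 4 * (1 - 2 * w i) + 8 * p 2 + 4 * w i * (1 - 4 * w i) - (1 - 2 * w i)\<^sup>2) * w j
      + (4 - 4 * w i + 8 * (1 - 2 * w i)) * w j ^ 2 + (-16) * w j ^ 3 + 0 * w j ^ 4" for j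
      unfolding A_def by algebra
    have "(\<Sum>j\<in>I-{i}. w j * A i j) = (\<Sum>j\<in>I. w j * A i j) - w i * A i i"
      using that assms(1) by (simp add: sum_diff1)
    also have "\<dots> = B i" unfolding A poly B_def by algebra
    finally show ?thesis .
  qed
  have "(\<Sum>i\<in>I. w i * (\<Sum>j\<in>I-{i}. w j * (\<Sum>k\<in>I-{i}-{j}. w k * (1 - 2 * (w i + w j + w k))\<^sup>2)))
     = (\<Sum>i\<in>I. w i * (\<Sum>j\<in>I-{i}. w j * A i j))"
    by (intro sum.cong arg_cong2[where f="(*)"] refl inner)
  also have "\<dots> = (\<Sum>i\<in>I. w i * B i)"
    by (intro sum.cong arg_cong2[where f="(*)"] refl mid)
  also have "\<dots> = 1 - 3 * p 2 + 2 * p 3 - 12 * core_poly (p 2) (p 3) (p 4) (p 5)"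
  proof -
    have B: "B i = (1 - 9 * p 2 + 8 * p 2 ^ 2 + 16 * p 3 - 16 * p 4) + (28 * p 2 - 6 - 24 * p 3) * w i
      + (22 - 36 * p 2) * w i ^ 2 + (- 56) * w i ^ 3 + 72 * w i ^ 4" for i
      unfolding B_def by algebra
    show ?thesis unfolding B poly core_poly_def by algebra
  qed
  finally show ?thesis by (simp add: p_def core_def)
qed

lemma core_triple_bound:
  assumes "weighting I w"
  shows "12 * core I w \<le> 1 - 3 * psum I w 2 + 2 * psum I w 3"
proof -
  have "0 \<le> (\<Sum>i\<in>I. w i * (\<Sum>j\<in>I-{i}. w j * (\<Sum>k\<in>I-{i}-{j}. w k * (1 - 2 * (w i + w j + w k))\<^sup>2)))"
    using assms by (intro sum_nonneg mult_nonneg_nonneg) (auto simp: weighting_def)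
  then show ?thesis
    using assms by (subst (asm) triple_square_identity) (auto simp: weighting_def)
qed

text \<open>The left-hand side is \<open>- 2 + 12 * p2 - 10 * p3\<close>. By
  \<open>core_triple_bound\<close> a value of at least \<open>1 / 20\<close> gives
  \<open>3 * p2 - 2 * p3 \<le> 2 / 5\<close>, hence \<open>6 * p2 - 5 * p3 \<le> 4 / 5\<close>. The
  threshold \<open>1 / 20\<close> lies just below the maximum \<open>210 / 4096\<close>.\<close>

lemma pair_slope_neg:
  assumes "weighting I w" "1 / 20 \<le> core I w"
  shows "pair_slope 1 (psum I w 2) (psum I w 3) \<le> - 1 / 5"
proof (rule ccontr)
  define p where "p = psum I w 2"
  define q where "q = psum I w 3"
  assume "\<not> ?thesis"
  then have k: "6 * p - 5 * q > 9 / 10" by (simp add: pair_slope_def p_def q_def)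
  have pq: "p\<^sup>2 \<le> q" unfolding p_def q_def by (rule psum_2_sq_le) fact
  have "12 * (1 / 20) \<le> 1 - 3 * p + 2 * q"
    using core_triple_bound[OF assms(1)] assms(2) by (simp add: p_def q_def)
  then have "p < 1 / 10" using k by linarith
  moreover have "0 \<le> p" using assms(1) by (auto simp: p_def weighting_def intro!: psum_nonneg)
  moreover have "0 \<le> q" using pq by (smt (verit) zero_le_power2)
  ultimately show False using k by linarith
qed

lemma core_pair:
  assumes "finite I" "i \<in> I" "j \<in> I" "i \<noteq> j"
  shows "core I w = core_poly (psum (I-{i}-{j}) w 2 + w i ^ 2 + w j ^ 2) (psum (I-{i}-{j}) w 3 + w i ^ 3 + w j ^ 3)
     (psum (I-{i}-{j}) w 4 + w i ^ 4 + w j ^ 4) (psum (I-{i}-{j}) w 5 + w i ^ 5 + w j ^ 5)"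
proof -
  have "psum I w k = psum (I-{i}-{j}) w k + w i ^ k + w j ^ k" for k
    using assms psum_remove[of I i w k] psum_remove[of "I-{i}" j w k] by simp
  then show ?thesis by (simp add: core_def)
qed

lemma core_merge:
  assumes "weighting I w" "i \<in> I" "j \<in> I" "i \<noteq> j"
  shows "core I w = core I (w(i := w i + w j, j := 0)) + w i * w j *
     pair_slope (psum (I-{i}-{j}) w 1) (psum (I-{i}-{j}) w 2) (psum (I-{i}-{j}) w 3)"
proof -
  let ?R = "I - {i} - {j}"
  let ?w = "w(i := w i + w j, j := 0)"
  have fin: "finite I" using assms by (simp add: weighting_def)
  have R: "psum ?R ?w k = psum ?R w k" for k
    by (auto simp: psum_def intro!: sum.cong)
  have r1: "psum ?R w 1 = 1 - w i - w j"
    using assms fin by (simp add: psum_def sum_diff1 weighting_def)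
  show ?thesis
    unfolding core_pair[OF fin assms(2,3,4), of w] core_pair[OF fin assms(2,3,4), of ?w] R
    using assms(4) core_poly_merge[OF r1] by simp
qed

lemma weighting_move:
  assumes "weighting I w" "i \<in> I" "j \<in> I" "i \<noteq> j" "0 \<le> a" "0 \<le> b" "a + b = w i + w j"
  shows "weighting I (w(i := a, j := b))"
proof -
  have fin: "finite I" using assms by (simp add: weighting_def)
  have "sum f I = f i + (f j + sum f (I - {i} - {j}))" for f :: "_ \<Rightarrow> real"
    using assms fin by (simp add: sum.remove)
  moreover have "sum (w(i := a, j := b)) (I - {i} - {j}) = sum w (I - {i} - {j})"
    by (rule sum.cong) auto
  ultimately have "sum (w(i := a, j := b)) I = sum w I"
    using assms by (metis (no_types, lifting) ab_semigroup_add_class.add_ac(1) fun_upd_other fun_upd_same)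
  then show ?thesis using assms by (auto simp: weighting_def)
qed

lemma core_drop_zero:
  assumes "finite I" "w j = 0"
  shows "core (I - {j}) w = core I w"
proof -
  have "psum (I - {j}) w k = psum I w k" if "k > 0" for k
    using assms that by (simp add: psum_def sum_diff1)
  then show ?thesis by (simp add: core_def)
qed

lemma weighting_drop_zero:
  assumes "weighting I w" "w j = 0"
  shows "weighting (I - {j}) w"
  using assms by (auto simp: weighting_def sum_diff1)

text \<open>The slope that governs the merge omits the two weights. Their total \<open>s\<close> is
  at most \<open>1 / 200\<close>, so this changes the slope of \<open>pair_slope_neg\<close> by at
  most \<open>30 * s\<close>, less than its margin \<open>1 / 5\<close>.\<close>

lemma core_merge_small:
  assumes w: "weighting I w" and c: "1 / 20 \<le> core I w" and ij: "i \<in> I" "j \<in> I" "i \<noteq> j"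
    and small: "w i \<le> 1 / 400" "w j \<le> 1 / 400"
  shows "core I w \<le> core I (w(i := w i + w j, j := 0))"
proof -
  define a b where "a = w i" and "b = w j"
  define p q where "p = psum I w 2" and "q = psum I w 3"
  have fin: "finite I" using w by (simp add: weighting_def)
  have ab: "0 \<le> a" "0 \<le> b" "a \<le> 1 / 400" "b \<le> 1 / 400"
    using assms by (auto simp: a_def b_def weighting_def)
  define s where "s = a + b"
  have s: "0 \<le> s" "s \<le> 1 / 200" using ab by (auto simp: s_def)
  have p0: "0 \<le> p" using w by (auto simp: p_def weighting_def intro!: psum_nonneg)
  let ?R = "I - {i} - {j}"
  have r1: "psum ?R w 1 = 1 - s"
    using w ij fin by (simp add: psum_def sum_diff1 weighting_def a_def b_def s_def)
  have r: "psum ?R w k = psum I w k - a ^ k - b ^ k" for k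
    using ij fin by (simp add: psum_def sum_diff1 a_def b_def)
  \<comment> \<open>Naming the nonlinear terms makes the estimate for \<open>K\<close> linear: four
    of them are at most \<open>s\<close>, and \<open>X\<close> and \<open>Y\<close> enter with a
    favourable sign.\<close>
  define X Y A2 A3 S2 S3 where "X = (1 - s) * (a\<^sup>2 + b\<^sup>2)" and "Y = s * p" and "A2 = a\<^sup>2 + b\<^sup>2"
    and "A3 = a ^ 3 + b ^ 3" and "S2 = s\<^sup>2" and "S3 = s ^ 3"
  have pw: "t ^ n \<le> t" if "0 \<le> t" "t \<le> 1" "n \<noteq> 0" for t :: real and n
    using that power_decreasing[of 1 n t] by simp
  have "A2 \<le> s" "A3 \<le> s" "S2 \<le> s" "S3 \<le> s"
    using pw[of a 2] pw[of b 2] pw[of a 3] pw[of b 3] pw[of s 2] pw[of s 3] ab s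
    by (auto simp: A2_def A3_def S2_def S3_def s_def)
  moreover have "0 \<le> Y" "0 \<le> X" "0 \<le> S2" "0 \<le> S3"
    using s p0 by (auto simp: X_def Y_def S2_def S3_def)
  moreover have "3 * (1 - p) - 5 * (1 - 3 * p + 2 * q) \<le> - 1 / 5"
    using pair_slope_neg[OF w c] by (simp add: pair_slope_def p_def q_def)
  moreover define K where "K = pair_slope (1 - s) (p - a\<^sup>2 - b\<^sup>2) (q - a ^ 3 - b ^ 3)"
  moreover have "K = 3 * (1 - p) - 5 * (1 - 3 * p + 2 * q)
     + (3 * (- 2 * s + S2 + A2) - 5 * (- 3 * s + 3 * S2 - S3 + 3 * Y + 3 * X - 2 * A3))"
    unfolding K_def pair_slope_def X_def Y_def A2_def A3_def S2_def S3_def by algebra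
  ultimately have "K \<le> 0" using s(2) by argo
  then have "w i * w j * pair_slope (psum ?R w 1) (psum ?R w 2) (psum ?R w 3) \<le> 0"
    unfolding r1 r[of 2] r[of 3] K_def p_def q_def using ab by (auto simp: a_def b_def intro!: mult_nonneg_nonpos)
  then show ?thesis using core_merge[OF w ij] by linarith
qed

text \<open>Near the maximum the slope is negative for tiny weights, so merging these reduces to boundedly many parts
  and leaves the large weights untouched.\<close>

lemma core_reduce:
  assumes "weighting I w" "1 / 20 \<le> core I w"
  shows "\<exists>J w'. weighting J w' \<and> card J \<le> 402 \<and> core I w \<le> core J w' \<and> J \<subseteq> I \<and>
     (\<forall>j\<in>J. w' j > 1 / 200 \<longrightarrow> w' j = w j)"
  using assms
proof (induction "card I" arbitrary: I w rule: less_induct)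
  case less
  have fin: "finite I" using less.prems by (simp add: weighting_def)
  show ?case
  proof (cases "card I \<le> 402")
    case True
    then show ?thesis using less.prems by blast
  next
    case False
    \<comment> \<open>At most 400 weights exceed \<open>1 / 400\<close>, so more than 402 parts
      include two that can be merged.\<close>
    define B where "B = {i\<in>I. w i > 1 / 400}"
    have "real (card B) * (1 / 400) = (\<Sum>i\<in>B. 1 / 400)" by simp
    also have "\<dots> \<le> sum w B" by (intro sum_mono) (auto simp: B_def)
    also have "\<dots> \<le> sum w I" using less.prems fin by (intro sum_mono2) (auto simp: B_def weighting_def)
    finally have "card B \<le> 400" using less.prems by (simp add: weighting_def)
    moreover have "card (I - B) = card I - card B"
      by (rule card_Diff_subset) (use fin in \<open>auto simp: B_def intro: finite_subset\<close>)
    ultimately have "2 \<le> card (I - B)" using False by simp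
    then obtain T where "T \<subseteq> I - B" "card T = 2" by (meson obtain_subset_with_card_n)
    then obtain i j where ij: "i \<in> I" "j \<in> I" "i \<noteq> j" "w i \<le> 1 / 400" "w j \<le> 1 / 400"
      by (auto simp: card_2_iff B_def)
    let ?w = "w(i := w i + w j, j := 0)"
    have W: "weighting I ?w" using less.prems ij by (intro weighting_move) (auto simp: weighting_def)
    then have W': "weighting (I - {j}) ?w"
      by (rule weighting_drop_zero) simp
    have c: "core I w \<le> core (I - {j}) ?w"
      using core_merge_small[OF less.prems ij] fin by (simp add: core_drop_zero)
    have "card (I - {j}) < card I" using fin ij by (meson card_Diff1_less)
    moreover have "1 / 20 \<le> core (I - {j}) ?w" using c less.prems by linarith
    ultimately obtain J w' where J: "weighting J w'" "card J \<le> 402"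
      "core (I - {j}) ?w \<le> core J w'" "J \<subseteq> I - {j}" "\<forall>k\<in>J. w' k > 1 / 200 \<longrightarrow> w' k = ?w k"
      using less.hyps W' by blast
    \<comment> \<open>Two weights of at most \<open>1 / 400\<close> merge to at most
      \<open>1 / 200\<close>, so the merged part never falls under the clause about large
      weights.\<close>
    have "w' k = w k" if "k \<in> J" "w' k > 1 / 200" for k
    proof -
      have "w' k = ?w k" using J that by blast
      moreover from this have "k \<noteq> i" using that ij by auto
      moreover have "k \<noteq> j" using J that by auto
      ultimately show ?thesis by simp
    qed
    moreover have "core I w \<le> core J w'" "J \<subseteq> I" using J c by auto
    ultimately show ?thesis using J by blast
  qed
qed

section \<open>Maximisers with finitely many parts\<close>

text \<open>\<open>210 / 4096 = 7 * 6 * 5 / 8 ^ 4\<close> is the value at \<open>k = 8\<close>.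
  After clearing denominators the difference has the factor \<open>x - 8\<close>; the cofactor is
  positive from \<open>x = 12\<close> on because \<open>2416 / 210 < 12\<close>, and the smaller
  \<open>k\<close> are checked one by one.\<close>

lemma turan_core_le:
  fixes k :: nat
  assumes "k \<ge> 1"
  shows "(real k - 1) * (real k - 2) * (real k - 3) / real k ^ 4 \<le> 210 / 4096"
    and "(real k - 1) * (real k - 2) * (real k - 3) / real k ^ 4 = 210 / 4096 \<Longrightarrow> k = 8"
proof -
  define x where "x = real k"
  have x: "x \<ge> 1" using assms by (simp add: x_def)
  have id: "210 * x ^ 4 - 4096 * ((x - 1) * (x - 2) * (x - 3)) = (x - 8) * (x\<^sup>2 * (210 * x - 2416) + 5248 * x - 3072)"
    by algebra
  have pos: "(x - 8) * (x\<^sup>2 * (210 * x - 2416) + 5248 * x - 3072) > 0" if "k \<noteq> 8"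
  proof (cases "k \<ge> 12")
    case True
    then have "x \<ge> 12" by (simp add: x_def)
    then have "x\<^sup>2 * (210 * x - 2416) \<ge> 0" by simp
    then show ?thesis using \<open>x \<ge> 12\<close> by (intro mult_pos_pos) linarith+
  next
    case False
    then have "k = 1 \<or> k = 2 \<or> k = 3 \<or> k = 4 \<or> k = 5 \<or> k = 6 \<or> k = 7 \<or> k = 9 \<or> k = 10 \<or> k = 11"
      using that assms by arith
    then show ?thesis unfolding x_def by (auto simp: power2_eq_square)
  qed
  have x4: "x ^ 4 > 0" using x by simp
  have 1: "4096 * ((x - 1) * (x - 2) * (x - 3)) \<le> 210 * x ^ 4"
  proof (cases "k = 8")
    case True
    then have "x = 8" by (simp add: x_def)
    then show ?thesis by simp
  next
    case False
    then show ?thesis using pos id by linarith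
  qed
  show "(real k - 1) * (real k - 2) * (real k - 3) / real k ^ 4 \<le> 210 / 4096"
    using 1 x4 unfolding x_def[symmetric] by (simp add: divide_simps)
  show "k = 8" if "(real k - 1) * (real k - 2) * (real k - 3) / real k ^ 4 = 210 / 4096"
  proof (rule ccontr)
    assume "k \<noteq> 8"
    then have "4096 * ((x - 1) * (x - 2) * (x - 3)) < 210 * x ^ 4" using pos id by linarith
    then have "(x - 1) * (x - 2) * (x - 3) / x ^ 4 < 210 / 4096"
      using x4 by (simp add: divide_simps)
    then show False using that unfolding x_def by linarith
  qed
qed

text \<open>There are \<open>k * (k - 1) * (k - 2) * (k - 3)\<close> ordered quadruples of distinct
  positive parts, each contributing \<open>1 / k ^ 5\<close>.\<close>

lemma core_uniform:
  assumes "finite I" "J \<subseteq> I" "card J = k" "k \<ge> 1" "\<And>i. i \<in> J \<Longrightarrow> w i = 1 / real k" "\<And>i. i \<in> I - J \<Longrightarrow> w i = 0"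
  shows "core I w = (real k - 1) * (real k - 2) * (real k - 3) / real k ^ 4"
proof -
  have p: "psum I w m = real k * (1 / real k) ^ m" if "m > 0" for m
  proof -
    have "psum I w m = psum J w m"
      unfolding psum_def using assms that by (intro sum.mono_neutral_right) auto
    also have "\<dots> = real k * (1 / real k) ^ m" using assms by (simp add: psum_def)
    finally show ?thesis .
  qed
  have k: "real k \<noteq> 0" using assms by simp
  define z where "z = 1 / real k"
  have kz: "real k * z = 1" using k by (simp add: z_def)
  have "core I w = core_poly z (z ^ 2) (z ^ 3) (z ^ 4)"
  proof -
    have e: "real k * z ^ m = z ^ (m - 1)" if "m > 0" for m
      using kz that by (cases m) (auto simp: mult.assoc[symmetric])
    show ?thesis unfolding core_def by (simp add: p z_def[symmetric] e)
  qed
  also have "\<dots> = (real k - 1) * (real k - 2) * (real k - 3) * z ^ 4"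
  proof -
    have "z ^ 4 * ((real k - 1) * (real k - 2) * (real k - 3)) = z * ((real k * z - z) * (real k * z - 2 * z) * (real k * z - 3 * z))"
      by algebra
    then show ?thesis unfolding kz core_poly_def by algebra
  qed
  finally show ?thesis by (simp add: z_def power_one_over field_simps)
qed

text \<open>Newton's inequality \<open>3 e\<^sub>1 e\<^sub>3 \<le> 2 e\<^sub>2 ^ 2\<close> excludes \<open>e\<^sub>1 = 5 e\<^sub>2 = 25 e\<^sub>3 > 0\<close>.\<close>

lemma newton_strict:
  assumes "finite R" "\<And>i. i \<in> R \<Longrightarrow> 0 \<le> w i"
    and r1: "r1 = psum R w 1" "r2 = psum R w 2" "r3 = psum R w 3"
    and e: "r1 = 5 * ((r1\<^sup>2 - r2) / 2)" "(r1\<^sup>2 - r2) / 2 = 5 * ((r1 ^ 3 - 3 * r1 * r2 + 2 * r3) / 6)"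
  shows "r1 = 0"
proof -
  have nn: "0 \<le> r1" "0 \<le> r2" unfolding r1 using assms by (auto intro!: psum_nonneg)
  define s where "s = sqrt r2"
  have s: "s\<^sup>2 = r2" "0 \<le> s" using nn by (auto simp: s_def)
  have le: "w i \<le> s" if "i \<in> R" for i
  proof -
    have "w i ^ 2 \<le> r2" unfolding r1 psum_def
      using assms that by (intro member_le_sum) auto
    then show ?thesis unfolding s_def by (rule real_le_rsqrt)
  qed
  \<comment> \<open>No weight exceeds \<open>s = sqrt r2\<close>. Together with
    \<open>2 * r1 * s \<le> r1^2 + r2\<close> this gives \<open>N\<close>, which is Newton's
    inequality written in power sums.\<close>
  have "r3 \<le> s * r2"
    unfolding r1 psum_def sum_distrib_left
  proof (rule sum_mono)
    fix i assume "i \<in> R"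
    then have "w i * (w i)\<^sup>2 \<le> s * (w i)\<^sup>2" using le by (intro mult_right_mono) auto
    then show "w i ^ 3 \<le> s * (w i)\<^sup>2" by (simp add: power3_eq_cube power2_eq_square mult.assoc)
  qed
  then have "r1 * r3 \<le> r1 * (s * r2)" using nn by (intro mult_left_mono)
  moreover have "0 \<le> r2 * (r1 - s)\<^sup>2" using nn by simp
  then have "2 * (r1 * (s * r2)) \<le> r1\<^sup>2 * r2 + r2\<^sup>2"
    unfolding power2_diff s(1) by (simp add: algebra_simps power2_eq_square)
  ultimately have N: "2 * (r1 * r3) \<le> r1\<^sup>2 * r2 + r2\<^sup>2" by linarith
  have r2: "r2 = r1\<^sup>2 - 2 / 5 * r1" using e(1) by simp
  have r3: "r3 = r1 ^ 3 - 3 / 5 * r1\<^sup>2 + 3 / 25 * r1"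
    using e unfolding r2 by (simp add: power2_eq_square power3_eq_cube algebra_simps)
  have "r1\<^sup>2 * r2 + r2\<^sup>2 - 2 * (r1 * r3) = - (2 / 25) * r1\<^sup>2"
    unfolding r2 r3 by (simp add: power2_eq_square power3_eq_cube algebra_simps)
  then have "r1\<^sup>2 \<le> 0" using N by linarith
  then show ?thesis by simp
qed

definition slope :: "'a set \<Rightarrow> ('a \<Rightarrow> real) \<Rightarrow> 'a \<Rightarrow> 'a \<Rightarrow> real" where
  "slope I w i j = pair_slope (psum (I-{i}-{j}) w 1) (psum (I-{i}-{j}) w 2) (psum (I-{i}-{j}) w 3)"

lemma core_move:
  assumes "weighting I w" "i \<in> I" "j \<in> I" "i \<noteq> j" "0 \<le> a" "0 \<le> b" "a + b = w i + w j"
  shows "core I (w(i := a, j := b)) = core I w + (a * b - w i * w j) * slope I w i j"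
proof -
  let ?w = "w(i := a, j := b)"
  have W: "weighting I ?w" by (rule weighting_move) fact+
  have "slope I ?w i j = slope I w i j"
    by (auto simp: slope_def psum_def intro!: arg_cong3[where f=pair_slope] sum.cong)
  moreover have "core I ?w = core I (?w(i := ?w i + ?w j, j := 0)) + ?w i * ?w j * slope I ?w i j"
    unfolding slope_def by (rule core_merge) (use assms W in auto)
  moreover have "?w(i := ?w i + ?w j, j := 0) = w(i := w i + w j, j := 0)"
    using assms by (auto simp: fun_eq_iff)
  moreover have "core I w = core I (w(i := w i + w j, j := 0)) + w i * w j * slope I w i j"
    unfolding slope_def by (rule core_merge) (use assms in auto)
  ultimately show ?thesis using assms by (simp add: algebra_simps)
qed

definition core_max :: "'a set \<Rightarrow> ('a \<Rightarrow> real) \<Rightarrow> bool" where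
  "core_max I w \<longleftrightarrow> weighting I w \<and> (\<forall>w'. weighting I w' \<longrightarrow> core I w' \<le> core I w)"

text \<open>Two distinct positive weights can be equalised, which raises their product, or merged,
  which lowers it. Since \<open>core\<close> is affine in the product, a nonzero slope would make
  one of the two moves an improvement.\<close>

lemma core_max_slope:
  assumes "core_max I w" "i \<in> I" "j \<in> I" "w i \<noteq> w j" "0 < w i" "0 < w j"
  shows "slope I w i j = 0"
proof -
  define a where "a = (w i + w j) / 2"
  have ne: "i \<noteq> j" using assms by auto
  have W: "weighting I w" using assms by (simp add: core_max_def)
  have "weighting I (w(i := a, j := a))"
    using assms by (intro weighting_move[OF W _ _ ne]) (auto simp: a_def)
  then have "core I (w(i := a, j := a)) \<le> core I w"
    using assms(1) unfolding core_max_def by blast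
  then have 1: "(a * a - w i * w j) * slope I w i j \<le> 0"
    using core_move[OF W assms(2,3) ne, of a a] assms by (simp add: a_def)
  have "a * a - w i * w j = ((w i - w j) / 2) ^ 2" by (simp add: a_def power2_eq_square field_simps)
  then have "a * a - w i * w j > 0" using assms by simp
  then have "slope I w i j \<le> 0" using 1 by (simp add: mult_le_0_iff)
  have "weighting I (w(i := w i + w j, j := 0))"
    using assms by (intro weighting_move[OF W _ _ ne]) auto
  then have "core I (w(i := w i + w j, j := 0)) \<le> core I w"
    using assms(1) unfolding core_max_def by blast
  then have "0 \<le> w i * w j * slope I w i j"
    using core_move[OF W assms(2,3) ne, of "w i + w j" 0] assms by simp
  moreover have "w i * w j > 0" using assms by simp
  ultimately have "slope I w i j \<ge> 0" by (simp add: zero_le_mult_iff)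
  then show ?thesis using \<open>slope I w i j \<le> 0\<close> by simp
qed

text \<open>Every term of \<open>core\<close> needs four distinct positive parts.\<close>

lemma core_three_parts:
  assumes "finite I" "i \<in> I" "j \<in> I" "k \<in> I" "i \<noteq> j" "i \<noteq> k" "j \<noteq> k" "w i + w j + w k = 1"
    "\<And>l. l \<in> I - {i} - {j} - {k} \<Longrightarrow> w l = 0"
  shows "core I w = 0"
proof -
  have "psum I w m = w i ^ m + (w j ^ m + w k ^ m)" if "m > 0" for m
  proof -
    have "psum (I - {i} - {j} - {k}) w m = 0"
      using assms(9) that unfolding psum_def by (intro sum.neutral) auto
    then show ?thesis
      using assms psum_remove[of I i w m] psum_remove[of "I-{i}" j w m] psum_remove[of "I-{i}-{j}" k w m] by simp
  qed
  then have "core I w = core_poly (w i ^ 2 + (w j ^ 2 + w k ^ 2)) (w i ^ 3 + (w j ^ 3 + w k ^ 3))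
     (w i ^ 4 + (w j ^ 4 + w k ^ 4)) (w i ^ 5 + (w j ^ 5 + w k ^ 5))"
    by (simp add: core_def)
  moreover have "w k = 1 - w i - w j" using assms(8) by simp
  ultimately show ?thesis unfolding core_poly_def by algebra
qed

text \<open>If \<open>w i\<close> and \<open>w j\<close> differ, their slope is zero, so every
  redistribution between them is again a maximum. Against a third positive part \<open>k\<close> the
  slope must then vanish while the weight \<open>b\<close> of \<open>j\<close> varies. This slope is
  affine in \<open>b\<close>, so both of its coefficients vanish; they say
  \<open>e_1 = 5 * e_2\<close> and \<open>e_2 = 5 * e_3\<close> for the remaining weights. By
  \<open>newton_strict\<close> nothing remains, and three parts have value 0.\<close>

lemma core_max_equal:
  assumes m: "core_max I w" and c: "core I w > 0" and ij: "i \<in> I" "j \<in> I" "0 < w i" "0 < w j"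
  shows "w i = w j"
proof (rule ccontr)
  assume ne: "w i \<noteq> w j"
  then have nij: "i \<noteq> j" by auto
  have W: "weighting I w" using m by (simp add: core_max_def)
  have fin: "finite I" using W by (simp add: weighting_def)
  have "\<exists>k\<in>I. k \<noteq> i \<and> k \<noteq> j \<and> 0 < w k"
  proof (rule ccontr)
    assume neg: "\<not> ?thesis"
    then have z: "w l = 0" if "l \<in> I - {i} - {j}" for l
    proof -
      have "0 \<le> w l" using W that by (simp add: weighting_def)
      moreover have "\<not> 0 < w l" using that neg by blast
      ultimately show ?thesis by simp
    qed
    have "sum w (I - {i} - {j}) = 0" using z by (intro sum.neutral) auto
    then have 1: "w i + w j = 1" using W fin ij nij by (simp add: weighting_def sum_diff1)
    have "psum (I - {i} - {j}) w m = 0" if "m > 0" for m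
      using z that unfolding psum_def by (intro sum.neutral) auto
    then have "core I w = core_poly (w i ^ 2 + w j ^ 2) (w i ^ 3 + w j ^ 3) (w i ^ 4 + w j ^ 4) (w i ^ 5 + w j ^ 5)"
      using fin ij nij by (simp add: core_pair)
    moreover have "w j = 1 - w i" using 1 by simp
    ultimately have "core I w = 0" unfolding core_poly_def by algebra
    then show False using c by simp
  qed
  then obtain k where k: "k \<in> I" "k \<noteq> i" "k \<noteq> j" "0 < w k" by blast
  define R where "R = I - {i} - {j} - {k}"
  define r1 r2 r3 where "r1 = psum R w 1" and "r2 = psum R w 2" and "r3 = psum R w 3"
  define s where "s = w i + w j"
  have s: "s > 0" using ij by (simp add: s_def)
  have sl: "slope I w i j = 0" by (rule core_max_slope) fact+
  have aff: "pair_slope (r1 + b) (r2 + b\<^sup>2) (r3 + b ^ 3) = 0" if b: "0 \<le> b" "b < s" "s - b \<noteq> w k" for b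
  proof -
    let ?w = "w(i := s - b, j := b)"
    have W': "weighting I ?w" using W ij nij b by (intro weighting_move) (auto simp: s_def)
    moreover have "core I ?w = core I w"
      using core_move[OF W ij(1,2) nij, of "s - b" b] b sl by (simp add: s_def)
    ultimately have M: "core_max I ?w" using m by (simp add: core_max_def)
    have "slope I ?w i k = 0"
      using M by (rule core_max_slope) (use ij k b nij in auto)
    moreover have "psum (I - {i} - {k}) ?w m = psum R w m + b ^ m" for m
    proof -
      have "psum (I - {i} - {k}) ?w m = b ^ m + psum (I - {i} - {k} - {j}) ?w m"
        using fin ij k nij by (subst psum_remove[of _ j]) auto
      also have "I - {i} - {k} - {j} = R" by (auto simp: R_def)
      also have "psum R ?w m = psum R w m" by (auto simp: R_def psum_def intro!: sum.cong)
      finally show ?thesis by (simp only: add.commute)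
    qed
    ultimately show ?thesis by (simp add: slope_def r1_def r2_def r3_def)
  qed
  have pair_slope_aff: "pair_slope (r1 + b) (r2 + b\<^sup>2) (r3 + b ^ 3) = pair_slope r1 r2 r3 + b * (6 * r1 - 15 * (r1\<^sup>2 - r2))" for b
    unfolding pair_slope_def by algebra
  define t where "t = 6 * r1 - 15 * (r1\<^sup>2 - r2)"
  obtain b c where bc: "b \<noteq> c" "pair_slope r1 r2 r3 + b * t = 0" "pair_slope r1 r2 r3 + c * t = 0"
  proof -
    \<comment> \<open>The slope is known to vanish only when \<open>s - b\<close> differs from
      \<open>w k\<close>. This excludes at most one of the three values, and two zeros suffice for
      an affine function.\<close>
    have "pair_slope r1 r2 r3 + b * t = 0" if "b \<in> {0, s/4, s/2}" "s - b \<noteq> w k" for b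
      using aff[of b] s that unfolding pair_slope_aff t_def by auto
    moreover have "(s - 0 \<noteq> w k \<and> s - s/4 \<noteq> w k) \<or> (s - 0 \<noteq> w k \<and> s - s/2 \<noteq> w k) \<or> (s - s/4 \<noteq> w k \<and> s - s/2 \<noteq> w k)"
      using s by auto
    ultimately have "(pair_slope r1 r2 r3 + 0 * t = 0 \<and> pair_slope r1 r2 r3 + s/4 * t = 0) \<or> (pair_slope r1 r2 r3 + 0 * t = 0 \<and> pair_slope r1 r2 r3 + s/2 * t = 0)
       \<or> (pair_slope r1 r2 r3 + s/4 * t = 0 \<and> pair_slope r1 r2 r3 + s/2 * t = 0)" by blast
    then show ?thesis using that[of 0 "s/4"] that[of 0 "s/2"] that[of "s/4" "s/2"] s by auto
  qed
  then have "(b - c) * t = 0" unfolding left_diff_distrib by linarith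
  then have t0: "t = 0" using bc by simp
  then have k0: "pair_slope r1 r2 r3 = 0" using bc by simp
  have "r1 = 0"
  proof (rule newton_strict[of R w r1 r2 r3])
    show "r1 = 5 * ((r1\<^sup>2 - r2) / 2)" using t0 by (simp add: t_def)
    show "(r1\<^sup>2 - r2) / 2 = 5 * ((r1 ^ 3 - 3 * r1 * r2 + 2 * r3) / 6)"
      using k0 by (simp add: pair_slope_def field_simps)
  qed (use fin W in \<open>auto simp: R_def r1_def r2_def r3_def weighting_def\<close>)
  then have "sum w R = 0" by (simp add: r1_def psum_def)
  then have R0: "w l = 0" if "l \<in> R" for l
    using that W fin by (subst (asm) sum_nonneg_eq_0_iff) (auto simp: R_def weighting_def)
  have "core I w = 0"
  proof (rule core_three_parts[of I i j k])
    show "w i + w j + w k = 1"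
      using \<open>sum w R = 0\<close> W fin ij k nij by (simp add: R_def weighting_def sum_diff1)
  qed (use fin ij k nij R0 in \<open>auto simp: R_def\<close>)
  then show False using c by simp
qed

lemma core_max_structure:
  assumes m: "core_max I w" and c: "core I w \<ge> 210 / 4096"
  shows "core I w = 210 / 4096" "\<exists>J\<subseteq>I. card J = 8 \<and> (\<forall>i\<in>J. w i = 1 / 8)"
proof -
  have W: "weighting I w" using m by (simp add: core_max_def)
  have fin: "finite I" using W by (simp add: weighting_def)
  define J where "J = {i\<in>I. w i > 0}"
  define k where "k = card J"
  have s: "sum w J = 1"
  proof -
    have "sum w J = sum w I" unfolding J_def
      using fin W by (intro sum.mono_neutral_left) (auto simp: weighting_def not_less intro: antisym)
    then show ?thesis using W by (simp add: weighting_def)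
  qed
  then have "J \<noteq> {}" by auto
  then obtain i where i: "i \<in> J" by auto
  have eq: "w j = w i" if "j \<in> J" for j
    using core_max_equal[OF m _, of j i] c that i by (auto simp: J_def)
  have "k \<ge> 1" using i fin by (auto simp: k_def J_def Suc_le_eq card_gt_0_iff)
  have "sum w J = real k * w i" using eq by (simp add: k_def)
  then have wi: "w i = 1 / real k" using s \<open>k \<ge> 1\<close> by (simp add: field_simps)
  have cu: "core I w = (real k - 1) * (real k - 2) * (real k - 3) / real k ^ 4"
  proof (rule core_uniform[of I J])
    show "w j = 1 / real k" if "j \<in> J" for j using eq[OF that] wi by (rule trans)
    show "w j = 0" if "j \<in> I - J" for j
      using that W by (auto simp: J_def weighting_def not_less intro: antisym)
  qed (use fin \<open>k \<ge> 1\<close> in \<open>auto simp: J_def k_def\<close>)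
  show eq8: "core I w = 210 / 4096" using turan_core_le(1)[OF \<open>k \<ge> 1\<close>] c cu by linarith
  then have "k = 8" using turan_core_le(2)[OF \<open>k \<ge> 1\<close>] cu by simp
  have "w j = 1 / 8" if "j \<in> J" for j using eq[OF that] wi \<open>k = 8\<close> by simp
  moreover have "J \<subseteq> I" by (auto simp: J_def)
  ultimately show "\<exists>J\<subseteq>I. card J = 8 \<and> (\<forall>i\<in>J. w i = 1 / 8)"
    using \<open>k = 8\<close> unfolding k_def by blast
qed

section \<open>Compactness and stability for part weights\<close>

text \<open>Vectors are padded with zeros to all of \<open>nat\<close>, so that the simplex is a
  closed subset of a compact box in the product topology on functions.\<close>

definition prob_simplex :: "nat \<Rightarrow> (nat \<Rightarrow> real) set" where
  "prob_simplex N = {w. (\<forall>i. 0 \<le> w i) \<and> (\<forall>i\<ge>N. w i = 0) \<and> sum w {..<N} = 1}"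

lemma prob_simplex_weighting: "w \<in> prob_simplex N \<Longrightarrow> weighting {..<N} w"
  by (auto simp: prob_simplex_def weighting_def)

lemma restrict_in_prob_simplex:
  "weighting {..<N} w \<Longrightarrow> (\<lambda>i. if i < N then w i else 0) \<in> prob_simplex N"
  by (auto simp: prob_simplex_def weighting_def)

lemma core_cong: "(\<And>i. i \<in> I \<Longrightarrow> w i = w' i) \<Longrightarrow> core I w = core I w'"
  by (simp add: core_def psum_def)

lemma compact_prob_simplex: "compact (prob_simplex N)"
proof -
  define K where "K = (\<lambda>i. if i < N then {0..1::real} else {0})"
  have "compactin (product_topology (\<lambda>_. euclidean) UNIV) (PiE UNIV K)"
    unfolding compactin_PiE by (auto simp: K_def)
  then have "compact (PiE UNIV K)" by (simp add: euclidean_product_topology)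
  moreover have "closed {w. sum w {..<N} = (1::real)}"
    by (intro closed_Collect_eq continuous_intros) auto
  moreover have "prob_simplex N = PiE UNIV K \<inter> {w. sum w {..<N} = 1}"
  proof (intro set_eqI iffI)
    fix w assume w: "w \<in> prob_simplex N"
    then have "w i \<le> 1" if "i < N" for i
      using weighting_le_1[OF prob_simplex_weighting[OF w], of i] that by simp
    then show "w \<in> PiE UNIV K \<inter> {w. sum w {..<N} = 1}"
      using w by (auto simp: prob_simplex_def K_def)
  next
    fix w assume w: "w \<in> PiE UNIV K \<inter> {w. sum w {..<N} = 1}"
    then have "w i \<in> K i" for i by auto
    then show "w \<in> prob_simplex N"
      using w unfolding prob_simplex_def K_def
      by (smt (verit) IntD2 atLeastAtMost_iff empty_iff insert_iff leD mem_Collect_eq)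
  qed
  ultimately show ?thesis by (simp add: compact_Int_closed)
qed

lemma continuous_on_core: "finite I \<Longrightarrow> continuous_on S (\<lambda>w. core I (w :: 'a \<Rightarrow> real))"
  unfolding core_def core_poly_def psum_def
  by (intro continuous_intros continuous_on_product_then_coordinatewise continuous_on_id)

lemma core_attains_max:
  assumes "8 \<le> N" "K \<subseteq> prob_simplex N" "closed K" "K \<noteq> {}"
  shows "\<exists>w\<in>K. \<forall>w'\<in>K. core {..<N} w' \<le> core {..<N} w"
proof -
  have "compact K" using assms compact_prob_simplex[of N]
    by (metis compact_Int_closed inf.absorb_iff2)
  then show ?thesis using assms by (intro continuous_attains_sup continuous_on_core) auto
qed

lemma core_max_nat:
  assumes "w \<in> prob_simplex N" "\<forall>w'\<in>prob_simplex N. core {..<N} w' \<le> core {..<N} w"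
  shows "core_max {..<N} w"
  unfolding core_max_def
proof (intro conjI allI impI)
  show "weighting {..<N} w" using assms by (rule_tac prob_simplex_weighting)
  fix w' assume W: "weighting {..<N} w'"
  have "core {..<N} w' = core {..<N} (\<lambda>i. if i < N then w' i else 0)"
    by (rule core_cong) auto
  then show "core {..<N} w' \<le> core {..<N} w"
    using assms(2) restrict_in_prob_simplex[OF W] by auto
qed

text \<open>With \<open>8 \<le> N\<close> the balanced vector is available, so a maximum reaches
  \<open>210 / 4096\<close> and \<open>core_max_structure\<close> describes it. For the second
  claim, the vectors outside the open set \<open>O1\<close> around the maximisers form a compact set
  on which the maximum is strictly smaller; \<open>c\<close> is half of that gap.\<close>

lemma core_nat_bound:
  assumes N: "8 \<le> N"
  shows "w \<in> prob_simplex N \<Longrightarrow> core {..<N} w \<le> 210 / 4096"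
    and "\<eta> > 0 \<Longrightarrow> \<exists>c>0. \<forall>w\<in>prob_simplex N. core {..<N} w \<ge> 210 / 4096 - c \<longrightarrow>
      (\<exists>J\<subseteq>{..<N}. card J = 8 \<and> (\<forall>i\<in>J. \<bar>w i - 1 / 8\<bar> < \<eta>))"
proof -
  define u :: "nat \<Rightarrow> real" where "u = (\<lambda>i. if i < 8 then 1 / 8 else 0)"
  have "sum u {..<N} = sum u {..<8}"
    using N by (intro sum.mono_neutral_right) (auto simp: u_def)
  then have u: "u \<in> prob_simplex N" using N by (auto simp: prob_simplex_def u_def)
  have cu: "core {..<N} u = 210 / 4096"
    using N by (subst core_uniform[of "{..<N}" "{..<8}" 8]) (auto simp: u_def)
  have cl: "closed (prob_simplex N)" by (intro compact_imp_closed compact_prob_simplex)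
  obtain w0 where w0: "w0 \<in> prob_simplex N" "\<forall>w'\<in>prob_simplex N. core {..<N} w' \<le> core {..<N} w0"
    using core_attains_max[OF N subset_refl cl] u by blast
  have "core {..<N} w0 = 210 / 4096"
    by (rule core_max_structure(1)[OF core_max_nat[OF w0]]) (use w0(2) u cu in force)
  then show le: "core {..<N} w \<le> 210 / 4096" if "w \<in> prob_simplex N" for w using w0 that by auto
  show "\<exists>c>0. \<forall>w\<in>prob_simplex N. core {..<N} w \<ge> 210 / 4096 - c \<longrightarrow>
      (\<exists>J\<subseteq>{..<N}. card J = 8 \<and> (\<forall>i\<in>J. \<bar>w i - 1 / 8\<bar> < \<eta>))" if "\<eta> > 0"
  proof -
    define O1 where "O1 = (\<Union>J\<in>{J. J \<subseteq> {..<N} \<and> card J = 8}. \<Inter>i\<in>J. {w :: nat \<Rightarrow> real. \<bar>w i - 1 / 8\<bar> < \<eta>})"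
    have O1: "w \<in> O1 \<longleftrightarrow> (\<exists>J\<subseteq>{..<N}. card J = 8 \<and> (\<forall>i\<in>J. \<bar>w i - 1 / 8\<bar> < \<eta>))" for w
      by (auto simp: O1_def)
    have "open O1" unfolding O1_def
    proof (intro open_UN ballI open_INT)
      fix J assume "J \<in> {J. J \<subseteq> {..<N} \<and> card J = 8}"
      then show "finite J" by (auto intro: finite_subset)
    next
      fix i show "open {w :: nat \<Rightarrow> real. \<bar>w i - 1 / 8\<bar> < \<eta>}"
        by (intro open_Collect_less continuous_intros) auto
    qed
    define K where "K = prob_simplex N - O1"
    have "closed K" unfolding K_def using cl \<open>open O1\<close> by (rule closed_Diff)
    show ?thesis
    proof (cases "K = {}")
      case True
      then show ?thesis using O1 by (intro exI[of _ 1]) (auto simp: K_def)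
    next
      case False
      obtain w where w: "w \<in> K" "\<forall>w'\<in>K. core {..<N} w' \<le> core {..<N} w"
        using core_attains_max[OF N _ \<open>closed K\<close> False] by (auto simp: K_def)
      have "core {..<N} w < 210 / 4096"
      proof (rule ccontr)
        assume "\<not> ?thesis"
        then have ge: "core {..<N} w \<ge> 210 / 4096" by simp
        have "\<forall>w'\<in>prob_simplex N. core {..<N} w' \<le> core {..<N} w" using le ge by force
        then have "core_max {..<N} w" using w by (intro core_max_nat) (auto simp: K_def)
        from core_max_structure(2)[OF this ge] have "w \<in> O1" using that by (fastforce simp: O1)
        then show False using w by (simp add: K_def)
      qed
      moreover have "w' \<in> O1" if "w' \<in> prob_simplex N" "core {..<N} w' \<ge> 210 / 4096 - (210 / 4096 - core {..<N} w) / 2" for w'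
      proof (rule ccontr)
        assume "w' \<notin> O1"
        then have "core {..<N} w' \<le> core {..<N} w" using w that by (simp add: K_def)
        then show False using that \<open>core {..<N} w < 210 / 4096\<close> by argo
      qed
      ultimately show ?thesis unfolding O1
        by (intro exI[of _ "(210 / 4096 - core {..<N} w) / 2"]) auto
    qed
  qed
qed

text \<open>Parts of weight 0 change no power sum of positive exponent, so an arbitrary index set of
  bounded size can be relabelled and padded.\<close>

lemma core_transfer_nat:
  assumes W: "weighting J w" and N: "card J \<le> N"
  obtains v h where "v \<in> prob_simplex N" "core {..<N} v = core J w" "inj_on h {..<card J}" "h ` {..<card J} = J"
    "\<And>i. i < card J \<Longrightarrow> v i = w (h i)" "\<And>i. i \<ge> card J \<Longrightarrow> v i = 0"
proof -
  have fin: "finite J" using W by (simp add: weighting_def)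
  obtain h where h: "bij_betw h {..<card J} J"
    using ex_bij_betw_nat_finite[OF fin] by (auto simp: lessThan_atLeast0)
  define v where "v = (\<lambda>i. if i < card J then w (h i) else 0)"
  have sum: "(\<Sum>i<N. f (v i)) = (\<Sum>j\<in>J. f (w j))" if "f 0 = (0::real)" for f
  proof -
    have "(\<Sum>i<N. f (v i)) = (\<Sum>i<card J. f (v i))"
      using N that by (intro sum.mono_neutral_right) (auto simp: v_def)
    also have "\<dots> = (\<Sum>i<card J. f (w (h i)))" by (simp add: v_def)
    also have "\<dots> = (\<Sum>j\<in>J. f (w j))" by (rule sum.reindex_bij_betw[OF h])
    finally show ?thesis .
  qed
  have ps: "psum {..<N} v k = psum J w k" if "k > 0" for k
    unfolding psum_def using that by (intro sum) auto
  have "0 \<le> v i" for i using h W by (auto simp: v_def weighting_def bij_betw_def)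
  moreover have "sum v {..<N} = 1" using sum[of id] W by (simp add: weighting_def)
  ultimately have "v \<in> prob_simplex N" using N by (auto simp: prob_simplex_def v_def)
  moreover have "core {..<N} v = core J w" by (simp add: core_def ps)
  ultimately show ?thesis using that[of v h] h by (auto simp: bij_betw_def v_def)
qed

theorem core_le:
  assumes "weighting I w"
  shows "core I w \<le> 210 / 4096"
proof (cases "core I w \<ge> 1 / 20")
  case True
  from core_reduce[OF assms this] obtain J w' where J: "weighting J w'" "card J \<le> 402" "core I w \<le> core J w'" "J \<subseteq> I"
    by blast
  obtain v where "v \<in> prob_simplex 402" "core {..<402} v = core J w'"
    using core_transfer_nat[OF J(1,2)] by metis
  then show ?thesis using core_nat_bound(1)[of 402 v] J by simp
qed simp

text \<open>The point is that \<open>c\<close> is independent of the number of parts: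
  \<open>core_reduce\<close> passes to at most 402 parts, where compactness applies, and keeps the
  large weights.\<close>

theorem core_stable:
  assumes "\<eta> > 0"
  shows "\<exists>c>0. \<forall>(I :: 'a set) w. weighting I w \<and> core I w \<ge> 210 / 4096 - c \<longrightarrow>
    (\<exists>J\<subseteq>I. card J = 8 \<and> (\<forall>i\<in>J. \<bar>w i - 1 / 8\<bar> < \<eta>))"
proof -
  \<comment> \<open>A weight within \<open>1 / 10\<close> of \<open>1 / 8\<close> exceeds
    \<open>1 / 200\<close>, so \<open>core_reduce\<close> has left it unchanged.\<close>
  define e where "e = min \<eta> (1 / 10)"
  have e: "e > 0" "e \<le> \<eta>" "e \<le> 1 / 10" using assms by (auto simp: e_def)
  obtain c where c: "c > 0" "\<forall>w\<in>prob_simplex 402. core {..<402} w \<ge> 210 / 4096 - c \<longrightarrow>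
      (\<exists>J\<subseteq>{..<402}. card J = 8 \<and> (\<forall>i\<in>J. \<bar>w i - 1 / 8\<bar> < e))"
    using core_nat_bound(2)[of 402 e] e by auto
  \<comment> \<open>\<open>210 / 4096 - 1 / 1000\<close> is still at least \<open>1 / 20\<close>, as
    \<open>core_reduce\<close> requires.\<close>
  define d where "d = min c (1 / 1000)"
  have d: "d > 0" "d \<le> c" "d \<le> 1 / 1000" using c by (auto simp: d_def)
  have "\<exists>J\<subseteq>I. card J = 8 \<and> (\<forall>i\<in>J. \<bar>w i - 1 / 8\<bar> < \<eta>)"
    if W: "weighting I w" "core I w \<ge> 210 / 4096 - d" for I :: "'a set" and w
  proof -
    have "core I w \<ge> 1 / 20" using W d by linarith
    from core_reduce[OF W(1) this] obtain J w' where J: "weighting J w'" "card J \<le> 402" "core I w \<le> core J w'"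
      "J \<subseteq> I" "\<forall>j\<in>J. w' j > 1 / 200 \<longrightarrow> w' j = w j" by blast
    obtain v h where v: "v \<in> prob_simplex 402" "core {..<402} v = core J w'" and h: "inj_on h {..<card J}" "h ` {..<card J} = J"
      and vh: "\<And>i. i < card J \<Longrightarrow> v i = w' (h i)" "\<And>i. i \<ge> card J \<Longrightarrow> v i = 0"
      using core_transfer_nat[OF J(1,2)] by metis
    have "core {..<402} v \<ge> 210 / 4096 - c" using v J W d by linarith
    then obtain L where L: "L \<subseteq> {..<402}" "card L = 8" "\<forall>i\<in>L. \<bar>v i - 1 / 8\<bar> < e" using c v by blast
    have lt: "i < card J" if "i \<in> L" for i
    proof (rule ccontr)
      assume "\<not> i < card J"
      then have "v i = 0" using vh by simp
      then show False using L that e by force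
    qed
    show ?thesis
    proof (intro exI conjI ballI)
      show "h ` L \<subseteq> I" using lt h J by auto
      show "card (h ` L) = 8" using L lt h by (subst card_image) (auto intro: inj_on_subset)
      fix j assume "j \<in> h ` L"
      then obtain i where i: "i \<in> L" "j = h i" by auto
      have "\<bar>w' j - 1 / 8\<bar> < e" using L vh lt i by auto
      moreover from this have "w' j = w j" using J i lt h e by force
      ultimately show "\<bar>w j - 1 / 8\<bar> < \<eta>" using e by auto
    qed
  qed
  then show ?thesis using d by blast
qed

section \<open>Weighted structures\<close>

definition wsum :: "'a set \<Rightarrow> ('a \<Rightarrow> real) \<Rightarrow> ('a \<Rightarrow> real) \<Rightarrow> real" where
  "wsum V x f = (\<Sum>v\<in>V. x v * f v)"

lemma wsum_add: "wsum V x (\<lambda>v. f v + g v) = wsum V x f + wsum V x g"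
  by (simp add: wsum_def sum.distrib algebra_simps)

lemma wsum_diff: "wsum V x (\<lambda>v. f v - g v) = wsum V x f - wsum V x g"
  by (simp add: wsum_def sum_subtractf algebra_simps)

lemma wsum_cmult: "wsum V x (\<lambda>v. c * f v) = c * wsum V x f"
  by (simp add: wsum_def sum_distrib_left mult.left_commute)

lemma wsum_multc: "wsum V x (\<lambda>v. f v * c) = wsum V x f * c"
  by (simp add: wsum_def sum_distrib_right mult.assoc)

lemma wsum_const: "wsum V x (\<lambda>v. c) = c * sum x V"
  by (simp add: wsum_def sum_distrib_left mult.commute)

lemma wsum_swap: "wsum V x (\<lambda>a. wsum U y (\<lambda>b. f a b)) = wsum U y (\<lambda>b. wsum V x (\<lambda>a. f a b))"
  unfolding wsum_def sum_distrib_left by (subst sum.swap) (simp add: mult.left_commute)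

lemma wsum_cong: "(\<And>v. v \<in> V \<Longrightarrow> f v = g v) \<Longrightarrow> wsum V x f = wsum V x g"
  by (simp add: wsum_def)

text \<open>The comparison is asked only at positive weight, since minimality of a partition
  controls no other vertices.\<close>

lemma wsum_mono:
  assumes "\<And>v. v \<in> V \<Longrightarrow> 0 \<le> x v" "\<And>v. v \<in> V \<Longrightarrow> 0 < x v \<Longrightarrow> f v \<le> g v"
  shows "wsum V x f \<le> wsum V x g"
  unfolding wsum_def
proof (rule sum_mono)
  fix v assume v: "v \<in> V"
  show "x v * f v \<le> x v * g v"
  proof (cases "x v = 0")
    case False
    then have "0 < x v" using assms(1)[OF v] by simp
    then show ?thesis using assms(2)[OF v] by simp
  qed simp
qed

lemma wsum_remove: "finite V \<Longrightarrow> v \<in> V \<Longrightarrow> wsum V x f = x v * f v + wsum (V - {v}) x f"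
  by (simp add: wsum_def sum.remove)

lemma wsum_neq:
  assumes "finite V" "v \<in> V"
  shows "wsum V x (\<lambda>u. of_bool (u \<noteq> v) * f u) = wsum V x f - x v * f v"
  using assms by (simp add: wsum_remove[of V v]) (auto simp: wsum_def intro!: sum.cong)

lemma wsum_eq:
  assumes "finite V" "v \<in> V"
  shows "wsum V x (\<lambda>u. of_bool (u = v) * f u) = x v * f v"
  using assms by (simp add: wsum_remove[of V v]) (auto simp: wsum_def intro!: sum.neutral)

lemma wsum_poly:
  "wsum V x (\<lambda>v. c0 + c1 * x v + c2 * x v ^ 2 + c3 * x v ^ 3 + c4 * x v ^ 4)
    = c0 * psum V x 1 + c1 * psum V x 2 + c2 * psum V x 3 + c3 * psum V x 4 + c4 * psum V x 5"
proof -
  have "wsum V x (\<lambda>v. x v ^ n) = psum V x (Suc n)" for n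
    by (simp add: wsum_def psum_def)
  from this[of 0] this[of 1] this[of 2] this[of 3] this[of 4] show ?thesis
    by (simp add: wsum_add wsum_cmult wsum_const psum_def power2_eq_square)
qed

section \<open>Five-fold sums and their symmetry\<close>

definition wsum5 :: "'a set \<Rightarrow> ('a \<Rightarrow> real) \<Rightarrow> ('a \<Rightarrow> 'a \<Rightarrow> 'a \<Rightarrow> 'a \<Rightarrow> 'a \<Rightarrow> real) \<Rightarrow> real" where
  "wsum5 V x f = wsum V x (\<lambda>a. wsum V x (\<lambda>b. wsum V x (\<lambda>c. wsum V x (\<lambda>d. wsum V x (\<lambda>e. f a b c d e)))))"

lemma wsum5_swap12: "wsum5 V x (\<lambda>a b c d e. f b a c d e) = wsum5 V x f"
  unfolding wsum5_def by (rule wsum_swap)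

lemma wsum5_swap23: "wsum5 V x (\<lambda>a b c d e. f a c b d e) = wsum5 V x f"
  unfolding wsum5_def by (rule wsum_cong, rule wsum_swap)

lemma wsum5_swap34: "wsum5 V x (\<lambda>a b c d e. f a b d c e) = wsum5 V x f"
  unfolding wsum5_def by (rule wsum_cong, rule wsum_cong, rule wsum_swap)

lemma wsum5_swap45: "wsum5 V x (\<lambda>a b c d e. f a b c e d) = wsum5 V x f"
  unfolding wsum5_def by (rule wsum_cong, rule wsum_cong, rule wsum_cong, rule wsum_swap)

text \<open>With this and \<open>wsum5_pair\<close>, a sum over the five positions of a special
  vertex, or over the ten positions of a special pair, becomes a multiple of a single sum.\<close>

lemma wsum5_first:
  "wsum5 V x (\<lambda>a b c d e. f b a c d e) = wsum5 V x f"
  "wsum5 V x (\<lambda>a b c d e. f c a b d e) = wsum5 V x f"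
  "wsum5 V x (\<lambda>a b c d e. f d a b c e) = wsum5 V x f"
  "wsum5 V x (\<lambda>a b c d e. f e a b c d) = wsum5 V x f"
proof -
  show 1: "wsum5 V x (\<lambda>a b c d e. f b a c d e) = wsum5 V x f" for f
    by (rule wsum5_swap12)
  show 2: "wsum5 V x (\<lambda>a b c d e. f c a b d e) = wsum5 V x f" for f
    using wsum5_swap23[of V x "\<lambda>a b c d e. f b a c d e"] 1[of f] by simp
  show 3: "wsum5 V x (\<lambda>a b c d e. f d a b c e) = wsum5 V x f" for f
    using wsum5_swap34[of V x "\<lambda>a b c d e. f c a b d e"] 2[of f] by simp
  show 4: "wsum5 V x (\<lambda>a b c d e. f e a b c d) = wsum5 V x f" for f
    using wsum5_swap45[of V x "\<lambda>a b c d e. f d a b c e"] 3[of f] by simp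
qed

lemma wsum5_pair:
  "wsum5 V x (\<lambda>a b c d e. f a c b d e) = wsum5 V x f"
  "wsum5 V x (\<lambda>a b c d e. f a d b c e) = wsum5 V x f"
  "wsum5 V x (\<lambda>a b c d e. f a e b c d) = wsum5 V x f"
  "wsum5 V x (\<lambda>a b c d e. f b c a d e) = wsum5 V x f"
  "wsum5 V x (\<lambda>a b c d e. f b d a c e) = wsum5 V x f"
  "wsum5 V x (\<lambda>a b c d e. f b e a c d) = wsum5 V x f"
  "wsum5 V x (\<lambda>a b c d e. f c d a b e) = wsum5 V x f"
  "wsum5 V x (\<lambda>a b c d e. f c e a b d) = wsum5 V x f"
  "wsum5 V x (\<lambda>a b c d e. f d e a b c) = wsum5 V x f"
proof -
  show 1: "wsum5 V x (\<lambda>a b c d e. f a c b d e) = wsum5 V x f" for f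
    by (rule wsum5_swap23)
  show 2: "wsum5 V x (\<lambda>a b c d e. f a d b c e) = wsum5 V x f" for f
    using wsum5_swap34[of V x "\<lambda>a b c d e. f a c b d e"] 1[of f] by simp
  show 3: "wsum5 V x (\<lambda>a b c d e. f a e b c d) = wsum5 V x f" for f
    using wsum5_swap45[of V x "\<lambda>a b c d e. f a d b c e"] 2[of f] by simp
  show 4: "wsum5 V x (\<lambda>a b c d e. f b c a d e) = wsum5 V x f" for f
    using wsum5_swap12[of V x "\<lambda>a b c d e. f a c b d e"] 1[of f] by simp
  show 5: "wsum5 V x (\<lambda>a b c d e. f b d a c e) = wsum5 V x f" for f
    using wsum5_swap12[of V x "\<lambda>a b c d e. f a d b c e"] 2[of f] by simp
  show 6: "wsum5 V x (\<lambda>a b c d e. f b e a c d) = wsum5 V x f" for f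
    using wsum5_swap12[of V x "\<lambda>a b c d e. f a e b c d"] 3[of f] by simp
  show 7: "wsum5 V x (\<lambda>a b c d e. f c d a b e) = wsum5 V x f" for f
    using wsum5_swap23[of V x "\<lambda>a b c d e. f b d a c e"] 5[of f] by simp
  show 8: "wsum5 V x (\<lambda>a b c d e. f c e a b d) = wsum5 V x f" for f
    using wsum5_swap23[of V x "\<lambda>a b c d e. f b e a c d"] 6[of f] by simp
  show 9: "wsum5 V x (\<lambda>a b c d e. f d e a b c) = wsum5 V x f" for f
    using wsum5_swap34[of V x "\<lambda>a b c d e. f c e a b d"] 8[of f] by simp
qed

text \<open>Power-sum form of the sums over tuples of distinct indices.\<close>

definition T2 where "T2 V x = (psum V x 1)\<^sup>2 - psum V x 2"
definition T3 where "T3 V x = psum V x 1 ^ 3 - 3 * psum V x 1 * psum V x 2 + 2 * psum V x 3"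
definition T4 where "T4 V x = psum V x 1 ^ 4 - 6 * (psum V x 1)\<^sup>2 * psum V x 2 + 3 * (psum V x 2)\<^sup>2
   + 8 * psum V x 1 * psum V x 3 - 6 * psum V x 4"

context
  fixes V :: "'a set" and x :: "'a \<Rightarrow> real"
  assumes fin: "finite V"
begin

private abbreviation (input) "S \<equiv> wsum V x"
private abbreviation (input) "p \<equiv> psum V x"

lemma wsum_distinct2:
  assumes "a \<in> V"
  shows "S (\<lambda>b. of_bool (b \<noteq> a)) = p 1 - x a"
  using wsum_neq[OF fin assms, of x "\<lambda>_. 1"] by (simp add: wsum_const psum_def)

lemma wsum_neq2:
  assumes "a \<in> V" "b \<in> V" "a \<noteq> b"
  shows "S (\<lambda>c. of_bool (c \<noteq> a \<and> c \<noteq> b) * f c) = S f - x a * f a - x b * f b"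
proof -
  have "S (\<lambda>c. of_bool (c \<noteq> a \<and> c \<noteq> b) * f c) = S (\<lambda>c. of_bool (c \<noteq> a) * (of_bool (c \<noteq> b) * f c))"
    by (rule wsum_cong) auto
  then show ?thesis using assms by (simp add: wsum_neq[OF fin])
qed

lemma wsum_distinct4:
  assumes "a \<in> V" "b \<in> V" "c \<in> V"
  shows "S (\<lambda>d. of_bool (distinct [a, b, c, d])) = of_bool (distinct [a, b, c]) * (p 1 - x a - x b - x c)"
proof (cases "distinct [a, b, c]")
  case True
  have "S (\<lambda>d. of_bool (distinct [a, b, c, d])) = S (\<lambda>d. of_bool (d \<noteq> a \<and> d \<noteq> b) * of_bool (d \<noteq> c))"
    using True by (intro wsum_cong) auto
  also have "\<dots> = p 1 - x a - x b - x c"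
    using True assms wsum_distinct2[OF assms(3)] by (subst wsum_neq2) auto
  finally show ?thesis using True by simp
next
  case False
  then show ?thesis by (auto simp: wsum_def)
qed

lemma wsum_distinct3:
  assumes "a \<in> V" "b \<in> V"
  shows "S (\<lambda>c. of_bool (distinct [a, b, c]) * f c) = of_bool (b \<noteq> a) * (S f - x a * f a - x b * f b)"
proof (cases "a = b")
  case False
  then have "S (\<lambda>c. of_bool (distinct [a, b, c]) * f c) = S (\<lambda>c. of_bool (c \<noteq> a \<and> c \<noteq> b) * f c)"
    by (intro wsum_cong) auto
  then show ?thesis using False assms by (simp add: wsum_neq2)
next
  case True
  then show ?thesis by (auto simp: wsum_def)
qed

lemma sum_distinct3_inner:
  assumes "a \<in> V"
  shows "S (\<lambda>b. S (\<lambda>c. of_bool (distinct [a, b, c]))) = ((p 1)\<^sup>2 - p 2) + (- 2 * p 1) * x a + 2 * x a ^ 2 + 0 * x a ^ 3 + 0 * x a ^ 4"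
proof -
  have "S (\<lambda>b. S (\<lambda>c. of_bool (distinct [a, b, c]))) = S (\<lambda>b. of_bool (b \<noteq> a) * (p 1 - x a - x b))"
    using wsum_distinct3[OF assms, of _ "\<lambda>_. 1"] by (intro wsum_cong) (simp add: wsum_const psum_def)
  also have "\<dots> = S (\<lambda>b. p 1 - x a - x b) - x a * (p 1 - x a - x a)" by (rule wsum_neq[OF fin assms])
  also have "S (\<lambda>b. p 1 - x a - x b) = S (\<lambda>b. (p 1 - x a) + (-1) * x b + 0 * x b ^ 2 + 0 * x b ^ 3 + 0 * x b ^ 4)"
    by simp
  also have "\<dots> = (p 1 - x a) * p 1 - p 2" by (subst wsum_poly) simp
  finally show ?thesis by (simp add: power2_eq_square algebra_simps)
qed

lemma sum_distinct3: "S (\<lambda>a. S (\<lambda>b. S (\<lambda>c. of_bool (distinct [a, b, c])))) = T3 V x"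
  and sum_sq_distinct3: "S (\<lambda>a. x a * S (\<lambda>b. S (\<lambda>c. of_bool (distinct [a, b, c]))))
    = (p 1)\<^sup>2 * p 2 - 2 * p 1 * p 3 + 2 * p 4 - (p 2)\<^sup>2"
proof -
  have "S (\<lambda>a. S (\<lambda>b. S (\<lambda>c. of_bool (distinct [a, b, c])))) = S (\<lambda>a. ((p 1)\<^sup>2 - p 2) + (- 2 * p 1) * x a + 2 * x a ^ 2 + 0 * x a ^ 3 + 0 * x a ^ 4)"
    by (rule wsum_cong) (rule sum_distinct3_inner)
  also have "\<dots> = T3 V x" unfolding wsum_poly T3_def by algebra
  finally show "S (\<lambda>a. S (\<lambda>b. S (\<lambda>c. of_bool (distinct [a, b, c])))) = T3 V x" .
  have "S (\<lambda>a. x a * S (\<lambda>b. S (\<lambda>c. of_bool (distinct [a, b, c])))) = S (\<lambda>a. 0 + ((p 1)\<^sup>2 - p 2) * x a + (- 2 * p 1) * x a ^ 2 + 2 * x a ^ 3 + 0 * x a ^ 4)"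
    by (rule wsum_cong) (simp only: sum_distinct3_inner, simp add: power2_eq_square power3_eq_cube algebra_simps)
  also have "\<dots> = (p 1)\<^sup>2 * p 2 - 2 * p 1 * p 3 + 2 * p 4 - (p 2)\<^sup>2" unfolding wsum_poly by algebra
  finally show "S (\<lambda>a. x a * S (\<lambda>b. S (\<lambda>c. of_bool (distinct [a, b, c]))))
    = (p 1)\<^sup>2 * p 2 - 2 * p 1 * p 3 + 2 * p 4 - (p 2)\<^sup>2" .
qed

lemma sum_distinct4_inner:
  assumes a: "a \<in> V"
  shows "S (\<lambda>b. S (\<lambda>c. S (\<lambda>d. of_bool (distinct [a, b, c, d])))) =
    p 1 ^ 3 - 3 * p 1 * p 2 + 2 * p 3 + (3 * p 2 - 3 * (p 1)\<^sup>2) * x a + 6 * p 1 * x a ^ 2 + (- 6) * x a ^ 3 + 0 * x a ^ 4"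
proof -
  define Q where "Q s t = (p 1 - s - t) * p 1 - p 2 - s * (p 1 - s - t - s) - t * (p 1 - s - t - t)" for s t
  have 1: "S (\<lambda>c. S (\<lambda>d. of_bool (distinct [a, b, c, d]))) = of_bool (b \<noteq> a) * Q (x a) (x b)"
    if b: "b \<in> V" for b
  proof -
    have "S (\<lambda>c. S (\<lambda>d. of_bool (distinct [a, b, c, d]))) = S (\<lambda>c. of_bool (distinct [a, b, c]) * (p 1 - x a - x b - x c))"
      using wsum_distinct4[OF a b] by (intro wsum_cong) simp
    also have "\<dots> = of_bool (b \<noteq> a) * (S (\<lambda>c. p 1 - x a - x b - x c) - x a * (p 1 - x a - x b - x a) - x b * (p 1 - x a - x b - x b))"
      by (rule wsum_distinct3[OF a b])
    also have "S (\<lambda>c. p 1 - x a - x b - x c) = S (\<lambda>c. (p 1 - x a - x b) + (-1) * x c + 0 * x c ^ 2 + 0 * x c ^ 3 + 0 * x c ^ 4)"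
      by simp
    also have "\<dots> = (p 1 - x a - x b) * p 1 - p 2" by (subst wsum_poly) simp
    finally show ?thesis by (simp add: Q_def)
  qed
  have "S (\<lambda>b. S (\<lambda>c. S (\<lambda>d. of_bool (distinct [a, b, c, d])))) = S (\<lambda>b. of_bool (b \<noteq> a) * Q (x a) (x b))"
    by (rule wsum_cong) (rule 1)
  also have "\<dots> = S (\<lambda>b. Q (x a) (x b)) - x a * Q (x a) (x a)" by (rule wsum_neq[OF fin a])
  also have "S (\<lambda>b. Q (x a) (x b)) = S (\<lambda>b. ((p 1 - x a) * p 1 - p 2 - x a * (p 1 - 2 * x a)) + (2 * x a - 2 * p 1) * x b + 2 * x b ^ 2 + 0 * x b ^ 3 + 0 * x b ^ 4)"
    unfolding Q_def by (rule wsum_cong) algebra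
  finally show ?thesis unfolding wsum_poly Q_def by algebra
qed

lemma sum_distinct4: "S (\<lambda>a. S (\<lambda>b. S (\<lambda>c. S (\<lambda>d. of_bool (distinct [a, b, c, d]))))) = T4 V x"
proof -
  have "S (\<lambda>a. S (\<lambda>b. S (\<lambda>c. S (\<lambda>d. of_bool (distinct [a, b, c, d]))))) =
    S (\<lambda>a. (p 1 ^ 3 - 3 * p 1 * p 2 + 2 * p 3) + (3 * p 2 - 3 * (p 1)\<^sup>2) * x a + 6 * p 1 * x a ^ 2 + (- 6) * x a ^ 3 + 0 * x a ^ 4)"
    by (rule wsum_cong) (simp only: sum_distinct4_inner)
  also have "\<dots> = T4 V x" unfolding wsum_poly T4_def by algebra
  finally show ?thesis .
qed

text \<open>Identifies the power-sum polynomial \<open>core\<close> with a sum over distinct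
  indices.\<close>

lemma sum_sq_distinct4:
  assumes "p 1 = 1"
  shows "S (\<lambda>a. x a * S (\<lambda>b. S (\<lambda>c. S (\<lambda>d. of_bool (distinct [a, b, c, d]))))) = core V x"
proof -
  have "S (\<lambda>a. x a * S (\<lambda>b. S (\<lambda>c. S (\<lambda>d. of_bool (distinct [a, b, c, d]))))) =
    S (\<lambda>a. 0 + (p 1 ^ 3 - 3 * p 1 * p 2 + 2 * p 3) * x a + (3 * p 2 - 3 * (p 1)\<^sup>2) * x a ^ 2 + 6 * p 1 * x a ^ 3 + (- 6) * x a ^ 4)"
    by (rule wsum_cong) (simp only: sum_distinct4_inner, algebra)
  also have "\<dots> = core V x"
    unfolding wsum_poly core_def core_poly_def assms by (simp add: algebra_simps power2_eq_square)
  finally show ?thesis .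
qed

end

text \<open>In applications \<open>R\<close> is non-adjacency, which is reflexive: repeated vertices count as non-adjacent.\<close>

definition coinc :: "('a \<Rightarrow> 'a \<Rightarrow> bool) \<Rightarrow> 'a \<Rightarrow> 'a \<Rightarrow> 'a \<Rightarrow> 'a \<Rightarrow> 'a \<Rightarrow> nat" where
  "coinc R a b c d e = of_bool (R a b) + of_bool (R a c) + of_bool (R a d) + of_bool (R a e) + of_bool (R b c)
     + of_bool (R b d) + of_bool (R b e) + of_bool (R c d) + of_bool (R c e) + of_bool (R d e)"

definition dens :: "'a set \<Rightarrow> ('a \<Rightarrow> real) \<Rightarrow> ('a \<Rightarrow> 'a \<Rightarrow> bool) \<Rightarrow> real" where
  "dens V x R = wsum5 V x (\<lambda>a b c d e. of_bool (coinc R a b c d e = 1))"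

text \<open>Equality is transitive, so two coincidences sharing a vertex force a third. A single
  coincidence therefore means one repeated value and four distinct values, and the ten alternatives
  exclude each other.\<close>

lemma coinc_eq_1:
  "of_bool (coinc (=) a b c d e = 1) = (of_bool (a = b \<and> distinct [a, c, d, e]) + of_bool (a = c \<and> distinct [a, b, d, e])
    + of_bool (a = d \<and> distinct [a, b, c, e]) + of_bool (a = e \<and> distinct [a, b, c, d]) + of_bool (b = c \<and> distinct [b, a, d, e])
    + of_bool (b = d \<and> distinct [b, a, c, e]) + of_bool (b = e \<and> distinct [b, a, c, d]) + of_bool (c = d \<and> distinct [c, a, b, e])
    + of_bool (c = e \<and> distinct [c, a, b, d]) + of_bool (d = e \<and> distinct [d, a, b, c]) :: real)"
  unfolding coinc_def
  by (cases "a = b"; cases "a = c"; cases "a = d"; cases "a = e"; cases "b = c"; cases "b = d"; cases "b = e";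
      cases "c = d"; cases "c = e"; cases "d = e"; simp)

lemma wsum5_add: "wsum5 V x (\<lambda>a b c d e. f a b c d e + g a b c d e) = wsum5 V x f + wsum5 V x g"
  by (simp add: wsum5_def wsum_add)

lemma dens_eq_core:
  assumes "weighting V x"
  shows "dens V x (=) = 10 * core V x"
proof -
  have fin: "finite V" using assms by (simp add: weighting_def)
  have p1: "psum V x 1 = 1" using assms by (simp add: psum_def weighting_def)
  define F where "F a b c d e = (of_bool (a = b \<and> distinct [a, c, d, e]) :: real)" for a b c d e :: 'a
  have "dens V x (=) = wsum5 V x (\<lambda>a b c d e. F a b c d e + F a c b d e + F a d b c e + F a e b c d + F b c a d e
     + F b d a c e + F b e a c d + F c d a b e + F c e a b d + F d e a b c)"
    unfolding dens_def coinc_eq_1 F_def ..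
  also have "\<dots> = 10 * wsum5 V x F"
    unfolding wsum5_add wsum5_pair[of V x F] by simp
  also have "wsum5 V x F = core V x"
  proof -
    have "wsum V x (\<lambda>b. wsum V x (\<lambda>c. wsum V x (\<lambda>d. wsum V x (\<lambda>e. F a b c d e))))
       = x a * wsum V x (\<lambda>b. wsum V x (\<lambda>c. wsum V x (\<lambda>d. of_bool (distinct [a, b, c, d]))))" if "a \<in> V" for a
    proof -
      have "wsum V x (\<lambda>b. wsum V x (\<lambda>c. wsum V x (\<lambda>d. wsum V x (\<lambda>e. F a b c d e)))) =
        wsum V x (\<lambda>b. of_bool (b = a) * wsum V x (\<lambda>c. wsum V x (\<lambda>d. wsum V x (\<lambda>e. of_bool (distinct [a, c, d, e])))))"
        by (rule wsum_cong) (auto simp: F_def wsum_def)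
      then show ?thesis by (simp only: wsum_eq[OF fin that])
    qed
    then have "wsum5 V x F = wsum V x (\<lambda>a. x a * wsum V x (\<lambda>b. wsum V x (\<lambda>c. wsum V x (\<lambda>d. of_bool (distinct [a, b, c, d])))))"
      unfolding wsum5_def by (rule wsum_cong)
    then show ?thesis using sum_sq_distinct4[OF fin p1] by simp
  qed
  finally show ?thesis .
qed

section \<open>A vertex attached to eight equal parts\<close>

text \<open>At a 0/1 vector with \<open>s\<close> ones every power sum is \<open>s\<close>, and the
  last bracket is \<open>(s - 7)^2\<close>. Equality holds at \<open>s = 7\<close>, a vertex joined
  to all parts but one. The coefficient 42 is limited by \<open>s = 0\<close>, where the left-hand
  side is \<open>42 * 49\<close>.\<close>

lemma T_bound_vertex:
  fixes s :: nat
  assumes "s \<le> 8"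
  shows "26 * (real s ^ 3 - 3 * real s * real s + 2 * real s)
     - 4 * (real s ^ 4 - 6 * (real s)\<^sup>2 * real s + 3 * (real s)\<^sup>2 + 8 * real s * real s - 6 * real s)
     + 42 * ((real s)\<^sup>2 - real s - 13 * real s + 49) \<le> 2100"
proof -
  have "s = 0 \<or> s = 1 \<or> s = 2 \<or> s = 3 \<or> s = 4 \<or> s = 5 \<or> s = 6 \<or> s = 7 \<or> s = 8" using assms by arith
  then show ?thesis by (auto simp: power2_eq_square)
qed

text \<open>The left-hand side is affine in every coordinate, so it suffices to look at the vertices of the cube.\<close>

lemma T_bound:
  assumes "\<And>i. i < 8 \<Longrightarrow> 0 \<le> y i \<and> y i \<le> 1"
  shows "26 * T3 {..<8::nat} y - 4 * T4 {..<8} y + 42 * (T2 {..<8} y - 13 * psum {..<8} y 1 + 49) \<le> 2100"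
proof -
  define G where "G y = 26 * T3 {..<8::nat} y - 4 * T4 {..<8} y + 42 * (T2 {..<8} y - 13 * psum {..<8} y 1 + 49)" for y
  have aff: "G (y(i := t)) = G (y(i := 0)) + t * (G (y(i := 1)) - G (y(i := 0)))" if "i < 8" for y i t
  proof -
    have ps: "psum {..<8} (y(i := t)) k = t ^ k + psum ({..<8} - {i}) y k" for k t
      using that psum_remove[of "{..<8}" i "y(i := t)" k] by (simp add: psum_upd_notin)
    show ?thesis unfolding G_def T2_def T3_def T4_def ps
      by (simp add: algebra_simps power2_eq_square power3_eq_cube power4_eq_xxxx)
  qed
  have "G y \<le> 2100" if "\<forall>i<8. 0 \<le> y i \<and> y i \<le> 1" "card {i. i < 8 \<and> y i \<noteq> 0 \<and> y i \<noteq> 1} = n" for n y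
    using that
  proof (induction n arbitrary: y rule: less_induct)
    case (less n)
    show ?case
    proof (cases "\<exists>i<8. y i \<noteq> 0 \<and> y i \<noteq> 1")
      case True
      then obtain i where i: "i < 8" "y i \<noteq> 0" "y i \<noteq> 1" by auto
      have *: "G (y(i := t)) \<le> 2100" if t: "t = 0 \<or> t = 1" for t
      proof (rule less.IH[OF _ _ refl])
        have "{j. j < 8 \<and> (y(i := t)) j \<noteq> 0 \<and> (y(i := t)) j \<noteq> 1} \<subset> {j. j < 8 \<and> y j \<noteq> 0 \<and> y j \<noteq> 1}"
          using i t by (auto split: if_splits)
        then show "card {j. j < 8 \<and> (y(i := t)) j \<noteq> 0 \<and> (y(i := t)) j \<noteq> 1} < n"
          unfolding less.prems(2)[symmetric] by (intro psubset_card_mono) auto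
      qed (use less.prems t in auto)
      have "G y = G (y(i := 0)) + y i * (G (y(i := 1)) - G (y(i := 0)))"
        using aff[OF i(1), of y "y i"] by simp
      also have "\<dots> = (1 - y i) * G (y(i := 0)) + y i * G (y(i := 1))" by (simp add: algebra_simps)
      also have "\<dots> \<le> (1 - y i) * 2100 + y i * 2100"
        using less.prems i * by (intro add_mono mult_left_mono) auto
      finally show ?thesis by simp
    next
      case False
      define s where "s = card {i. i < 8 \<and> y i = 1}"
      have ps: "psum {..<8} y k = real s" if "k > 0" for k
      proof -
        have "psum {..<8} y k = (\<Sum>i\<in>{..<8}. of_bool (y i = 1))"
          unfolding psum_def using False that by (intro sum.cong) (auto simp: zero_power)
        also have "\<dots> = real (card ({..<8} \<inter> {i. y i = 1}))" by (simp add: sum.If_cases of_bool_def)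
        also have "{..<8} \<inter> {i. y i = 1} = {i. i < 8 \<and> y i = 1}" by auto
        finally show ?thesis by (simp add: s_def)
      qed
      have "s \<le> card {..<8::nat}" unfolding s_def by (intro card_mono) auto
      then show ?thesis using T_bound_vertex[of s] by (simp add: G_def T2_def T3_def T4_def ps)
    qed
  qed
  then show ?thesis using assms unfolding G_def by blast
qed

text \<open>The quadratic form is \<open>(Y - 7)^2\<close> plus the sum of
  \<open>y i * (1 - y i)\<close>, where \<open>Y\<close> is the coordinate sum. A coordinate
  strictly between \<open>9 / 1000\<close> and \<open>991 / 1000\<close> would contribute more than
  \<open>1 / 250\<close>, and \<open>Y\<close> near 7 leaves room for exactly seven coordinates near
  1.\<close>

lemma near_part_vector:
  assumes y: "\<And>i. i < 8 \<Longrightarrow> 0 \<le> y i \<and> y i \<le> 1"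
    and Q: "T2 {..<8::nat} y - 13 * psum {..<8} y 1 + 49 < 1 / 250"
  shows "\<exists>j<8. y j \<le> 9 / 1000 \<and> (\<forall>i<8. i \<noteq> j \<longrightarrow> 991 / 1000 \<le> y i)"
proof -
  define Y where "Y = psum {..<8} y 1"
  have Q': "T2 {..<8::nat} y - 13 * psum {..<8} y 1 + 49 = (Y - 7)\<^sup>2 + (\<Sum>i<8. y i * (1 - y i))"
    by (simp add: T2_def Y_def psum_def sum_subtractf power2_eq_square algebra_simps)
  have nn: "0 \<le> y i * (1 - y i)" if "i < 8" for i using y[OF that] by simp
  have "0 \<le> (\<Sum>i<8. y i * (1 - y i))" using nn by (intro sum_nonneg) auto
  \<comment> \<open>\<open>64 / 1000\<close> is slightly above the square root of
    \<open>1 / 250\<close>.\<close>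
  then have "(Y - 7)\<^sup>2 < (64 / 1000)\<^sup>2" using Q Q' by (simp add: power2_eq_square)
  then have "\<bar>Y - 7\<bar>\<^sup>2 < (64 / 1000)\<^sup>2" by (simp only: power2_abs)
  then have "\<bar>Y - 7\<bar> < 64 / 1000" by (rule power2_less_imp_less) simp
  then have Y: "6936 / 1000 < Y" "Y < 7064 / 1000" by linarith+
  have ext: "y i \<le> 9 / 1000 \<or> 991 / 1000 \<le> y i" if i: "i < 8" for i
  proof (rule ccontr)
    assume "\<not> ?thesis"
    then have "0 < (y i - 9 / 1000) * (991 / 1000 - y i)" by simp
    moreover have "(y i - 9 / 1000) * (991 / 1000 - y i) = y i * (1 - y i) - 9 / 1000 * (991 / 1000)"
      by (simp add: field_simps)
    ultimately have "y i * (1 - y i) > 9 / 1000 * (991 / 1000)" by linarith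
    moreover have "y i * (1 - y i) \<le> (\<Sum>i<8. y i * (1 - y i))" using nn i by (intro member_le_sum) auto
    moreover have "0 \<le> (Y - 7)\<^sup>2" by simp
    ultimately show False using Q Q' by linarith
  qed
  define S where "S = {i. i < 8 \<and> 991 / 1000 \<le> y i}"
  have S: "S \<subseteq> {..<8}" "finite S" by (auto simp: S_def)
  have Ysplit: "Y = sum y S + sum y ({..<8} - S)"
    using S by (simp add: Y_def psum_def sum.subset_diff[of S "{..<8}"])
  have cS: "card S \<le> 8" using card_mono[OF _ S(1)] by simp
  have cD: "real (card ({..<8} - S)) = 8 - real (card S)"
    using cS S by (simp add: card_Diff_subset of_nat_diff)
  have "sum y S \<le> (\<Sum>i\<in>S. 1)" using y by (intro sum_mono) (auto simp: S_def)
  moreover have "sum y ({..<8} - S) \<le> (\<Sum>i\<in>{..<8} - S. 9 / 1000)" using ext by (intro sum_mono) (auto simp: S_def)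
  ultimately have up: "Y \<le> real (card S) + (8 - real (card S)) * (9 / 1000)" using Ysplit cD by (simp add: field_simps)
  have "(\<Sum>i\<in>S. 991 / 1000) \<le> sum y S" by (intro sum_mono) (auto simp: S_def)
  moreover have "0 \<le> sum y ({..<8} - S)" using y by (intro sum_nonneg) auto
  ultimately have lo: "real (card S) * (991 / 1000) \<le> Y" using Ysplit by (simp add: field_simps)
  have "card S > 6"
  proof (rule ccontr)
    assume "\<not> card S > 6"
    then have "real (card S) \<le> 6" by simp
    then show False using up Y by argo
  qed
  moreover have "card S < 8"
  proof (rule ccontr)
    assume "\<not> card S < 8"
    then have "real (card S) \<ge> 8" by simp
    then show False using lo Y by argo
  qed
  ultimately have "card S = 7" by simp
  then have "card ({..<8} - S) = 1" using S by (simp add: card_Diff_subset)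
  then obtain j where j: "{..<8} - S = {j}" by (auto simp: card_1_singleton_iff)
  then have "j < 8" "j \<notin> S" by auto
  moreover have "i \<in> S" if "i < 8" "i \<noteq> j" for i using j that by blast
  ultimately show ?thesis using ext[of j] by (intro exI[of _ j]) (auto simp: S_def)
qed

text \<open>The Boolean says whether a vertex of part \<open>i\<close> is non-adjacent to a fixed vertex, and \<open>y i\<close> is the adjacent
  fraction of that part.\<close>

definition avg :: "(nat \<Rightarrow> real) \<Rightarrow> (nat \<Rightarrow> bool \<Rightarrow> real) \<Rightarrow> real" where
  "avg y f = (wsum {..<8} y (\<lambda>i. f i False) + wsum {..<8} (\<lambda>i. 1 - y i) (\<lambda>i. f i True)) / 8"

definition c4 :: "'a \<Rightarrow> 'a \<Rightarrow> 'a \<Rightarrow> 'a \<Rightarrow> nat" where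
  "c4 i j k l = of_bool (i = j) + of_bool (i = k) + of_bool (i = l) + of_bool (j = k) + of_bool (j = l) + of_bool (k = l)"

text \<open>Indicator that a fixed vertex and four vertices from parts \<open>i, j, k, l\<close>
  have exactly one non-adjacent pair. The Booleans record non-adjacency to the fixed vertex, and
  \<open>c4\<close> counts the non-adjacent pairs among the four.\<close>

definition Phi :: "'a \<Rightarrow> bool \<Rightarrow> 'a \<Rightarrow> bool \<Rightarrow> 'a \<Rightarrow> bool \<Rightarrow> 'a \<Rightarrow> bool \<Rightarrow> real" where
  "Phi i \<alpha> j \<beta> k \<gamma> l \<delta> = of_bool (c4 i j k l + of_bool \<alpha> + of_bool \<beta> + of_bool \<gamma> + of_bool \<delta> = 1)"

lemma c4_eq_0: "c4 i j k l = 0 \<longleftrightarrow> distinct [i, j, k, l]"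
  by (auto simp: c4_def)

lemma Phi_0: "Phi i False j False k False l False = of_bool (c4 i j k l = 1)"
  by (simp add: Phi_def)

lemma Phi_1:
  "Phi i True j False k False l False = of_bool (distinct [i, j, k, l])"
  "Phi i False j True k False l False = of_bool (distinct [i, j, k, l])"
  "Phi i False j False k True l False = of_bool (distinct [i, j, k, l])"
  "Phi i False j False k False l True = of_bool (distinct [i, j, k, l])"
  unfolding Phi_def c4_eq_0[symmetric] by simp_all

lemma Phi_2:
  "Phi i True j True k \<gamma> l \<delta> = 0" "Phi i True j \<beta> k True l \<delta> = 0" "Phi i True j \<beta> k \<gamma> l True = 0"
  "Phi i \<alpha> j True k True l \<delta> = 0" "Phi i \<alpha> j True k \<gamma> l True = 0" "Phi i \<alpha> j \<beta> k True l True = 0"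
  by (simp_all add: Phi_def)

lemma wsum_zero: "wsum V x (\<lambda>v. 0) = 0"
  by (simp add: wsum_def)

lemma wsum_divide: "wsum V x (\<lambda>v. f v / c) = wsum V x f / c"
  by (simp add: wsum_def sum_divide_distrib)

lemma c4_eq_1:
  "of_bool (c4 i j k l = 1) = (of_bool (i = j \<and> distinct [i, k, l]) + of_bool (i = k \<and> distinct [i, j, l])
    + of_bool (i = l \<and> distinct [i, j, k]) + of_bool (j = k \<and> distinct [j, i, l])
    + of_bool (j = l \<and> distinct [j, i, k]) + of_bool (k = l \<and> distinct [k, i, j]) :: real)"
  unfolding c4_def
  by (cases "i = j"; cases "i = k"; cases "i = l"; cases "j = k"; cases "j = l"; cases "k = l"; simp)

lemma sum_c4_eq_1:
  assumes fin: "finite V"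
  shows "wsum V x (\<lambda>i. wsum V x (\<lambda>j. wsum V x (\<lambda>k. wsum V x (\<lambda>l. of_bool (c4 i j k l = 1)))))
    = 6 * ((psum V x 1)\<^sup>2 * psum V x 2 - 2 * psum V x 1 * psum V x 3 + 2 * psum V x 4 - (psum V x 2)\<^sup>2)"
proof -
  define F where "F i j k l = (of_bool (i = j \<and> distinct [i, k, l]) :: real)" for i j k l :: 'a
  define S where "S f = wsum V x (\<lambda>i. wsum V x (\<lambda>j. wsum V x (\<lambda>k. wsum V x (\<lambda>l. f i j k l))))" for f :: "'a \<Rightarrow> 'a \<Rightarrow> 'a \<Rightarrow> 'a \<Rightarrow> real"
  have add: "S (\<lambda>i j k l. f i j k l + g i j k l) = S f + S g" for f g by (simp add: S_def wsum_add)
  have s12: "S (\<lambda>i j k l. f j i k l) = S f" for f unfolding S_def by (rule wsum_swap)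
  have s23: "S (\<lambda>i j k l. f i k j l) = S f" for f unfolding S_def by (rule wsum_cong, rule wsum_swap)
  have s34: "S (\<lambda>i j k l. f i j l k) = S f" for f unfolding S_def by (rule wsum_cong, rule wsum_cong, rule wsum_swap)
  have 1: "S (\<lambda>i j k l. f i k j l) = S f" for f by (rule s23)
  have 2: "S (\<lambda>i j k l. f i l j k) = S f" for f using s34[of "\<lambda>i j k l. f i k j l"] 1 by simp
  have 3: "S (\<lambda>i j k l. f j k i l) = S f" for f using s12[of "\<lambda>i j k l. f i k j l"] 1 by simp
  have 4: "S (\<lambda>i j k l. f j l i k) = S f" for f using s12[of "\<lambda>i j k l. f i l j k"] 2 by simp
  have 5: "S (\<lambda>i j k l. f k l i j) = S f" for f using s23[of "\<lambda>i j k l. f j l i k"] 4 by simp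
  have "S (\<lambda>i j k l. of_bool (c4 i j k l = 1)) = S (\<lambda>i j k l. F i j k l + F i k j l + F i l j k + F j k i l + F j l i k + F k l i j)"
    unfolding c4_eq_1 F_def ..
  also have "\<dots> = 6 * S F" unfolding add 1[of F] 2[of F] 3[of F] 4[of F] 5[of F] by simp
  also have "S F = wsum V x (\<lambda>i. x i * wsum V x (\<lambda>k. wsum V x (\<lambda>l. of_bool (distinct [i, k, l]))))"
    unfolding S_def
  proof (rule wsum_cong)
    fix i assume i: "i \<in> V"
    have "wsum V x (\<lambda>j. wsum V x (\<lambda>k. wsum V x (\<lambda>l. F i j k l))) =
      wsum V x (\<lambda>j. of_bool (j = i) * wsum V x (\<lambda>k. wsum V x (\<lambda>l. of_bool (distinct [i, k, l]))))"
      by (rule wsum_cong) (auto simp: F_def wsum_def)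
    then show "wsum V x (\<lambda>j. wsum V x (\<lambda>k. wsum V x (\<lambda>l. F i j k l))) =
      x i * wsum V x (\<lambda>k. wsum V x (\<lambda>l. of_bool (distinct [i, k, l])))"
      by (simp only: wsum_eq[OF fin i])
  qed
  also have "\<dots> = (psum V x 1)\<^sup>2 * psum V x 2 - 2 * psum V x 1 * psum V x 3 + 2 * psum V x 4 - (psum V x 2)\<^sup>2"
    by (rule sum_sq_distinct3[OF fin])
  finally show ?thesis by (simp add: S_def)
qed

text \<open>The sum of \<open>y i ^ 2 * y j * y k\<close> over distinct
  \<open>i, j, k\<close>.\<close>

definition X4 where "X4 y = (psum {..<8::nat} y 1)\<^sup>2 * psum {..<8} y 2 - 2 * psum {..<8} y 1 * psum {..<8} y 3
   + 2 * psum {..<8} y 4 - (psum {..<8} y 2)\<^sup>2"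

text \<open>Either the non-adjacent pair contains the fixed vertex: then the four parts are distinct
  and one of the four vertices is its non-neighbour, which gives \<open>4 * (5 * T3 - T4)\<close>.
  Or it is one of the six pairs among the four, which gives \<open>6 * X4\<close>. The denominator
  is \<open>8 ^ 4\<close>.\<close>

lemma avg_Phi:
  "avg y (\<lambda>i \<alpha>. avg y (\<lambda>j \<beta>. avg y (\<lambda>k \<gamma>. avg y (\<lambda>l \<delta>. Phi i \<alpha> j \<beta> k \<gamma> l \<delta>))))
    = (4 * (5 * T3 {..<8} y - T4 {..<8} y) + 6 * X4 y) / 4096"
proof -
  let ?I = "{..<8::nat}"
  let ?S = "wsum ?I y" and ?Z = "wsum ?I (\<lambda>i. 1 - y i)"
  define D where "D i j k l = (of_bool (distinct [i, j, k, l]) :: real)" for i j k l :: nat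
  have Z: "?Z f = wsum ?I (\<lambda>_. 1) f - ?S f" for f
    by (simp add: wsum_def sum_subtractf left_diff_distrib)
  have base: "?S (\<lambda>i. ?S (\<lambda>j. ?S (\<lambda>k. ?Z (\<lambda>l. D i j k l)))) = 5 * T3 ?I y - T4 ?I y"
  proof -
    \<comment> \<open>Three distinct parts leave five for the fourth vertex.\<close>
    have 1: "wsum ?I (\<lambda>_. 1) (\<lambda>l. D i j k l) = of_bool (distinct [i, j, k]) * 5"
      if "i \<in> ?I" "j \<in> ?I" "k \<in> ?I" for i j k
      using wsum_distinct4[of ?I i j k "\<lambda>_. 1"] that by (simp add: D_def psum_def)
    have "?S (\<lambda>i. ?S (\<lambda>j. ?S (\<lambda>k. ?Z (\<lambda>l. D i j k l))))
      = ?S (\<lambda>i. ?S (\<lambda>j. ?S (\<lambda>k. of_bool (distinct [i, j, k]) * 5 - ?S (\<lambda>l. D i j k l))))"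
      unfolding Z by (intro wsum_cong) (simp add: 1)
    also have "\<dots> = ?S (\<lambda>i. ?S (\<lambda>j. ?S (\<lambda>k. of_bool (distinct [i, j, k])))) * 5 - ?S (\<lambda>i. ?S (\<lambda>j. ?S (\<lambda>k. ?S (\<lambda>l. D i j k l))))"
      by (simp only: wsum_diff wsum_multc)
    also have "\<dots> = T3 ?I y * 5 - T4 ?I y"
      unfolding D_def by (simp only: sum_distinct3[OF finite_lessThan] sum_distinct4[OF finite_lessThan])
    finally show ?thesis by simp
  qed
  have D: "D i j k l = D i j l k" "D i j k l = D i k j l" "D i j k l = D j i k l" for i j k l
    by (auto simp: D_def)
  have z3: "?S (\<lambda>i. ?S (\<lambda>j. ?Z (\<lambda>k. ?S (\<lambda>l. D i j k l)))) = 5 * T3 ?I y - T4 ?I y"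
  proof -
    have "?S (\<lambda>i. ?S (\<lambda>j. ?Z (\<lambda>k. ?S (\<lambda>l. D i j k l)))) = ?S (\<lambda>i. ?S (\<lambda>j. ?S (\<lambda>l. ?Z (\<lambda>k. D i j l k))))"
      by (rule wsum_cong, rule wsum_cong, subst wsum_swap, intro wsum_cong, rule D(1))
    then show ?thesis using base by simp
  qed
  have z2: "?S (\<lambda>i. ?Z (\<lambda>j. ?S (\<lambda>k. ?S (\<lambda>l. D i j k l)))) = 5 * T3 ?I y - T4 ?I y"
  proof -
    have "?S (\<lambda>i. ?Z (\<lambda>j. ?S (\<lambda>k. ?S (\<lambda>l. D i j k l)))) = ?S (\<lambda>i. ?S (\<lambda>k. ?Z (\<lambda>j. ?S (\<lambda>l. D i k j l))))"
      by (rule wsum_cong, subst wsum_swap, intro wsum_cong, rule D(2))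
    then show ?thesis using z3 by simp
  qed
  have z1: "?Z (\<lambda>i. ?S (\<lambda>j. ?S (\<lambda>k. ?S (\<lambda>l. D i j k l)))) = 5 * T3 ?I y - T4 ?I y"
  proof -
    have "?Z (\<lambda>i. ?S (\<lambda>j. ?S (\<lambda>k. ?S (\<lambda>l. D i j k l)))) = ?S (\<lambda>j. ?Z (\<lambda>i. ?S (\<lambda>k. ?S (\<lambda>l. D j i k l))))"
      by (subst wsum_swap, intro wsum_cong, rule D(3))
    then show ?thesis using z2 by simp
  qed
  have c1: "?S (\<lambda>i. ?S (\<lambda>j. ?S (\<lambda>k. ?S (\<lambda>l. of_bool (c4 i j k l = 1))))) = 6 * X4 y"
    unfolding X4_def by (rule sum_c4_eq_1) simp
  show ?thesis
    unfolding avg_def Phi_0 Phi_1 Phi_2 D_def[symmetric] wsum_add wsum_divide wsum_zero base z1 z2 z3 c1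
    by (simp add: field_simps)
qed

text \<open>Replacing the square \<open>y a ^ 2\<close> by \<open>y a\<close> turns the value in
  \<open>avg_Phi\<close> into \<open>26 * T3 - 4 * T4\<close>, which is affine in each coordinate as
  \<open>T_bound\<close> needs. Nothing is lost at 0/1 vectors.\<close>

lemma X4_le_T3:
  assumes "\<And>i. i < 8 \<Longrightarrow> 0 \<le> y i \<and> y i \<le> 1"
  shows "X4 y \<le> T3 {..<8} y"
proof -
  let ?I = "{..<8::nat}"
  have "X4 y = wsum ?I y (\<lambda>a. y a * wsum ?I y (\<lambda>b. wsum ?I y (\<lambda>c. of_bool (distinct [a, b, c]))))"
    unfolding X4_def by (rule sum_sq_distinct3[symmetric]) simp
  also have "\<dots> \<le> wsum ?I y (\<lambda>a. wsum ?I y (\<lambda>b. wsum ?I y (\<lambda>c. of_bool (distinct [a, b, c]))))"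
    using assms unfolding wsum_def
    by (intro sum_mono mult_left_mono mult_left_le_one_le sum_nonneg mult_nonneg_nonneg) auto
  also have "\<dots> = T3 ?I y" by (rule sum_distinct3) simp
  finally show ?thesis .
qed

lemma avg_Phi_le:
  assumes "\<And>i. i < 8 \<Longrightarrow> 0 \<le> y i \<and> y i \<le> 1"
  shows "avg y (\<lambda>i \<alpha>. avg y (\<lambda>j \<beta>. avg y (\<lambda>k \<gamma>. avg y (\<lambda>l \<delta>. Phi i \<alpha> j \<beta> k \<gamma> l \<delta>))))
    \<le> (2100 - 42 * (T2 {..<8} y - 13 * psum {..<8} y 1 + 49)) / 4096"
proof -
  have "26 * T3 {..<8::nat} y - 4 * T4 {..<8} y + 42 * (T2 {..<8} y - 13 * psum {..<8} y 1 + 49) \<le> 2100"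
    by (rule T_bound) (rule assms)
  moreover have "X4 y \<le> T3 {..<8} y" by (rule X4_le_T3) (rule assms)
  ultimately show ?thesis unfolding avg_Phi by (intro divide_right_mono) auto
qed

lemma avg_Phi_part:
  assumes "j < 8"
  shows "avg (\<lambda>i. of_bool (i \<noteq> j)) (\<lambda>i \<alpha>. avg (\<lambda>i. of_bool (i \<noteq> j)) (\<lambda>j' \<beta>. avg (\<lambda>i. of_bool (i \<noteq> j))
    (\<lambda>k \<gamma>. avg (\<lambda>i. of_bool (i \<noteq> j)) (\<lambda>l \<delta>. Phi i \<alpha> j' \<beta> k \<gamma> l \<delta>)))) = 2100 / 4096"
proof -
  have "psum {..<8} (\<lambda>i. of_bool (i \<noteq> j)) k = 7" if "k > 0" for k
  proof -
    have "psum {..<8} (\<lambda>i. of_bool (i \<noteq> j)) k = (\<Sum>i\<in>{..<8} - {j}. 1)"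
      unfolding psum_def using assms that
      by (subst sum.remove[of _ j]) (auto simp: zero_power intro!: sum.cong)
    then show ?thesis using assms by simp
  qed
  then show ?thesis unfolding avg_Phi by (simp add: X4_def T3_def T4_def)
qed

section \<open>Partitions into eight nearly equal parts\<close>

lemma wsum_sum: "wsum V x (\<lambda>v. \<Sum>i\<in>I. f i v) = (\<Sum>i\<in>I. wsum V x (f i))"
  unfolding wsum_def sum_distrib_left by (rule sum.swap)

lemma wsum_nonneg: "(\<And>v. v \<in> V \<Longrightarrow> 0 \<le> x v) \<Longrightarrow> (\<And>v. v \<in> V \<Longrightarrow> 0 \<le> f v) \<Longrightarrow> 0 \<le> wsum V x f"
  by (simp add: wsum_def sum_nonneg)

text \<open>The tolerance makes it cheap to treat the parts as equal: four samples cost at most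
  \<open>32 / 10000000\<close>, whereas a badly attached vertex loses about
  \<open>42 / 250 / 4096\<close>, roughly \<open>4 / 100000\<close>.\<close>

locale partition_near_uniform =
  fixes V :: "'a set" and x :: "'a \<Rightarrow> real" and \<pi> :: "'a \<Rightarrow> nat"
  assumes W: "weighting V x" and part: "v \<in> V \<Longrightarrow> \<pi> v < 8"
    and near: "i < 8 \<Longrightarrow> \<bar>wsum V x (\<lambda>u. of_bool (\<pi> u = i)) - 1 / 8\<bar> \<le> 1 / 10000000"
begin

lemma x0: "v \<in> V \<Longrightarrow> 0 \<le> x v" and x1: "sum x V = 1"
  using W by (auto simp: weighting_def)

abbreviation E :: "('a \<Rightarrow> real) \<Rightarrow> real" where "E \<equiv> wsum V x"

lemma E_const [simp]: "E (\<lambda>_. c) = c"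
  by (simp add: wsum_const x1)

lemma E_close:
  assumes "\<And>v. v \<in> V \<Longrightarrow> \<bar>f v - g v\<bar> \<le> e"
  shows "\<bar>E f - E g\<bar> \<le> e"
proof -
  have le: "f v - g v \<le> e" "- e \<le> f v - g v" if "v \<in> V" for v
    using assms[OF that] by (auto simp: abs_le_iff)
  have "E (\<lambda>v. f v - g v) \<le> E (\<lambda>_. e)" by (rule wsum_mono) (use x0 le in auto)
  moreover have "E (\<lambda>_. - e) \<le> E (\<lambda>v. f v - g v)" by (rule wsum_mono) (use x0 le in auto)
  ultimately show ?thesis by (simp add: wsum_diff abs_le_iff)
qed

definition wt :: "nat \<Rightarrow> real" where "wt i = E (\<lambda>u. of_bool (\<pi> u = i))"

definition afrac :: "('a \<Rightarrow> bool) \<Rightarrow> nat \<Rightarrow> real" where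
  "afrac a i = E (\<lambda>u. of_bool (\<pi> u = i \<and> \<not> a u)) / wt i"

lemma wt_near: "i < 8 \<Longrightarrow> \<bar>wt i - 1 / 8\<bar> \<le> 1 / 10000000"
  using near by (simp add: wt_def)

lemma wt_pos: "i < 8 \<Longrightarrow> 0 < wt i"
  using wt_near[of i] by linarith

lemma afrac_bounds:
  assumes "i < 8"
  shows "0 \<le> afrac a i" "afrac a i \<le> 1"
proof -
  have "0 \<le> E (\<lambda>u. of_bool (\<pi> u = i \<and> \<not> a u))" by (rule wsum_nonneg) (auto simp: x0)
  moreover have "E (\<lambda>u. of_bool (\<pi> u = i \<and> \<not> a u)) \<le> wt i"
    unfolding wt_def by (rule wsum_mono) (auto simp: x0)
  ultimately show "0 \<le> afrac a i" "afrac a i \<le> 1" using wt_pos[OF assms] by (auto simp: afrac_def)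
qed

lemma E_push:
  "E (\<lambda>u. f (\<pi> u) (a u)) = (\<Sum>i<8. wt i * (afrac a i * f i False + (1 - afrac a i) * f i True))"
proof -
  have "E (\<lambda>u. f (\<pi> u) (a u)) = E (\<lambda>u. \<Sum>i<8. of_bool (\<pi> u = i \<and> \<not> a u) * f i False + (of_bool (\<pi> u = i) - of_bool (\<pi> u = i \<and> \<not> a u)) * f i True)"
  proof (rule wsum_cong)
    fix u assume u: "u \<in> V"
    have "(\<Sum>i<8. of_bool (\<pi> u = i \<and> \<not> a u) * f i False + (of_bool (\<pi> u = i) - of_bool (\<pi> u = i \<and> \<not> a u)) * f i True)
      = (\<Sum>i<8. if i = \<pi> u then f (\<pi> u) (a u) else 0)"
      by (rule sum.cong) auto
    also have "\<dots> = f (\<pi> u) (a u)" using part[OF u] by simp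
    finally show "f (\<pi> u) (a u) = (\<Sum>i<8. of_bool (\<pi> u = i \<and> \<not> a u) * f i False + (of_bool (\<pi> u = i) - of_bool (\<pi> u = i \<and> \<not> a u)) * f i True)" ..
  qed
  also have "\<dots> = (\<Sum>i<8. E (\<lambda>u. of_bool (\<pi> u = i \<and> \<not> a u)) * f i False + (wt i - E (\<lambda>u. of_bool (\<pi> u = i \<and> \<not> a u))) * f i True)"
    by (simp only: wsum_sum wsum_add wsum_multc wsum_diff wt_def)
  also have "\<dots> = (\<Sum>i<8. wt i * (afrac a i * f i False + (1 - afrac a i) * f i True))"
  proof (rule sum.cong)
    fix i :: nat assume "i \<in> {..<8}"
    then have "E (\<lambda>u. of_bool (\<pi> u = i \<and> \<not> a u)) = wt i * afrac a i"
      using wt_pos[of i] by (simp add: afrac_def)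
    then show "E (\<lambda>u. of_bool (\<pi> u = i \<and> \<not> a u)) * f i False + (wt i - E (\<lambda>u. of_bool (\<pi> u = i \<and> \<not> a u))) * f i True
      = wt i * (afrac a i * f i False + (1 - afrac a i) * f i True)"
      by (simp add: algebra_simps)
  qed simp
  finally show ?thesis .
qed

lemma mix_bound:
  fixes t u v :: real
  assumes "0 \<le> t" "t \<le> 1" "\<bar>u\<bar> \<le> 1" "\<bar>v\<bar> \<le> 1"
  shows "\<bar>t * u + (1 - t) * v\<bar> \<le> 1"
proof -
  have "\<bar>t * u + (1 - t) * v\<bar> \<le> t * \<bar>u\<bar> + (1 - t) * \<bar>v\<bar>"
    using assms abs_triangle_ineq[of "t * u" "(1 - t) * v"] by (simp add: abs_mult)
  also have "\<dots> \<le> t * 1 + (1 - t) * 1" using assms by (intro add_mono mult_left_mono) auto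
  finally show ?thesis by simp
qed

lemma avg_alt: "avg y f = (\<Sum>i<8. 1 / 8 * (y i * f i False + (1 - y i) * f i True))"
  by (simp add: avg_def wsum_def sum.distrib flip: sum_divide_distrib)

lemma avg_afrac_bounded:
  assumes "\<And>i \<alpha>. i < 8 \<Longrightarrow> \<bar>f i \<alpha>\<bar> \<le> 1"
  shows "\<bar>avg (afrac a) f\<bar> \<le> 1"
proof -
  have "\<bar>avg (afrac a) f\<bar> \<le> (\<Sum>i<8::nat. \<bar>1 / 8 * (afrac a i * f i False + (1 - afrac a i) * f i True)\<bar>)"
    unfolding avg_alt by (rule sum_abs)
  also have "\<dots> \<le> (\<Sum>i<8::nat. 1 / 8)"
  proof (rule sum_mono)
    fix i :: nat assume "i \<in> {..<8}"
    then have i: "i < 8" by simp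
    have "\<bar>afrac a i * f i False + (1 - afrac a i) * f i True\<bar> \<le> 1"
      by (intro mix_bound afrac_bounds[OF i] assms[OF i])
    then show "\<bar>1 / 8 * (afrac a i * f i False + (1 - afrac a i) * f i True)\<bar> \<le> 1 / 8"
      by (simp add: abs_mult)
  qed
  finally show ?thesis by simp
qed

lemma E_avg:
  assumes "\<And>i \<alpha>. i < 8 \<Longrightarrow> \<bar>f i \<alpha>\<bar> \<le> 1"
  shows "\<bar>E (\<lambda>u. f (\<pi> u) (a u)) - avg (afrac a) f\<bar> \<le> 8 / 10000000"
proof -
  have "\<bar>\<Sum>i<8. (wt i - 1 / 8) * (afrac a i * f i False + (1 - afrac a i) * f i True)\<bar>
    \<le> (\<Sum>i<8. \<bar>(wt i - 1 / 8) * (afrac a i * f i False + (1 - afrac a i) * f i True)\<bar>)"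
    by (rule sum_abs)
  also have "\<dots> \<le> (\<Sum>i<8::nat. 1 / 10000000 * 1)"
  proof (rule sum_mono)
    fix i :: nat assume "i \<in> {..<8}"
    then have i: "i < 8" by simp
    have b: "\<bar>afrac a i * f i False + (1 - afrac a i) * f i True\<bar> \<le> 1"
      by (intro mix_bound afrac_bounds[OF i] assms[OF i])
    show "\<bar>(wt i - 1 / 8) * (afrac a i * f i False + (1 - afrac a i) * f i True)\<bar> \<le> 1 / 10000000 * 1"
      unfolding abs_mult by (rule mult_mono[OF wt_near[OF i] b]) auto
  qed
  finally show ?thesis
    unfolding E_push avg_alt sum_subtractf[symmetric] left_diff_distrib[symmetric] by simp
qed

text \<open>The four expectations are replaced one at a time, innermost first, each at the cost
  \<open>8 / 10000000\<close> of \<open>E_avg\<close>.\<close>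

lemma E4_avg:
  assumes "\<And>i \<alpha> j \<beta> k \<gamma> l \<delta>. \<bar>F i \<alpha> j \<beta> k \<gamma> l \<delta>\<bar> \<le> 1"
  shows "\<bar>E (\<lambda>b. E (\<lambda>c. E (\<lambda>d. E (\<lambda>e. F (\<pi> b) (a b) (\<pi> c) (a c) (\<pi> d) (a d) (\<pi> e) (a e)))))
    - avg (afrac a) (\<lambda>i \<alpha>. avg (afrac a) (\<lambda>j \<beta>. avg (afrac a) (\<lambda>k \<gamma>. avg (afrac a) (\<lambda>l \<delta>. F i \<alpha> j \<beta> k \<gamma> l \<delta>))))\<bar> \<le> 32 / 10000000"
proof -
  let ?A = "avg (afrac a)"
  have step: "\<bar>E (\<lambda>u. g (\<pi> u) (a u)) - ?A h\<bar> \<le> t + 8 / 10000000"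
    if "\<And>i \<alpha>. \<bar>g i \<alpha> - h i \<alpha>\<bar> \<le> t" "\<And>i \<alpha>. \<bar>h i \<alpha>\<bar> \<le> 1" for g h t
  proof -
    have "\<bar>E (\<lambda>u. g (\<pi> u) (a u)) - E (\<lambda>u. h (\<pi> u) (a u))\<bar> \<le> t" by (rule E_close) (rule that(1))
    moreover have "\<bar>E (\<lambda>u. h (\<pi> u) (a u)) - ?A h\<bar> \<le> 8 / 10000000" by (rule E_avg) (rule that(2))
    ultimately show ?thesis by linarith
  qed
  have 1: "\<bar>E (\<lambda>e. F i \<alpha> j \<beta> k \<gamma> (\<pi> e) (a e)) - ?A (\<lambda>l \<delta>. F i \<alpha> j \<beta> k \<gamma> l \<delta>)\<bar> \<le> 8 / 10000000" for i \<alpha> j \<beta> k \<gamma>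
    by (rule E_avg) (rule assms)
  have 2: "\<bar>E (\<lambda>d. E (\<lambda>e. F i \<alpha> j \<beta> (\<pi> d) (a d) (\<pi> e) (a e))) - ?A (\<lambda>k \<gamma>. ?A (\<lambda>l \<delta>. F i \<alpha> j \<beta> k \<gamma> l \<delta>))\<bar> \<le> 8 / 10000000 + 8 / 10000000" for i \<alpha> j \<beta>
    by (rule step[where g = "\<lambda>k \<gamma>. E (\<lambda>e. F i \<alpha> j \<beta> k \<gamma> (\<pi> e) (a e))"]) (intro 1 avg_afrac_bounded assms)+
  have 3: "\<bar>E (\<lambda>c. E (\<lambda>d. E (\<lambda>e. F i \<alpha> (\<pi> c) (a c) (\<pi> d) (a d) (\<pi> e) (a e)))) - ?A (\<lambda>j \<beta>. ?A (\<lambda>k \<gamma>. ?A (\<lambda>l \<delta>. F i \<alpha> j \<beta> k \<gamma> l \<delta>)))\<bar>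
    \<le> 8 / 10000000 + 8 / 10000000 + 8 / 10000000" for i \<alpha>
    by (rule step[where g = "\<lambda>j \<beta>. E (\<lambda>d. E (\<lambda>e. F i \<alpha> j \<beta> (\<pi> d) (a d) (\<pi> e) (a e)))"]) (intro 2 avg_afrac_bounded assms)+
  have 4: "\<bar>E (\<lambda>b. E (\<lambda>c. E (\<lambda>d. E (\<lambda>e. F (\<pi> b) (a b) (\<pi> c) (a c) (\<pi> d) (a d) (\<pi> e) (a e)))))
    - ?A (\<lambda>i \<alpha>. ?A (\<lambda>j \<beta>. ?A (\<lambda>k \<gamma>. ?A (\<lambda>l \<delta>. F i \<alpha> j \<beta> k \<gamma> l \<delta>))))\<bar> \<le> 8 / 10000000 + 8 / 10000000 + 8 / 10000000 + 8 / 10000000"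
    by (rule step[where g = "\<lambda>i \<alpha>. E (\<lambda>c. E (\<lambda>d. E (\<lambda>e. F i \<alpha> (\<pi> c) (a c) (\<pi> d) (a d) (\<pi> e) (a e))))"]) (intro 3 avg_afrac_bounded assms)+
  show ?thesis using 4 by simp
qed

text \<open>Probability that a vertex with non-neighbourhood \<open>a\<close> and four random
  vertices have exactly one non-adjacent pair, if the four see each other as in the complete partite
  structure of \<open>\<pi>\<close>.\<close>

definition psi :: "('a \<Rightarrow> bool) \<Rightarrow> real" where
  "psi a = E (\<lambda>b. E (\<lambda>c. E (\<lambda>d. E (\<lambda>e. Phi (\<pi> b) (a b) (\<pi> c) (a c) (\<pi> d) (a d) (\<pi> e) (a e)))))"

lemma psi_avg: "\<bar>psi a - avg (afrac a) (\<lambda>i \<alpha>. avg (afrac a) (\<lambda>j \<beta>. avg (afrac a) (\<lambda>k \<gamma>. avg (afrac a) (\<lambda>l \<delta>. Phi i \<alpha> j \<beta> k \<gamma> l \<delta>))))\<bar> \<le> 32 / 10000000"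
  unfolding psi_def by (rule E4_avg) (simp add: Phi_def)

lemma avg_cong: "(\<And>i. i < 8 \<Longrightarrow> y i = z i) \<Longrightarrow> avg y = avg z"
  by (intro ext) (simp add: avg_def wsum_def)

lemma psi_part: 
  assumes "j < 8"
  shows "2100 / 4096 - 32 / 10000000 \<le> psi (\<lambda>u. \<pi> u = j)"
proof -
  have "afrac (\<lambda>u. \<pi> u = j) i = of_bool (i \<noteq> j)" if "i < 8" for i
  proof (cases "i = j")
    case True
    then have "E (\<lambda>u. of_bool (\<pi> u = i \<and> \<pi> u \<noteq> j)) = E (\<lambda>_. 0)" by (intro wsum_cong) auto
    then show ?thesis using True by (simp add: afrac_def)
  next
    case False
    then have "E (\<lambda>u. of_bool (\<pi> u = i \<and> \<pi> u \<noteq> j)) = wt i" unfolding wt_def by (intro wsum_cong) auto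
    then show ?thesis using False wt_pos[OF that] by (simp add: afrac_def)
  qed
  then have eq: "avg (afrac (\<lambda>u. \<pi> u = j)) = avg (\<lambda>i. of_bool (i \<noteq> j))" by (rule avg_cong)
  show ?thesis
    using psi_avg[of "\<lambda>u. \<pi> u = j"] unfolding eq avg_Phi_part[OF assms] by linarith
qed

text \<open>On the cube the quadratic form in \<open>T_bound\<close> vanishes only at part-like
  vectors. Being far from all of them makes it at least \<open>1 / 250\<close>, which costs
  \<open>42 / 250\<close> out of 2100.\<close>

lemma psi_far:
  assumes "\<And>j. j < 8 \<Longrightarrow> 1 / 100 \<le> E (\<lambda>u. of_bool (a u \<noteq> (\<pi> u = j)))"
  shows "psi a \<le> (2100 - 42 / 250) / 4096 + 32 / 10000000"
proof -
  have y: "0 \<le> afrac a i \<and> afrac a i \<le> 1" if "i < 8" for i using afrac_bounds that by auto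
  have "1 / 250 \<le> T2 {..<8::nat} (afrac a) - 13 * psum {..<8} (afrac a) 1 + 49"
  \<comment> \<open>Otherwise \<open>near_part_vector\<close> yields a part \<open>j\<close> with
    expected disagreement at most \<open>9 / 1000 + 8 / 10000000\<close>, less than
    \<open>1 / 100\<close>.\<close>
  proof (rule ccontr)
    assume "\<not> ?thesis"
    then have "\<exists>j<8. afrac a j \<le> 9 / 1000 \<and> (\<forall>i<8. i \<noteq> j \<longrightarrow> 991 / 1000 \<le> afrac a i)"
      by (intro near_part_vector y) auto
    then obtain j where j: "j < 8" "afrac a j \<le> 9 / 1000" "\<And>i. i < 8 \<Longrightarrow> i \<noteq> j \<Longrightarrow> 991 / 1000 \<le> afrac a i" by auto
    define f :: "nat \<Rightarrow> bool \<Rightarrow> real" where "f i \<alpha> = of_bool (\<alpha> \<noteq> (i = j))" for i \<alpha>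
    have "\<bar>E (\<lambda>u. f (\<pi> u) (a u)) - avg (afrac a) f\<bar> \<le> 8 / 10000000"
      by (rule E_avg) (simp add: f_def)
    moreover have "avg (afrac a) f \<le> (\<Sum>i<8::nat. 1 / 8 * (9 / 1000))"
      unfolding avg_alt
    proof (intro sum_mono mult_left_mono)
      fix i :: nat assume "i \<in> {..<8}"
      then show "afrac a i * f i False + (1 - afrac a i) * f i True \<le> 9 / 1000"
        using j(2) j(3)[of i] by (cases "i = j") (auto simp: f_def)
    qed simp
    ultimately show False using assms[OF j(1)] by (simp add: f_def)
  qed
  moreover have "avg (afrac a) (\<lambda>i \<alpha>. avg (afrac a) (\<lambda>j \<beta>. avg (afrac a) (\<lambda>k \<gamma>. avg (afrac a) (\<lambda>l \<delta>. Phi i \<alpha> j \<beta> k \<gamma> l \<delta>))))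
    \<le> (2100 - 42 * (T2 {..<8} (afrac a) - 13 * psum {..<8} (afrac a) 1 + 49)) / 4096"
    by (rule avg_Phi_le) (rule y)
  moreover have "psi a \<le> (2100 - 42 / 250) / 4096 + 32 / 10000000"
    if "\<bar>psi a - A\<bar> \<le> 32 / 10000000" "A \<le> (2100 - 42 * Q) / 4096" "1 / 250 \<le> Q" for A Q :: real
  proof -
    have "(2100 - 42 * Q) / 4096 \<le> (2100 - 42 / 250) / 4096" using that(3) by (intro divide_right_mono) auto
    then show ?thesis using that(1,2) by linarith
  qed
  ultimately show ?thesis using psi_avg[of a] by blast
qed

end

section \<open>The loss caused by flipping one pair\<close>

text \<open>A tuple with \<open>c\<close> non-adjacent pairs, before minus after flipping one pair
  that is non-adjacent exactly if \<open>h\<close> holds. After the flip one non-adjacent pair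
  remains if \<open>c\<close> was 2 in the case \<open>h\<close>, and if \<open>c\<close> was 0
  otherwise.\<close>

definition flip_gain :: "bool \<Rightarrow> nat \<Rightarrow> real" where
  "flip_gain h c = of_bool (c = 1) - of_bool (c = (if h then 2 else 0))"

abbreviation (input) "sum8 \<equiv> wsum {..<8::nat} (\<lambda>_. 1)"

text \<open>For \<open>i = j\<close> there are \<open>7 * 6 * 5 = 210\<close> triples with no
  further coincidence, and \<open>3 * 42\<close> triples with exactly one further, which the flip
  would turn into counted ones; the difference is 84. For \<open>i \<noteq> j\<close> it is enough
  to exhibit a gain of 90.\<close>

lemma flip_gain_sum:
  assumes ij: "i < 8" "j < 8"
  shows "84 \<le> sum8 (\<lambda>k. sum8 (\<lambda>l. sum8 (\<lambda>m. flip_gain (i = j) (coinc (=) i j k l m))))"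
proof -
  have fin: "finite {..<8::nat}" by simp
  have swap: "sum8 (\<lambda>a. sum8 (\<lambda>b. f a b)) = sum8 (\<lambda>b. sum8 (\<lambda>a. f a b))" for f by (rule wsum_swap)
  have p8: "psum {..<8::nat} (\<lambda>_. 1) k = 8" for k by (simp add: psum_def)
  have eq: "sum8 (\<lambda>k. of_bool (k = l) * f k) = f l" if "l < 8" for l f
    using wsum_eq[OF fin, of l "\<lambda>_. 1" f] that by simp
  have s2: "sum8 (\<lambda>l. sum8 (\<lambda>m. of_bool (distinct [i, l, m]))) = 42"
    using sum_distinct3_inner[OF fin, of i "\<lambda>_. 1"] ij by (simp add: p8)
  show ?thesis
  proof (cases "i = j")
    case True
    have pt: "flip_gain (i = j) (coinc (=) i j k l m) = of_bool (distinct [i, k, l, m])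
       - (of_bool (l = k) * of_bool (distinct [i, k, m]) + of_bool (m = k) * of_bool (distinct [i, k, l])
          + of_bool (m = l) * of_bool (distinct [i, k, l]))" for k l m
      unfolding flip_gain_def coinc_def True
      by (cases "j = k"; cases "j = l"; cases "j = m"; cases "k = l"; cases "k = m"; cases "l = m"; simp)
    have "sum8 (\<lambda>k. sum8 (\<lambda>l. sum8 (\<lambda>m. of_bool (distinct [i, k, l, m])))) = 210"
      using sum_distinct4_inner[OF fin, of i "\<lambda>_. 1"] ij by (simp add: p8)
    moreover have "sum8 (\<lambda>k. sum8 (\<lambda>l. sum8 (\<lambda>m. of_bool (l = k) * of_bool (distinct [i, k, m])))) = 42"
    proof -
      have "sum8 (\<lambda>k. sum8 (\<lambda>l. sum8 (\<lambda>m. of_bool (l = k) * of_bool (distinct [i, k, m])))) = sum8 (\<lambda>k. sum8 (\<lambda>m. of_bool (distinct [i, k, m])))"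
        by (rule wsum_cong) (subst swap, rule wsum_cong, rule eq, simp)
      then show ?thesis using s2 by simp
    qed
    moreover have "sum8 (\<lambda>k. sum8 (\<lambda>l. sum8 (\<lambda>m. of_bool (m = k) * of_bool (distinct [i, k, l])))) = 42"
    proof -
      have "sum8 (\<lambda>k. sum8 (\<lambda>l. sum8 (\<lambda>m. of_bool (m = k) * of_bool (distinct [i, k, l])))) = sum8 (\<lambda>k. sum8 (\<lambda>l. of_bool (distinct [i, k, l])))"
        by (rule wsum_cong, rule wsum_cong, rule eq) simp
      then show ?thesis using s2 by simp
    qed
    moreover have "sum8 (\<lambda>k. sum8 (\<lambda>l. sum8 (\<lambda>m. of_bool (m = l) * of_bool (distinct [i, k, l])))) = 42"
    proof -
      have "sum8 (\<lambda>k. sum8 (\<lambda>l. sum8 (\<lambda>m. of_bool (m = l) * of_bool (distinct [i, k, l])))) = sum8 (\<lambda>k. sum8 (\<lambda>l. of_bool (distinct [i, k, l])))"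
        by (rule wsum_cong, rule wsum_cong, rule eq) simp
      then show ?thesis using s2 by simp
    qed
    ultimately show ?thesis unfolding pt by (simp only: wsum_diff wsum_add)
  next
    case False
    define D where "D k l = (of_bool (distinct [i, j, k, l]) :: real)" for k l
    \<comment> \<open>For distinct \<open>i, j, k, l\<close> the four values of \<open>m\<close>
      among them gain 1 and the other four lose 1, so these terms cancel in the sum over
      \<open>m\<close>. The three remaining families contribute 30 each.\<close>
    have pt: "D k l * (2 * (of_bool (m = i) + of_bool (m = j) + of_bool (m = k) + of_bool (m = l)) - 1)
       + of_bool (l = k) * D k m + of_bool (k = i) * D l m + of_bool (k = j) * D l m
       \<le> flip_gain (i = j) (coinc (=) i j k l m)" for k l m
    proof (cases "distinct [i, j, k, l]")
      case True
      then show ?thesis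
        by (cases "m = i"; cases "m = j"; cases "m = k"; cases "m = l") (auto simp: flip_gain_def coinc_def D_def)
    next
      case nd: False
      then have g0: "0 \<le> flip_gain (i = j) (coinc (=) i j k l m)" and D0: "D k l = 0"
        using False by (auto simp: flip_gain_def coinc_def D_def)
      consider "l = k" "distinct [i, j, k, m]" | "k = i" "distinct [i, j, l, m]" | "k = j" "distinct [i, j, l, m]"
        | "\<not> (l = k \<and> distinct [i, j, k, m])" "\<not> (k = i \<and> distinct [i, j, l, m])" "\<not> (k = j \<and> distinct [i, j, l, m])"
        by blast
      then show ?thesis
      proof cases
        case 4
        then have z: "of_bool (l = k) * D k m = 0" "of_bool (k = i) * D l m = 0" "of_bool (k = j) * D l m = 0"
          unfolding D_def by auto
        show ?thesis using g0 unfolding D0 z by simp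
      qed (auto simp: flip_gain_def coinc_def D_def)
    qed
    have sD: "sum8 (\<lambda>l. sum8 (\<lambda>m. D l m)) = 30"
    proof -
      have inner: "sum8 (\<lambda>m. D l m) = 5 * of_bool (l \<noteq> i \<and> l \<noteq> j)" if "l < 8" for l
        using wsum_distinct4[OF fin, of i j l "\<lambda>_. 1"] ij that False by (auto simp: D_def p8)
      have "sum8 (\<lambda>l. sum8 (\<lambda>m. D l m)) = sum8 (\<lambda>l. of_bool (l \<noteq> i \<and> l \<noteq> j) * 5)"
        by (rule wsum_cong) (simp add: inner)
      then show ?thesis using wsum_neq2[OF fin, of i j "\<lambda>_. 1" "\<lambda>_. 5"] ij False by (simp add: wsum_const)
    qed
    have eq1: "sum8 (\<lambda>m. of_bool (m = l)) = 1" if "l < 8" for l using eq[OF that, of "\<lambda>_. 1"] by simp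
    have t0: "sum8 (\<lambda>m. D k l * (2 * (of_bool (m = i) + of_bool (m = j) + of_bool (m = k) + of_bool (m = l)) - 1)) = 0"
      if "k < 8" "l < 8" for k l
      using that ij by (simp add: wsum_cmult wsum_diff wsum_add eq1 wsum_const)
    have t1: "sum8 (\<lambda>k. sum8 (\<lambda>l. sum8 (\<lambda>m. of_bool (l = k) * D k m))) = 30"
    proof -
      have "sum8 (\<lambda>k. sum8 (\<lambda>l. sum8 (\<lambda>m. of_bool (l = k) * D k m))) = sum8 (\<lambda>k. sum8 (\<lambda>m. D k m))"
        by (rule wsum_cong) (subst swap, rule wsum_cong, rule eq, simp)
      then show ?thesis using sD by simp
    qed
    have t2: "sum8 (\<lambda>k. sum8 (\<lambda>l. sum8 (\<lambda>m. of_bool (k = r) * D l m))) = 30" if "r < 8" for r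
      using that by (simp add: wsum_cmult sD wsum_multc eq1)
    have "84 \<le> 0 + sum8 (\<lambda>k. sum8 (\<lambda>l. sum8 (\<lambda>m. of_bool (l = k) * D k m)))
       + sum8 (\<lambda>k. sum8 (\<lambda>l. sum8 (\<lambda>m. of_bool (k = i) * D l m))) + sum8 (\<lambda>k. sum8 (\<lambda>l. sum8 (\<lambda>m. of_bool (k = j) * D l m)))"
      using t1 t2 ij by simp
    also have "0 = sum8 (\<lambda>k. sum8 (\<lambda>l. sum8 (\<lambda>m. D k l * (2 * (of_bool (m = i) + of_bool (m = j) + of_bool (m = k) + of_bool (m = l)) - 1))))"
    proof -
      have "sum8 (\<lambda>k. sum8 (\<lambda>l. sum8 (\<lambda>m. D k l * (2 * (of_bool (m = i) + of_bool (m = j) + of_bool (m = k) + of_bool (m = l)) - 1))))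
        = sum8 (\<lambda>k. sum8 (\<lambda>l. 0))"
        by (rule wsum_cong, rule wsum_cong, rule t0) auto
      then show ?thesis by (simp add: wsum_def)
    qed
    also have "\<dots> + sum8 (\<lambda>k. sum8 (\<lambda>l. sum8 (\<lambda>m. of_bool (l = k) * D k m)))
       + sum8 (\<lambda>k. sum8 (\<lambda>l. sum8 (\<lambda>m. of_bool (k = i) * D l m))) + sum8 (\<lambda>k. sum8 (\<lambda>l. sum8 (\<lambda>m. of_bool (k = j) * D l m)))
       = sum8 (\<lambda>k. sum8 (\<lambda>l. sum8 (\<lambda>m. D k l * (2 * (of_bool (m = i) + of_bool (m = j) + of_bool (m = k) + of_bool (m = l)) - 1)
       + of_bool (l = k) * D k m + of_bool (k = i) * D l m + of_bool (k = j) * D l m)))"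
      by (simp only: wsum_add)
    also have "\<dots> \<le> sum8 (\<lambda>k. sum8 (\<lambda>l. sum8 (\<lambda>m. flip_gain (i = j) (coinc (=) i j k l m))))"
      by (intro wsum_mono pt) auto
    finally show ?thesis .
  qed
qed

context partition_near_uniform
begin

lemma E_uniform:
  assumes "\<And>i. \<bar>f i\<bar> \<le> 1"
  shows "\<bar>E (\<lambda>u. f (\<pi> u)) - sum8 f / 8\<bar> \<le> 8 / 10000000"
proof -
  have "afrac (\<lambda>_. False) i = 1" if "i < 8" for i
    using wt_pos[OF that] by (simp add: afrac_def wt_def)
  then have "avg (afrac (\<lambda>_. False)) (\<lambda>i _. f i) = avg (\<lambda>_. 1) (\<lambda>i _. f i)" by (metis avg_cong)
  also have "\<dots> = sum8 f / 8" by (simp add: avg_def wsum_def)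
  finally have eq: "avg (afrac (\<lambda>_. False)) (\<lambda>i _. f i) = sum8 f / 8" .
  show ?thesis using E_avg[of "\<lambda>i _. f i" "\<lambda>_. False", OF assms] unfolding eq .
qed

lemma E3_uniform:
  assumes "\<And>i j k. \<bar>f i j k\<bar> \<le> 1"
  shows "sum8 (\<lambda>i. sum8 (\<lambda>j. sum8 (\<lambda>k. f i j k))) / 512 - 24 / 10000000 \<le> E (\<lambda>u. E (\<lambda>v. E (\<lambda>w. f (\<pi> u) (\<pi> v) (\<pi> w))))"
proof -
  have b: "\<bar>sum8 g / 8\<bar> \<le> 1" if "\<And>i. \<bar>g i\<bar> \<le> 1" for g
  proof -
    have "\<bar>sum8 g\<bar> \<le> (\<Sum>i<8::nat. \<bar>g i\<bar>)" unfolding wsum_def using sum_abs[of g] by simp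
    also have "\<dots> \<le> (\<Sum>i<8::nat. 1)" by (intro sum_mono that)
    finally show ?thesis by simp
  qed
  have step: "\<bar>E (\<lambda>u. g (\<pi> u)) - sum8 h / 8\<bar> \<le> t + 8 / 10000000"
    if "\<And>i. \<bar>g i - h i\<bar> \<le> t" "\<And>i. \<bar>h i\<bar> \<le> 1" for g h t
  proof -
    have "\<bar>E (\<lambda>u. g (\<pi> u)) - E (\<lambda>u. h (\<pi> u))\<bar> \<le> t" by (rule E_close) (rule that(1))
    moreover have "\<bar>E (\<lambda>u. h (\<pi> u)) - sum8 h / 8\<bar> \<le> 8 / 10000000" by (rule E_uniform) (rule that(2))
    ultimately show ?thesis by linarith
  qed
  have 1: "\<bar>E (\<lambda>w. f i j (\<pi> w)) - sum8 (\<lambda>k. f i j k) / 8\<bar> \<le> 8 / 10000000" for i j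
    by (rule E_uniform) (rule assms)
  have 2: "\<bar>E (\<lambda>v. E (\<lambda>w. f i (\<pi> v) (\<pi> w))) - sum8 (\<lambda>j. sum8 (\<lambda>k. f i j k) / 8) / 8\<bar> \<le> 8 / 10000000 + 8 / 10000000" for i
    by (rule step[where g = "\<lambda>j. E (\<lambda>w. f i j (\<pi> w))"]) (intro 1 b assms)+
  have 3: "\<bar>E (\<lambda>u. E (\<lambda>v. E (\<lambda>w. f (\<pi> u) (\<pi> v) (\<pi> w)))) - sum8 (\<lambda>i. sum8 (\<lambda>j. sum8 (\<lambda>k. f i j k) / 8) / 8) / 8\<bar> \<le> 8 / 10000000 + 8 / 10000000 + 8 / 10000000"
    by (rule step[where g = "\<lambda>i. E (\<lambda>v. E (\<lambda>w. f i (\<pi> v) (\<pi> w)))"]) (intro 2 b assms)+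
  have "\<bar>p - q\<bar> \<le> 8 / 10000000 + 8 / 10000000 + 8 / 10000000 \<Longrightarrow> q - 24 / 10000000 \<le> p" for p q :: real
    by linarith
  from this[OF 3] show ?thesis unfolding wsum_divide by simp
qed

lemma flip_gain_E:
  assumes "a \<in> V" "b \<in> V"
  shows "84 / 512 - 24 / 10000000 \<le> E (\<lambda>c. E (\<lambda>d. E (\<lambda>e. flip_gain (\<pi> a = \<pi> b) (coinc (\<lambda>u v. \<pi> u = \<pi> v) a b c d e))))"
proof -
  define f where "f k l m = flip_gain (\<pi> a = \<pi> b) (coinc (=) (\<pi> a) (\<pi> b) k l m)" for k l m
  have "\<bar>f k l m\<bar> \<le> 1" for k l m by (simp add: f_def flip_gain_def)
  then have "sum8 (\<lambda>i. sum8 (\<lambda>j. sum8 (\<lambda>k. f i j k))) / 512 - 24 / 10000000 \<le> E (\<lambda>u. E (\<lambda>v. E (\<lambda>w. f (\<pi> u) (\<pi> v) (\<pi> w))))"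
    by (rule E3_uniform)
  moreover have "84 \<le> sum8 (\<lambda>i. sum8 (\<lambda>j. sum8 (\<lambda>k. f i j k)))"
    unfolding f_def using assms by (intro flip_gain_sum part)
  ultimately show ?thesis by (simp add: f_def coinc_def)
qed

end

section \<open>Local stability\<close>

lemma coinc_perm:
  assumes "\<And>u v. R u v = R v u"
  shows "coinc R a c b d e = coinc R a b c d e" "coinc R a d b c e = coinc R a b c d e" "coinc R a e b c d = coinc R a b c d e"
    "coinc R b c a d e = coinc R a b c d e" "coinc R b d a c e = coinc R a b c d e" "coinc R b e a c d = coinc R a b c d e"
    "coinc R c d a b e = coinc R a b c d e" "coinc R c e a b d = coinc R a b c d e" "coinc R d e a b c = coinc R a b c d e"
    "coinc R b a c d e = coinc R a b c d e" "coinc R c a b d e = coinc R a b c d e" "coinc R d a b c e = coinc R a b c d e"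
    "coinc R e a b c d = coinc R a b c d e"
  unfolding coinc_def using assms[of a b] assms[of a c] assms[of a d] assms[of a e] assms[of b c] assms[of b d]
    assms[of b e] assms[of c d] assms[of c e] assms[of d e] by simp_all

text \<open>The error term pays for the tuples with at least two flipped pairs.\<close>

lemma flip_bound:
  fixes h n :: "'i \<Rightarrow> bool"
  assumes fin: "finite I"
  defines "B \<equiv> \<lambda>p. of_bool (h p \<noteq> n p) :: real"
  defines "cH \<equiv> \<Sum>p\<in>I. of_bool (h p) :: nat" and "cN \<equiv> \<Sum>p\<in>I. of_bool (n p) :: nat"
  shows "(\<Sum>p\<in>I. B p * (flip_gain (h p) cH - 3 / 2 * (sum B I - B p))) \<le> of_bool (cH = 1) - of_bool (cN = 1)"
proof -
  define Z where "Z = {p\<in>I. h p \<noteq> n p}"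
  have Z: "Z \<subseteq> I" "finite Z" using fin by (auto simp: Z_def)
  have B1: "B p = 1" if "p \<in> Z" for p using that by (simp add: B_def Z_def)
  have B0: "B p = 0" if "p \<in> I - Z" for p using that by (auto simp: B_def Z_def)
  have K: "sum B I = real (card Z)"
  proof -
    have "sum B I = sum B Z" using fin Z B0 by (intro sum.mono_neutral_right) auto
    then show ?thesis using B1 by simp
  qed
  have "(\<Sum>p\<in>I. B p * (flip_gain (h p) cH - 3 / 2 * (sum B I - B p)))
    = (\<Sum>p\<in>Z. B p * (flip_gain (h p) cH - 3 / 2 * (sum B I - B p)))"
    using fin Z B0 by (intro sum.mono_neutral_right) auto
  also have "\<dots> = (\<Sum>p\<in>Z. flip_gain (h p) cH - 3 / 2 * (real (card Z) - 1))"
    using B1 K by (intro sum.cong) auto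
  finally have L: "(\<Sum>p\<in>I. B p * (flip_gain (h p) cH - 3 / 2 * (sum B I - B p)))
    = (\<Sum>p\<in>Z. flip_gain (h p) cH - 3 / 2 * (real (card Z) - 1))" .
  consider "card Z = 0" | "card Z = 1" | "card Z \<ge> 2" by linarith
  then show ?thesis
  proof cases
    case 1
    then have "Z = {}" using Z by simp
    then have "cH = cN" unfolding cH_def cN_def by (intro sum.cong) (auto simp: Z_def)
    then show ?thesis using L \<open>Z = {}\<close> by simp
  next
    case 2
    then obtain p where p: "Z = {p}" by (auto simp: card_1_singleton_iff)
    then have pI: "p \<in> I" and hn: "h p \<noteq> n p" and oth: "\<And>q. q \<in> I - {p} \<Longrightarrow> h q = n q"
      by (auto simp: Z_def)
    have eq: "(\<Sum>q\<in>I-{p}. of_bool (h q) :: nat) = (\<Sum>q\<in>I-{p}. of_bool (n q))"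
      by (intro sum.cong) (auto simp: oth)
    have "cH = of_bool (h p) + (\<Sum>q\<in>I-{p}. of_bool (h q))" "cN = of_bool (n p) + (\<Sum>q\<in>I-{p}. of_bool (n q))"
      unfolding cH_def cN_def by (rule sum.remove[OF fin pI])+
    then have "cH + of_bool (n p) = cN + of_bool (h p)"
      by (simp only: eq add_ac)
    then show ?thesis unfolding L p using hn by (auto simp: flip_gain_def)
  next
    case 3
    \<comment> \<open>The factor \<open>3 / 2\<close> is chosen so that
      \<open>K * (1 - 3 / 2 * (K - 1)) \<le> - 1\<close> for every number \<open>K \<ge> 2\<close>
      of flips, the least value a difference of two indicators can take.\<close>
    have "(\<Sum>p\<in>Z. flip_gain (h p) cH - 3 / 2 * (real (card Z) - 1)) \<le> (\<Sum>p\<in>Z. 1 - 3 / 2 * (real (card Z) - 1))"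
      by (intro sum_mono) (auto simp: flip_gain_def)
    also have "\<dots> = real (card Z) * (1 - 3 / 2 * (real (card Z) - 1))" by simp
    also have "\<dots> \<le> real (card Z) * (- 1 / 2)"
    proof (intro mult_left_mono)
      have "2 \<le> real (card Z)" using 3 by simp
      then show "1 - 3 / 2 * (real (card Z) - 1) \<le> - 1 / 2" by argo
    qed simp
    also have "\<dots> \<le> - 1" using 3 by simp
    also have "\<dots> \<le> of_bool (cH = 1) - of_bool (cN = 1)" by simp
    finally show ?thesis unfolding L .
  qed
qed

lemma sum_lessThan_10:
  fixes f :: "nat \<Rightarrow> 'b :: comm_monoid_add"
  shows "sum f {..<10} = f 0 + f 1 + f 2 + f 3 + f 4 + f 5 + f 6 + f 7 + f 8 + f 9"
  by (simp add: eval_nat_numeral)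

text \<open>The summand of \<open>flip_bound\<close> for the pair \<open>a, b\<close>; the bracket
  with \<open>coinc B\<close> is the number of the other flipped pairs in the tuple.\<close>

definition pair_gain :: "('a \<Rightarrow> 'a \<Rightarrow> bool) \<Rightarrow> ('a \<Rightarrow> 'a \<Rightarrow> bool) \<Rightarrow> 'a \<Rightarrow> 'a \<Rightarrow> 'a \<Rightarrow> 'a \<Rightarrow> 'a \<Rightarrow> real" where
  "pair_gain H B a b c d e = of_bool (B a b) *
     (flip_gain (H a b) (coinc H a b c d e) - 3 / 2 * (real (coinc B a b c d e) - of_bool (B a b)))"

lemma pair_gain_bound:
  assumes H: "\<And>u v. H u v = H v u" and N: "\<And>u v. N u v = N v u"
  defines "B \<equiv> \<lambda>u v. H u v \<noteq> N u v"
  shows "pair_gain H B a b c d e + pair_gain H B a c b d e + pair_gain H B a d b c e + pair_gain H B a e b c d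
    + pair_gain H B b c a d e + pair_gain H B b d a c e + pair_gain H B b e a c d + pair_gain H B c d a b e
    + pair_gain H B c e a b d + pair_gain H B d e a b c
    \<le> of_bool (coinc H a b c d e = 1) - of_bool (coinc N a b c d e = 1)"
proof -
  have Bs: "B u v = B v u" for u v using H[of u v] N[of u v] by (simp add: B_def)
  define h where "h p = [H a b, H a c, H a d, H a e, H b c, H b d, H b e, H c d, H c e, H d e] ! p" for p
  define n where "n p = [N a b, N a c, N a d, N a e, N b c, N b d, N b e, N c d, N c e, N d e] ! p" for p
  have cH: "(\<Sum>p<10. of_bool (h p)) = coinc H a b c d e" unfolding sum_lessThan_10 by (simp add: h_def coinc_def)
  have cN: "(\<Sum>p<10. of_bool (n p)) = coinc N a b c d e" unfolding sum_lessThan_10 by (simp add: n_def coinc_def)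
  have cB: "(\<Sum>p<10. of_bool (h p \<noteq> n p)) = real (coinc B a b c d e)"
    unfolding sum_lessThan_10 by (simp add: h_def n_def coinc_def B_def)
  have fin: "finite {..<10::nat}" by simp
  show ?thesis
    using flip_bound[OF fin, of h n] unfolding cH cN cB sum_lessThan_10
    unfolding pair_gain_def coinc_perm(1-9)[where R = H and a = a and b = b and c = c and d = d and e = e, OF H]
      coinc_perm(1-9)[where R = B and a = a and b = b and c = c and d = d and e = e, OF Bs]
    by (simp add: h_def n_def B_def)
qed

definition c6 :: "('a \<Rightarrow> 'a \<Rightarrow> bool) \<Rightarrow> 'a \<Rightarrow> 'a \<Rightarrow> 'a \<Rightarrow> 'a \<Rightarrow> nat" where
  "c6 R b c d e = of_bool (R b c) + of_bool (R b d) + of_bool (R b e) + of_bool (R c d) + of_bool (R c e) + of_bool (R d e)"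

definition c5 :: "('a \<Rightarrow> 'a \<Rightarrow> bool) \<Rightarrow> 'a \<Rightarrow> 'a \<Rightarrow> 'a \<Rightarrow> 'a \<Rightarrow> 'a \<Rightarrow> nat" where
  "c5 R a b c d e = of_bool (R a b) + of_bool (R a c) + of_bool (R a d) + of_bool (R a e)"

text \<open>The subtracted terms pay for tuples with a further vertex in \<open>D\<close> or a misplaced pair avoiding the first vertex.\<close>

definition vertex_gain :: "('a \<Rightarrow> 'a \<Rightarrow> bool) \<Rightarrow> ('a \<Rightarrow> 'a \<Rightarrow> bool) \<Rightarrow> ('a \<Rightarrow> bool) \<Rightarrow> 'a \<Rightarrow> 'a \<Rightarrow> 'a \<Rightarrow> 'a \<Rightarrow> 'a \<Rightarrow> real" where
  "vertex_gain H N D a b c d e = of_bool (D a) *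
     (of_bool (coinc H a b c d e = 1) - of_bool (c5 N a b c d e + c6 H b c d e = 1)
      - 3 * real (c6 (\<lambda>u v. H u v \<noteq> N u v) b c d e) - 3 / 2 * (of_bool (D b) + of_bool (D c) + of_bool (D d) + of_bool (D e)))"

text \<open>If the pairs among the other four vertices agree with \<open>H\<close>, the two
  indicators in \<open>vertex_gain\<close> are exactly those of \<open>M\<close> and
  \<open>N\<close>. Otherwise the penalty 3 brings the value down to at most -2, below any
  difference of indicators.\<close>

lemma vertex_gain_one:
  fixes N H :: "'a \<Rightarrow> 'a \<Rightarrow> bool" and D :: "'a \<Rightarrow> bool"
  assumes "D a" "\<not> D b" "\<not> D c" "\<not> D d" "\<not> D e"
  defines "M \<equiv> \<lambda>u v. if D u \<or> D v then H u v else N u v"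
  shows "vertex_gain H N D a b c d e \<le> of_bool (coinc M a b c d e = 1) - of_bool (coinc N a b c d e = 1)"
proof (cases "c6 (\<lambda>u v. H u v \<noteq> N u v) b c d e = 0")
  case True
  then have eq: "N b c = H b c" "N b d = H b d" "N b e = H b e" "N c d = H c d" "N c e = H c e" "N d e = H d e"
    by (auto simp: c6_def split: if_splits)
  then have "coinc M a b c d e = coinc H a b c d e" using assms by (simp add: coinc_def)
  moreover have "c5 N a b c d e + c6 H b c d e = coinc N a b c d e" using eq by (simp add: c5_def c6_def coinc_def)
  ultimately show ?thesis using assms True by (simp add: vertex_gain_def)
next
  case False
  then have "1 \<le> real (c6 (\<lambda>u v. H u v \<noteq> N u v) b c d e)" by linarith
  moreover have "- 1 \<le> (of_bool (coinc M a b c d e = 1) - of_bool (coinc N a b c d e = 1) :: real)" by simp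
  moreover have "(of_bool (coinc H a b c d e = 1) :: real) - of_bool (c5 N a b c d e + c6 H b c d e = 1) \<le> 1" by simp
  ultimately show ?thesis using assms by (simp add: vertex_gain_def)
qed

lemma vertex_gain_le:
  "vertex_gain H N D a b c d e \<le> of_bool (D a) * (1 - 3 / 2 * (of_bool (D b) + of_bool (D c) + of_bool (D d) + of_bool (D e)))"
  unfolding vertex_gain_def by (intro mult_left_mono) auto

text \<open>\<open>M\<close> is \<open>N\<close> with the vertices of \<open>D\<close> re-attached
  as in \<open>H\<close>. One vertex in \<open>D\<close> is the preceding lemma; for
  \<open>m \<ge> 2\<close> of them the penalty \<open>3 / 2\<close> works by the same quadratic
  estimate as in \<open>flip_bound\<close>.\<close>

lemma vertex_gain_bound:
  fixes N H :: "'a \<Rightarrow> 'a \<Rightarrow> bool" and D :: "'a \<Rightarrow> bool"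
  assumes H: "\<And>u v. H u v = H v u" and N: "\<And>u v. N u v = N v u"
  defines "M \<equiv> \<lambda>u v. if D u \<or> D v then H u v else N u v"
  shows "vertex_gain H N D a b c d e + vertex_gain H N D b a c d e + vertex_gain H N D c a b d e
    + vertex_gain H N D d a b c e + vertex_gain H N D e a b c d
    \<le> of_bool (coinc M a b c d e = 1) - of_bool (coinc N a b c d e = 1)"
proof -
  have Ms: "M u v = M v u" for u v using H[of u v] N[of u v] by (auto simp: M_def)
  note one = vertex_gain_one[of D _ _ _ _ _ H N, folded M_def]
  note pM = coinc_perm(10-13)[where R = M and a = a and b = b and c = c and d = d and e = e, OF Ms]
  note pN = coinc_perm(10-13)[where R = N and a = a and b = b and c = c and d = d and e = e, OF N]
  have z: "vertex_gain H N D p q r s t = 0" if "\<not> D p" for p q r s t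
    using that by (simp add: vertex_gain_def)
  define m where "m = of_bool (D a) + of_bool (D b) + of_bool (D c) + of_bool (D d) + (of_bool (D e) :: nat)"
  consider "m = 0" | "m = 1" | "m \<ge> 2" by linarith
  then show ?thesis
  proof cases
    case 1
    then have "\<not> D a" "\<not> D b" "\<not> D c" "\<not> D d" "\<not> D e" by (auto simp: m_def split: if_splits)
    then show ?thesis by (simp add: z M_def coinc_def)
  next
    case 2
    then consider "D a" "\<not> D b" "\<not> D c" "\<not> D d" "\<not> D e" | "\<not> D a" "D b" "\<not> D c" "\<not> D d" "\<not> D e"
      | "\<not> D a" "\<not> D b" "D c" "\<not> D d" "\<not> D e" | "\<not> D a" "\<not> D b" "\<not> D c" "D d" "\<not> D e"
      | "\<not> D a" "\<not> D b" "\<not> D c" "\<not> D d" "D e"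
      by (cases "D a"; cases "D b"; cases "D c"; cases "D d"; cases "D e"; simp add: m_def)
    then show ?thesis
    proof cases
      case 1 then show ?thesis using one[of a b c d e] by (simp add: z)
    next
      case 2 then show ?thesis using one[of b a c d e] by (simp add: z pM pN)
    next
      case 3 then show ?thesis using one[of c a b d e] by (simp add: z pM pN)
    next
      case 4 then show ?thesis using one[of d a b c e] by (simp add: z pM pN)
    next
      case 5 then show ?thesis using one[of e a b c d] by (simp add: z pM pN)
    qed
  next
    case 3
    define u v w x y where "u = (of_bool (D a) :: real)" and "v = (of_bool (D b) :: real)" and "w = (of_bool (D c) :: real)"
      and "x = (of_bool (D d) :: real)" and "y = (of_bool (D e) :: real)"
    have sq: "u * u = u" "v * v = v" "w * w = w" "x * x = x" "y * y = y"
      by (auto simp: u_def v_def w_def x_def y_def)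
    have mr: "real m = u + v + w + x + y" by (simp add: m_def u_def v_def w_def x_def y_def)
    have "vertex_gain H N D a b c d e + vertex_gain H N D b a c d e + vertex_gain H N D c a b d e
      + vertex_gain H N D d a b c e + vertex_gain H N D e a b c d
      \<le> u * (1 - 3 / 2 * (v + w + x + y)) + v * (1 - 3 / 2 * (u + w + x + y)) + w * (1 - 3 / 2 * (u + v + x + y))
        + x * (1 - 3 / 2 * (u + v + w + y)) + y * (1 - 3 / 2 * (u + v + w + x))"
      unfolding u_def v_def w_def x_def y_def by (intro add_mono vertex_gain_le)
    also have "\<dots> = real m - 3 / 2 * (real m * real m - (u * u + v * v + w * w + x * x + y * y))"
      unfolding mr by (simp add: field_simps)
    also have "\<dots> = real m * (1 - 3 / 2 * (real m - 1))"
      unfolding sq using mr by (simp add: field_simps)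
    also have "\<dots> \<le> real m * (- 1 / 2)"
    proof (intro mult_left_mono)
      have "2 \<le> real m" using 3 by simp
      then show "1 - 3 / 2 * (real m - 1) \<le> - 1 / 2" by argo
    qed simp
    also have "\<dots> \<le> - 1" using 3 by simp
    also have "\<dots> \<le> of_bool (coinc M a b c d e = 1) - of_bool (coinc N a b c d e = 1)" by simp
    finally show ?thesis .
  qed
qed

context partition_near_uniform
begin

abbreviation H :: "'a \<Rightarrow> 'a \<Rightarrow> bool" where "H u v \<equiv> \<pi> u = \<pi> v"

lemma E5_mono:
  assumes "\<And>a b c d e. f a b c d e \<le> g a b c d e"
  shows "wsum5 V x f \<le> wsum5 V x g"
  unfolding wsum5_def using assms by (intro wsum_mono x0)

lemma E5_diff: "wsum5 V x (\<lambda>a b c d e. f a b c d e - g a b c d e) = wsum5 V x f - wsum5 V x g"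
  by (simp add: wsum5_def wsum_diff)

text \<open>First \<open>N\<close> is changed to \<open>M\<close> by re-attaching the vertices of
  large bad degree, then \<open>M\<close> to \<open>H\<close> pair by pair. Minimality of
  \<open>\<pi>\<close> makes each vertex of the first kind far from all eight parts, so
  \<open>psi_far\<close> applies. In \<open>M\<close> every vertex of positive weight has bad degree
  at most \<open>1 / 100\<close>, which keeps the second-order penalty below the gain of a
  flip.\<close>

theorem local_stability:
  assumes N: "\<And>u v. N u v = N v u"
  defines "bad \<equiv> \<lambda>u v. H u v \<noteq> N u v"
  defines "\<beta> \<equiv> E (\<lambda>u. E (\<lambda>v. of_bool (bad u v)))"
  assumes min: "\<And>v j. v \<in> V \<Longrightarrow> 0 < x v \<Longrightarrow> j < 8 \<Longrightarrow>
      E (\<lambda>u. of_bool (bad v u)) \<le> E (\<lambda>u. of_bool (N v u \<noteq> (\<pi> u = j)))"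
    and small: "\<beta> \<le> 1 / 100000000"
  shows "\<beta> / 20000 \<le> dens V x H - dens V x N"
proof -
  have Hs: "H u v = H v u" for u v by auto
  define D where "D v \<longleftrightarrow> 1 / 100 \<le> E (\<lambda>u. of_bool (bad v u)) \<and> 0 < x v" for v
  define \<mu> where "\<mu> = E (\<lambda>v. of_bool (D v))"
  define M where "M = (\<lambda>u v. if D u \<or> D v then H u v else N u v)"
  have Ms: "M u v = M v u" for u v using N[of u v] by (auto simp: M_def)
  define bad' where "bad' = (\<lambda>u v. H u v \<noteq> M u v)"
  define \<beta>' where "\<beta>' = E (\<lambda>u. E (\<lambda>v. of_bool (bad' u v)))"
  have bad'_le: "(of_bool (bad' u v) :: real) \<le> of_bool (bad u v)" for u v
    by (auto simp: bad'_def M_def bad_def)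
  have \<beta>'le: "\<beta>' \<le> \<beta>" unfolding \<beta>'_def \<beta>_def by (intro wsum_mono x0 bad'_le)
  have \<beta>'0: "0 \<le> \<beta>'" unfolding \<beta>'_def by (intro wsum_nonneg x0) auto
  have \<mu>0: "0 \<le> \<mu>" unfolding \<mu>_def by (intro wsum_nonneg x0) auto
  have "E (\<lambda>v. of_bool (D v) * (1 / 100)) \<le> \<beta>"
    unfolding \<beta>_def by (intro wsum_mono x0) (auto simp: D_def intro!: wsum_nonneg x0)
  \<comment> \<open>Markov's inequality for the bad degree.\<close>
  then have \<mu>\<beta>: "\<mu> \<le> 100 * \<beta>" by (simp add: wsum_multc \<mu>_def wsum_divide)
  have "\<beta> \<le> E (\<lambda>u. E (\<lambda>v. of_bool (bad' u v) + of_bool (D u) + of_bool (D v)))"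
    unfolding \<beta>_def by (intro wsum_mono x0) (auto simp: bad'_def M_def bad_def)
  also have "\<dots> = \<beta>' + 2 * \<mu>" by (simp add: wsum_add \<beta>'_def \<mu>_def)
  finally have split: "\<beta> \<le> \<beta>' + 2 * \<mu>" .

  \<comment> \<open>The gap between \<open>psi_part\<close> and \<open>psi_far\<close>; their two
    errors of \<open>32 / 10000000\<close> add up. Averaging the penalties of
    \<open>vertex_gain\<close> gives \<open>3 * 6 * \<beta>\<close> and
    \<open>3 / 2 * 4 * \<mu>\<close>, and the factor 5 counts the positions of the vertex in
    \<open>D\<close>.\<close>
  define c where "c = (42 / 250 / 4096 - 64 / 10000000 :: real)"
  have step1: "5 * (\<mu> * (c - 18 * \<beta> - 6 * \<mu>)) \<le> dens V x M - dens V x N"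
  proof -
    define G where "G = vertex_gain H N D"
    have inner: "of_bool (D a) * (c - 18 * \<beta> - 6 * \<mu>) \<le> E (\<lambda>b. E (\<lambda>c. E (\<lambda>d. E (\<lambda>e. G a b c d e))))"
      if a: "a \<in> V" "0 < x a" for a
    proof (cases "D a")
      case True
      have H1: "E (\<lambda>b. E (\<lambda>c. E (\<lambda>d. E (\<lambda>e. of_bool (coinc H a b c d e = 1))))) = psi (\<lambda>u. \<pi> u = \<pi> a)"
        unfolding psi_def Phi_def c4_def coinc_def by (intro wsum_cong arg_cong[where f = of_bool]) auto
      have N1: "E (\<lambda>b. E (\<lambda>c. E (\<lambda>d. E (\<lambda>e. of_bool (c5 N a b c d e + c6 H b c d e = 1))))) = psi (N a)"
        unfolding psi_def Phi_def c4_def c5_def c6_def by (intro wsum_cong arg_cong[where f = of_bool]) auto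
      have "1 / 100 \<le> E (\<lambda>u. of_bool (N a u \<noteq> (\<pi> u = j)))" if "j < 8" for j
        using min[OF a that] True by (simp add: D_def)
      then have "psi (N a) \<le> (2100 - 42 / 250) / 4096 + 32 / 10000000" by (rule psi_far)
      moreover have "2100 / 4096 - 32 / 10000000 \<le> psi (\<lambda>u. \<pi> u = \<pi> a)" by (rule psi_part) (rule part[OF a(1)])
      ultimately have "c \<le> psi (\<lambda>u. \<pi> u = \<pi> a) - psi (N a)" by (simp add: c_def)
      moreover have "E (\<lambda>b. E (\<lambda>c. E (\<lambda>d. E (\<lambda>e. real (c6 bad b c d e))))) = 6 * \<beta>"
        by (simp add: c6_def wsum_add wsum_cmult wsum_multc \<beta>_def)
      moreover have "E (\<lambda>b. E (\<lambda>c. E (\<lambda>d. E (\<lambda>e. of_bool (D b) + of_bool (D c) + of_bool (D d) + of_bool (D e))))) = 4 * \<mu>"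
        by (simp add: wsum_add wsum_cmult wsum_multc \<mu>_def)
      moreover have "E (\<lambda>b. E (\<lambda>c. E (\<lambda>d. E (\<lambda>e. G a b c d e)))) = psi (\<lambda>u. \<pi> u = \<pi> a) - psi (N a)
         - 3 * E (\<lambda>b. E (\<lambda>c. E (\<lambda>d. E (\<lambda>e. real (c6 bad b c d e)))))
         - 3 / 2 * E (\<lambda>b. E (\<lambda>c. E (\<lambda>d. E (\<lambda>e. of_bool (D b) + of_bool (D c) + of_bool (D d) + of_bool (D e)))))"
        unfolding G_def vertex_gain_def bad_def[symmetric]
        using True by (simp only: of_bool_eq mult_1 wsum_diff wsum_cmult H1 N1)
      ultimately show ?thesis using True by simp
    next
      case False
      then show ?thesis by (simp add: G_def vertex_gain_def)
    qed
    have "\<mu> * (c - 18 * \<beta> - 6 * \<mu>) = E (\<lambda>a. of_bool (D a) * (c - 18 * \<beta> - 6 * \<mu>))"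
      by (simp only: wsum_multc \<mu>_def)
    also have "\<dots> \<le> wsum5 V x G" unfolding wsum5_def by (intro wsum_mono x0 inner)
    finally have "5 * (\<mu> * (c - 18 * \<beta> - 6 * \<mu>)) \<le> 5 * wsum5 V x G" by simp
    also have "5 * wsum5 V x G = wsum5 V x (\<lambda>a b c d e. G a b c d e + G b a c d e + G c a b d e + G d a b c e + G e a b c d)"
      unfolding wsum5_add wsum5_first[of V x G] by simp
    also have "\<dots> \<le> wsum5 V x (\<lambda>a b c d e. of_bool (coinc M a b c d e = 1) - of_bool (coinc N a b c d e = 1))"
      unfolding G_def M_def by (intro E5_mono vertex_gain_bound Hs N)
    finally show ?thesis unfolding dens_def E5_diff .
  qed

  \<comment> \<open>\<open>84 / 512\<close> bounds the mean of \<open>flip_gain\<close> from below,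
    up to the tolerance. Of the nine other pairs, six meet \<open>a\<close> or \<open>b\<close> and
    cost \<open>3 / 2 * 6 / 100\<close>; three avoid both and cost
    \<open>3 / 2 * 3 * \<beta>'\<close>. The factor 10 counts the positions of the flipped
    pair.\<close>
  have step2: "10 * (\<beta>' * (84 / 512 - 24 / 10000000 - 9 / 100 - 9 / 2 * \<beta>')) \<le> dens V x H - dens V x M"
  proof -
    define G where "G = pair_gain H bad'"
    define \<kappa> where "\<kappa> = (84 / 512 - 24 / 10000000 - 9 / 100 - 9 / 2 * \<beta>' :: real)"
    have deg: "E (\<lambda>u. of_bool (bad' v u)) \<le> 1 / 100" if v: "v \<in> V" "0 < x v" for v
    proof (cases "D v")
      case True
      then have "\<not> bad' v u" for u by (simp add: bad'_def M_def)
      then show ?thesis by simp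
    next
      case False
      then have "E (\<lambda>u. of_bool (bad v u)) \<le> 1 / 100" using v by (auto simp: D_def)
      moreover have "E (\<lambda>u. of_bool (bad' v u)) \<le> E (\<lambda>u. of_bool (bad v u))"
        by (intro wsum_mono x0 bad'_le)
      ultimately show ?thesis by simp
    qed
    have inner: "of_bool (bad' a b) * \<kappa> \<le> E (\<lambda>c. E (\<lambda>d. E (\<lambda>e. G a b c d e)))"
      if a: "a \<in> V" "0 < x a" and b: "b \<in> V" "0 < x b" for a b
    proof (cases "bad' a b")
      case True
      have "E (\<lambda>c. E (\<lambda>d. E (\<lambda>e. real (coinc bad' a b c d e) - of_bool (bad' a b))))
        = 3 * E (\<lambda>u. of_bool (bad' a u)) + 3 * E (\<lambda>u. of_bool (bad' b u)) + 3 * \<beta>'"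
        by (simp add: coinc_def wsum_add wsum_cmult wsum_multc \<beta>'_def)
      moreover have "\<dots> \<le> 6 / 100 + 3 * \<beta>'" using deg[OF a] deg[OF b] by simp
      moreover have "84 / 512 - 24 / 10000000 \<le> E (\<lambda>c. E (\<lambda>d. E (\<lambda>e. flip_gain (H a b) (coinc H a b c d e))))"
        by (rule flip_gain_E[OF a(1) b(1)])
      ultimately have "\<kappa> \<le> E (\<lambda>c. E (\<lambda>d. E (\<lambda>e. flip_gain (H a b) (coinc H a b c d e))))
        - 3 / 2 * E (\<lambda>c. E (\<lambda>d. E (\<lambda>e. real (coinc bad' a b c d e) - of_bool (bad' a b))))"
        unfolding \<kappa>_def by linarith
      then show ?thesis using True unfolding G_def pair_gain_def by (simp only: wsum_diff wsum_cmult of_bool_eq mult_1)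
    next
      case False
      then show ?thesis by (simp add: G_def pair_gain_def)
    qed
    have "\<beta>' * \<kappa> = E (\<lambda>a. E (\<lambda>b. of_bool (bad' a b) * \<kappa>))"
      by (simp only: wsum_multc \<beta>'_def)
    also have "\<dots> \<le> wsum5 V x G" unfolding wsum5_def by (intro wsum_mono x0 inner)
    finally have "10 * (\<beta>' * \<kappa>) \<le> 10 * wsum5 V x G" by simp
    also have "10 * wsum5 V x G = wsum5 V x (\<lambda>a b c d e. G a b c d e + G a c b d e + G a d b c e + G a e b c d
       + G b c a d e + G b d a c e + G b e a c d + G c d a b e + G c e a b d + G d e a b c)"
      unfolding wsum5_add wsum5_pair[of V x G] by simp
    also have "\<dots> \<le> wsum5 V x (\<lambda>a b c d e. of_bool (coinc H a b c d e = 1) - of_bool (coinc M a b c d e = 1))"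
      unfolding G_def bad'_def by (intro E5_mono pair_gain_bound Hs Ms)
    finally show ?thesis unfolding dens_def E5_diff \<kappa>_def .
  qed

  \<comment> \<open>With \<open>\<mu> \<le> 1 / 1000000\<close> the first round gains at least
    \<open>140 / 1000000 * \<mu>\<close>, more than the required \<open>2 * \<mu> / 20000\<close>;
    the second gains \<open>\<beta>' / 2\<close>. So the first round dictates the constant
    20000.\<close>
  have "\<mu> * (28 / 1000000) \<le> \<mu> * (c - 18 * \<beta> - 6 * \<mu>)"
    using \<mu>0 small \<mu>\<beta> by (intro mult_left_mono) (auto simp: c_def)
  moreover have "\<beta>' * (1 / 20) \<le> \<beta>' * (84 / 512 - 24 / 10000000 - 9 / 100 - 9 / 2 * \<beta>')"
    using \<beta>'0 small \<beta>'le by (intro mult_left_mono) auto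
  ultimately show ?thesis using step1 step2 split \<mu>0 \<beta>'0 by linarith
qed

end

section \<open>Nearest partitions\<close>

definition bdist :: "'a set \<Rightarrow> ('a \<Rightarrow> real) \<Rightarrow> ('a \<Rightarrow> 'a \<Rightarrow> bool) \<Rightarrow> ('a \<Rightarrow> nat) \<Rightarrow> real" where
  "bdist V x R \<pi> = wsum V x (\<lambda>u. wsum V x (\<lambda>v. of_bool ((\<pi> u = \<pi> v) \<noteq> R u v)))"

lemma wsum5_coinc:
  assumes "weighting V x"
  shows "wsum5 V x (\<lambda>a b c d e. real (coinc B a b c d e)) = 10 * wsum V x (\<lambda>u. wsum V x (\<lambda>v. of_bool (B u v)))"
proof -
  have [simp]: "wsum V x (\<lambda>_. c) = c" for c using assms by (simp add: wsum_const weighting_def)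
  show ?thesis by (simp add: wsum5_def coinc_def wsum_add wsum_cmult wsum_multc)
qed

lemma wsum5_mono:
  assumes "weighting V x" "\<And>a b c d e. f a b c d e \<le> g a b c d e"
  shows "wsum5 V x f \<le> wsum5 V x g"
  unfolding wsum5_def using assms by (intro wsum_mono) (auto simp: weighting_def)

text \<open>The status of a tuple can change only if one of its ten pairs changes.\<close>

lemma dens_diff:
  assumes W: "weighting V x"
  shows "dens V x A - dens V x B \<le> 10 * wsum V x (\<lambda>u. wsum V x (\<lambda>v. of_bool (A u v \<noteq> B u v)))"
proof -
  have "of_bool (coinc A a b c d e = 1) \<le> real (coinc (\<lambda>u v. A u v \<noteq> B u v) a b c d e) + of_bool (coinc B a b c d e = 1)" for a b c d e
  proof (cases "coinc (\<lambda>u v. A u v \<noteq> B u v) a b c d e = 0")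
    case True
    then have "coinc A a b c d e = coinc B a b c d e" by (simp add: coinc_def)
    then show ?thesis by simp
  next
    case False
    then have "1 \<le> real (coinc (\<lambda>u v. A u v \<noteq> B u v) a b c d e)" by linarith
    moreover have "(of_bool (coinc A a b c d e = 1) :: real) \<le> 1" "(0 :: real) \<le> of_bool (coinc B a b c d e = 1)" by auto
    ultimately show ?thesis by linarith
  qed
  then have "dens V x A \<le> wsum5 V x (\<lambda>a b c d e. real (coinc (\<lambda>u v. A u v \<noteq> B u v) a b c d e) + of_bool (coinc B a b c d e = 1))"
    unfolding dens_def by (intro wsum5_mono W)
  also have "\<dots> = 10 * wsum V x (\<lambda>u. wsum V x (\<lambda>v. of_bool (A u v \<noteq> B u v))) + dens V x B"
    by (simp only: wsum5_add wsum5_coinc[OF W] dens_def)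
  finally show ?thesis by simp
qed

definition part_weight :: "'a set \<Rightarrow> ('a \<Rightarrow> real) \<Rightarrow> ('a \<Rightarrow> 'b) \<Rightarrow> 'b \<Rightarrow> real" where
  "part_weight V x \<pi> i = wsum V x (\<lambda>u. of_bool (\<pi> u = i))"

lemma wsum_part:
  assumes "finite I" "\<pi> ` V \<subseteq> I"
  shows "wsum V x (\<lambda>u. f (\<pi> u)) = wsum I (part_weight V x \<pi>) f"
proof -
  have "wsum V x (\<lambda>u. f (\<pi> u)) = wsum V x (\<lambda>u. \<Sum>i\<in>I. of_bool (\<pi> u = i) * f i)"
  proof (rule wsum_cong)
    fix u assume "u \<in> V"
    have "(\<Sum>i\<in>I. of_bool (\<pi> u = i) * f i) = (\<Sum>i\<in>I. if i = \<pi> u then f i else 0)" by (rule sum.cong) auto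
    moreover have "\<pi> u \<in> I" using assms(2) \<open>u \<in> V\<close> by blast
    ultimately show "f (\<pi> u) = (\<Sum>i\<in>I. of_bool (\<pi> u = i) * f i)" using assms(1) by simp
  qed
  then show ?thesis by (simp add: wsum_sum wsum_multc part_weight_def wsum_def[of I])
qed

lemma weighting_part:
  assumes "weighting V x" "finite I" "\<pi> ` V \<subseteq> I"
  shows "weighting I (part_weight V x \<pi>)"
proof -
  have "sum (part_weight V x \<pi>) I = 1"
    using wsum_part[OF assms(2,3), where x = x and f = "\<lambda>_. 1"] assms(1)
    by (simp add: wsum_const wsum_def[of I] weighting_def)
  moreover have "0 \<le> part_weight V x \<pi> i" for i
    unfolding part_weight_def using assms by (intro wsum_nonneg) (auto simp: weighting_def)
  ultimately show ?thesis using assms by (simp add: weighting_def)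
qed

lemma dens_part:
  assumes "finite I" "\<pi> ` V \<subseteq> I"
  shows "dens V x (\<lambda>u v. \<pi> u = \<pi> v) = dens I (part_weight V x \<pi>) (=)"
proof -
  note p = wsum_part[OF assms, where x = x]
  have "dens V x (\<lambda>u v. \<pi> u = \<pi> v) = wsum5 V x (\<lambda>a b c d e. of_bool (coinc (=) (\<pi> a) (\<pi> b) (\<pi> c) (\<pi> d) (\<pi> e) = 1))"
    by (simp add: dens_def coinc_def)
  also have "\<dots> = dens I (part_weight V x \<pi>) (=)"
  proof -
    let ?W = "wsum I (part_weight V x \<pi>)"
    define f1 where "f1 i j k l = ?W (\<lambda>m. of_bool (coinc (=) i j k l m = 1))" for i j k l
    have 1: "wsum V x (\<lambda>e. of_bool (coinc (=) i j k l (\<pi> e) = 1)) = f1 i j k l" for i j k l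
      unfolding f1_def by (rule p)
    have 2: "wsum V x (\<lambda>d. f1 i j k (\<pi> d)) = ?W (f1 i j k)" for i j k by (rule p)
    have 3: "wsum V x (\<lambda>c. ?W (f1 i j (\<pi> c))) = ?W (\<lambda>k. ?W (f1 i j k))" for i j
      by (rule p[where f = "\<lambda>k. ?W (f1 i j k)"])
    have 4: "wsum V x (\<lambda>b. ?W (\<lambda>k. ?W (f1 i (\<pi> b) k))) = ?W (\<lambda>j. ?W (\<lambda>k. ?W (f1 i j k)))" for i
      by (rule p[where f = "\<lambda>j. ?W (\<lambda>k. ?W (f1 i j k))"])
    have 5: "wsum V x (\<lambda>a. ?W (\<lambda>j. ?W (\<lambda>k. ?W (f1 (\<pi> a) j k)))) = ?W (\<lambda>i. ?W (\<lambda>j. ?W (\<lambda>k. ?W (f1 i j k))))"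
      by (rule p[where f = "\<lambda>i. ?W (\<lambda>j. ?W (\<lambda>k. ?W (f1 i j k)))"])
    have "f1 = (\<lambda>i j k l. ?W (\<lambda>m. of_bool (coinc (=) i j k l m = 1)))"
      by (intro ext) (rule f1_def)
    then show ?thesis unfolding wsum5_def dens_def 1 2 3 4 5 by simp
  qed
  finally show ?thesis .
qed

lemma dens_part_core:
  assumes "weighting V x" "finite I" "\<pi> ` V \<subseteq> I"
  shows "dens V x (\<lambda>u v. \<pi> u = \<pi> v) = 10 * core I (part_weight V x \<pi>)"
  using dens_part[OF assms(2,3)] dens_eq_core[OF weighting_part[OF assms]] by simp

lemma bdist_cong:
  assumes "\<And>v. v \<in> V \<Longrightarrow> \<pi> v = \<pi>' v"
  shows "bdist V x R \<pi> = bdist V x R \<pi>'"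
  unfolding bdist_def by (intro wsum_cong) (simp add: assms)

text \<open>Recolouring \<open>v\<close> alone affects only the pairs at \<open>v\<close>, which
  enter \<open>bdist\<close> with the factor \<open>2 * x v\<close>; dividing by it turns minimality
  of the partition into minimality of the bad degree of \<open>v\<close>. The diagonal never
  contributes because both relations are reflexive.\<close>

lemma bdist_recolour:
  assumes W: "weighting V x" and sym: "\<And>u v. R u v = R v u" and refl: "\<And>u. R u u"
    and v: "v \<in> V" "0 < x v" and le: "bdist V x R \<pi> \<le> bdist V x R (\<pi>(v := j))"
  shows "wsum V x (\<lambda>u. of_bool ((\<pi> v = \<pi> u) \<noteq> R v u)) \<le> wsum V x (\<lambda>u. of_bool (R v u \<noteq> (\<pi> u = j)))"
proof -
  have fin: "finite V" using W by (simp add: weighting_def)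
  define U where "U = V - {v}"
  define B where "B \<pi> a b = (of_bool ((\<pi> a = (\<pi> b :: nat)) \<noteq> R a b) :: real)" for \<pi> a b
  have Bvv: "B \<pi> v v = 0" for \<pi> using refl by (simp add: B_def)
  have Bs: "B \<pi> a b = B \<pi> b a" for \<pi> a b using sym[of a b] by (auto simp: B_def)
  have rm: "wsum V x f = x v * f v + wsum U x f" for f
    unfolding U_def by (rule wsum_remove[OF fin v(1)])
  have bd: "bdist V x R \<pi> = 2 * x v * wsum U x (B \<pi> v) + wsum U x (\<lambda>a. wsum U x (B \<pi> a))" for \<pi>
  proof -
    have "bdist V x R \<pi> = x v * wsum V x (B \<pi> v) + wsum U x (\<lambda>u. wsum V x (B \<pi> u))"
      unfolding bdist_def B_def[symmetric] by (rule rm)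
    moreover have "wsum V x (B \<pi> u) = x v * B \<pi> u v + wsum U x (B \<pi> u)" for u
      by (rule rm)
    ultimately have "bdist V x R \<pi> = x v * wsum U x (B \<pi> v) + wsum U x (\<lambda>a. x v * B \<pi> a v + wsum U x (B \<pi> a))"
      by (simp add: Bvv)
    also have "wsum U x (\<lambda>a. x v * B \<pi> a v + wsum U x (B \<pi> a)) = x v * wsum U x (B \<pi> v) + wsum U x (\<lambda>a. wsum U x (B \<pi> a))"
      unfolding wsum_add wsum_cmult by (simp add: Bs[of \<pi> _ v])
    finally show ?thesis by simp
  qed
  have rest: "wsum U x (\<lambda>a. wsum U x (B (\<pi>(v := j)) a)) = wsum U x (\<lambda>a. wsum U x (B \<pi> a))"
    by (intro wsum_cong) (auto simp: B_def U_def)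
  have "2 * x v * wsum U x (B \<pi> v) \<le> 2 * x v * wsum U x (B (\<pi>(v := j)) v)"
    using le unfolding bd rest by simp
  then have "wsum U x (B \<pi> v) \<le> wsum U x (B (\<pi>(v := j)) v)" using v by simp
  also have "\<dots> = wsum U x (\<lambda>u. of_bool (R v u \<noteq> (\<pi> u = j)))"
    by (rule wsum_cong) (auto simp: B_def U_def)
  \<comment> \<open>The target keeps the old colour of \<open>v\<close>, so its term at
    \<open>u = v\<close> may be positive; this only enlarges the right-hand side.\<close>
  also have "\<dots> \<le> wsum V x (\<lambda>u. of_bool (R v u \<noteq> (\<pi> u = j)))"
    unfolding rm[of "\<lambda>u. of_bool (R v u \<noteq> (\<pi> u = j))"] using v by simp
  finally have "wsum U x (B \<pi> v) \<le> wsum V x (\<lambda>u. of_bool (R v u \<noteq> (\<pi> u = j)))" .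
  moreover have "wsum V x (B \<pi> v) = x v * B \<pi> v v + wsum U x (B \<pi> v)" by (rule rm)
  moreover have "wsum V x (\<lambda>u. of_bool ((\<pi> v = \<pi> u) \<noteq> R v u)) = wsum V x (B \<pi> v)"
    by (rule wsum_cong) (simp only: B_def)
  ultimately show ?thesis by (simp add: Bvv)
qed

definition eight_part :: "'a set \<Rightarrow> ('a \<Rightarrow> nat) \<Rightarrow> bool" where
  "eight_part V \<pi> \<longleftrightarrow> (\<forall>v\<in>V. \<pi> v < 8)"

lemma bdist_minimal:
  assumes "finite V"
  obtains \<pi> where "eight_part V \<pi>" "\<And>\<pi>'. eight_part V \<pi>' \<Longrightarrow> bdist V x R \<pi> \<le> bdist V x R \<pi>'"
proof -
  let ?P = "PiE V (\<lambda>_. {..<8::nat})"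
  have fin: "finite ?P" using assms by (intro finite_PiE) auto
  have "restrict (\<lambda>_. 0) V \<in> ?P" by auto
  then have "?P \<noteq> {}" by blast
  then obtain \<pi> where \<pi>: "\<pi> \<in> ?P" "\<And>\<pi>'. \<pi>' \<in> ?P \<Longrightarrow> bdist V x R \<pi> \<le> bdist V x R \<pi>'"
    using ex_is_arg_min_if_finite[OF fin, of "bdist V x R"] unfolding is_arg_min_linorder by blast
  have "bdist V x R \<pi> \<le> bdist V x R \<pi>'" if "eight_part V \<pi>'" for \<pi>'
  proof -
    have "restrict \<pi>' V \<in> ?P" using that by (auto simp: eight_part_def)
    then have "bdist V x R \<pi> \<le> bdist V x R (restrict \<pi>' V)" by (rule \<pi>(2))
    also have "\<dots> = bdist V x R \<pi>'" by (rule bdist_cong) simp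
    finally show ?thesis .
  qed
  moreover have "eight_part V \<pi>" using \<pi>(1) by (auto simp: eight_part_def)
  ultimately show ?thesis using that by blast
qed

text \<open>The nearest 8-partition is at least as close as the given one and, by
  \<open>dens_diff\<close>, almost as dense as \<open>R\<close>. Hence \<open>core_stable\<close>
  makes its eight parts nearly equal, and \<open>local_stability\<close> applies with its minimality
  hypothesis supplied by \<open>bdist_recolour\<close>.\<close>

lemma local_structure:
  obtains \<epsilon> where "0 < \<epsilon>" "\<epsilon> \<le> 1"
    "\<And>(V :: 'a set) x R \<pi>. weighting V x \<Longrightarrow> (\<And>u v. R u v = R v u) \<Longrightarrow> (\<And>u. R u u) \<Longrightarrow> eight_part V \<pi> \<Longrightarrow>
      bdist V x R \<pi> \<le> \<epsilon> \<Longrightarrow> 525 / 1024 - \<epsilon> \<le> dens V x R \<Longrightarrow>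
      \<exists>\<pi>. eight_part V \<pi> \<and> bdist V x R \<pi> / 20000 \<le> dens V x (\<lambda>u v. \<pi> u = \<pi> v) - dens V x R"
proof -
  obtain c where c: "c > 0" "\<And>(I :: nat set) w. weighting I w \<Longrightarrow> core I w \<ge> 210 / 4096 - c \<Longrightarrow>
    (\<exists>J\<subseteq>I. card J = 8 \<and> (\<forall>i\<in>J. \<bar>w i - 1 / 8\<bar> < 1 / 10000000))"
    using core_stable[of "1 / 10000000"] by auto
  \<comment> \<open>The partition has \<open>core\<close> at least
    \<open>210 / 4096 - 11 / 10 * \<epsilon>\<close>, so \<open>c / 2\<close> suffices; the other
    bound is the smallness asked for by \<open>local_stability\<close>.\<close>
  define \<epsilon> where "\<epsilon> = min (1 / 100000000) (c / 2)"
  have \<epsilon>: "0 < \<epsilon>" "\<epsilon> \<le> 1 / 100000000" "\<epsilon> \<le> c / 2" using c by (auto simp: \<epsilon>_def)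
  have key: "\<exists>\<pi>. eight_part V \<pi> \<and> bdist V x R \<pi> / 20000 \<le> dens V x (\<lambda>u v. \<pi> u = \<pi> v) - dens V x R"
    if W: "weighting V x" and sym: "\<And>u v. R u v = R v u" and refl: "\<And>u. R u u" and \<pi>0: "eight_part V \<pi>0"
      "bdist V x R \<pi>0 \<le> \<epsilon>" and d: "525 / 1024 - \<epsilon> \<le> dens V x R" for V :: "'a set" and x R \<pi>0
  proof -
    have fin: "finite V" using W by (simp add: weighting_def)
    obtain \<pi> where \<pi>: "eight_part V \<pi>" "\<And>\<pi>'. eight_part V \<pi>' \<Longrightarrow> bdist V x R \<pi> \<le> bdist V x R \<pi>'"
      using bdist_minimal[OF fin] by metis
    have b: "bdist V x R \<pi> \<le> \<epsilon>" using \<pi>(2)[OF \<pi>0(1)] \<pi>0(2) by linarith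
    have p8: "\<pi> v \<in> {..<8}" if "v \<in> V" for v using \<pi>(1) that by (simp add: eight_part_def)
    have "dens V x R - dens V x (\<lambda>u v. \<pi> u = \<pi> v) \<le> 10 * bdist V x R \<pi>"
    proof -
      have "wsum V x (\<lambda>u. wsum V x (\<lambda>v. of_bool (R u v \<noteq> (\<pi> u = \<pi> v)))) = bdist V x R \<pi>"
        unfolding bdist_def by (intro wsum_cong arg_cong[where f = of_bool]) auto
      then show ?thesis using dens_diff[OF W, of R "\<lambda>u v. \<pi> u = \<pi> v"] by simp
    qed
    moreover have "dens V x (\<lambda>u v. \<pi> u = \<pi> v) = 10 * core {..<8} (part_weight V x \<pi>)"
      by (rule dens_part_core[OF W]) (use p8 in auto)
    ultimately have "core {..<8} (part_weight V x \<pi>) \<ge> 210 / 4096 - c" using d b \<epsilon> by linarith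
    moreover have "weighting {..<8} (part_weight V x \<pi>)"
      by (rule weighting_part[OF W]) (use p8 in auto)
    ultimately obtain J where J: "J \<subseteq> {..<8}" "card J = 8" "\<forall>i\<in>J. \<bar>part_weight V x \<pi> i - 1 / 8\<bar> < 1 / 10000000"
      using c(2) by blast
    have "J = {..<8}" using J by (intro card_subset_eq) auto
    then have near: "\<bar>part_weight V x \<pi> i - 1 / 8\<bar> \<le> 1 / 10000000" if "i < 8" for i
      using J(3) that by (auto intro: less_imp_le)
    interpret partition_near_uniform V x \<pi>
      using W p8 near by unfold_locales (auto simp: part_weight_def)
    have "bdist V x R \<pi> / 20000 \<le> dens V x (\<lambda>u v. \<pi> u = \<pi> v) - dens V x R"
      unfolding bdist_def
    proof (rule local_stability)
      show "R u v = R v u" for u v by (rule sym)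
      show "wsum V x (\<lambda>u. wsum V x (\<lambda>v. of_bool ((\<pi> u = \<pi> v) \<noteq> R u v))) \<le> 1 / 100000000"
        using b \<epsilon> by (simp add: bdist_def)
      show "wsum V x (\<lambda>u. of_bool ((\<pi> v = \<pi> u) \<noteq> R v u)) \<le> wsum V x (\<lambda>u. of_bool (R v u \<noteq> (\<pi> u = j)))"
        if "v \<in> V" "0 < x v" "j < 8" for v j
        using that \<pi> by (intro bdist_recolour[OF W sym refl]) (auto simp: eight_part_def)
    qed
    then show ?thesis using \<pi>(1) by blast
  qed
  have "\<epsilon> \<le> 1" using \<epsilon> by linarith
  from that[OF \<epsilon>(1) this] show ?thesis using key by blast
qed

section \<open>Symmetrisation\<close>

definition shift :: "('a \<Rightarrow> real) \<Rightarrow> 'a \<Rightarrow> 'a \<Rightarrow> real \<Rightarrow> 'a \<Rightarrow> real" where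
  "shift x u w t = (\<lambda>v. x v + t * (of_bool (v = u) - of_bool (v = w)))"

lemma wsum_shift:
  assumes "finite V" "u \<in> V" "w \<in> V"
  shows "wsum V (shift x u w t) f = wsum V x f + t * (f u - f w)"
proof -
  have "wsum V (shift x u w t) f = wsum V x f + t * (wsum V (\<lambda>_. 1) (\<lambda>v. of_bool (v = u) * f v) - wsum V (\<lambda>_. 1) (\<lambda>v. of_bool (v = w) * f v))"
    by (simp add: wsum_def shift_def algebra_simps sum.distrib sum_subtractf sum_distrib_left)
  then show ?thesis using assms by (simp add: wsum_eq)
qed

lemma weighting_shift:
  assumes "weighting V x" "u \<in> V" "w \<in> V" "u \<noteq> w" "0 \<le> t" "t \<le> x w"
  shows "weighting V (shift x u w t)"
proof -
  have "sum (shift x u w t) V = 1"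
    using wsum_shift[of V u w x t "\<lambda>_. 1"] assms by (simp add: wsum_def weighting_def)
  moreover have "0 \<le> shift x u w t v" if "v \<in> V" for v
    using assms that by (auto simp: shift_def weighting_def)
  ultimately show ?thesis using assms by (simp add: weighting_def)
qed

context
  fixes V :: "'a set" and x :: "'a \<Rightarrow> real" and R :: "'a \<Rightarrow> 'a \<Rightarrow> bool" and u w :: 'a
  assumes W: "weighting V x" and sym: "\<And>p q. R p q = R q p" and refl: "\<And>p. R p p"
    and uw: "u \<in> V" "w \<in> V" "u \<noteq> w" "R u w"
begin

private definition f :: "'a \<Rightarrow> 'a \<Rightarrow> 'a \<Rightarrow> 'a \<Rightarrow> 'a \<Rightarrow> real" where
  "f a b c d e = of_bool (coinc R a b c d e = 1)"

private definition \<Delta> :: "('a \<Rightarrow> real) \<Rightarrow> real" where "\<Delta> g = g u - g w"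

private abbreviation "E \<equiv> wsum V x"

private definition op :: "bool \<Rightarrow> ('a \<Rightarrow> real) \<Rightarrow> real" where "op b g = (if b then \<Delta> g else E g)"

text \<open>A sum over shifted weights is \<open>E\<close> plus \<open>t\<close> times
  \<open>\<Delta>\<close>. Expanding five of them gives a polynomial in \<open>t\<close>; the
  coefficient of a power collects the \<open>mixed\<close> terms with that many \<open>True\<close>
  flags.\<close>

private definition mixed :: "bool \<Rightarrow> bool \<Rightarrow> bool \<Rightarrow> bool \<Rightarrow> bool \<Rightarrow> real" where
  "mixed i j k l m = op i (\<lambda>a. op j (\<lambda>b. op k (\<lambda>c. op l (\<lambda>d. op m (\<lambda>e. f a b c d e)))))"

private lemma op_add: "op b (\<lambda>v. g v + h v) = op b g + op b h"
  by (simp add: op_def \<Delta>_def wsum_add)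

private lemma op_cmult: "op b (\<lambda>v. c * g v) = c * op b g"
  by (simp add: op_def \<Delta>_def wsum_cmult algebra_simps)

private lemma shift_op: "wsum V (shift x u w t) g = op False g + t * op True g"
  using wsum_shift[of V u w x t g] W uw by (simp add: op_def \<Delta>_def weighting_def)

private lemma R_facts: "R u u" "R w w" "R u w" "R w u"
  using uw sym refl by auto

text \<open>Any two vertices from \<open>u\<close> and \<open>w\<close>, equal or not, count as
  non-adjacent, so three such positions already create three non-adjacent pairs.\<close>

private lemma mixed_three:
  "mixed True True True l m = 0" "mixed True True k True m = 0" "mixed True True k l True = 0"
  "mixed True j True True m = 0" "mixed True j True l True = 0" "mixed True j k True True = 0"
  "mixed i True True True m = 0" "mixed i True True l True = 0" "mixed i True k True True = 0" "mixed i j True True True = 0"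
  unfolding mixed_def op_def \<Delta>_def f_def by (simp_all add: coinc_def R_facts wsum_zero)

text \<open>In a counted tuple through \<open>u\<close> and \<open>w\<close> these two are the only
  non-adjacent pair, so \<open>c, d, e\<close> are adjacent to both. Doubling \<open>u\<close> or
  doubling \<open>w\<close> then again gives exactly one non-adjacent pair.\<close>

private lemma pair_convex: "0 \<le> f u u c d e - f u w c d e - (f w u c d e - f w w c d e)"
proof -
  have "coinc R u u c d e = 1 \<and> coinc R w w c d e = 1" if "coinc R u w c d e = 1 \<or> coinc R w u c d e = 1"
    using that R_facts by (auto simp: coinc_def split: if_splits)
  then show ?thesis by (auto simp: f_def)
qed

private lemma f_perm:
  "f a p b q c = f p q a b c" "f a b p c q = f p q a b c" "f p a q b c = f p q a b c" "f p a b q c = f p q a b c"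
  "f p a b c q = f p q a b c" "f a p q b c = f p q a b c" "f a p b c q = f p q a b c" "f a b p q c = f p q a b c"
  "f a b c p q = f p q a b c"
  unfolding f_def coinc_def using sym[of p q] sym[of p a] sym[of p b] sym[of p c] sym[of q a] sym[of q b] sym[of q c]
  by (simp_all add: ac_simps)

private lemma E_nonneg: "(\<And>v. 0 \<le> g v) \<Longrightarrow> 0 \<le> E g"
  using W by (intro wsum_nonneg) (auto simp: weighting_def)

private lemma pair_convex_perm:
  "0 \<le> f u u a b c - f u w a b c - (f w u a b c - f w w a b c)"
  "0 \<le> f u a u b c - f u a w b c - (f w a u b c - f w a w b c)"
  "0 \<le> f u a b u c - f u a b w c - (f w a b u c - f w a b w c)"
  "0 \<le> f u a b c u - f u a b c w - (f w a b c u - f w a b c w)"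
  "0 \<le> f a u u b c - f a u w b c - (f a w u b c - f a w w b c)"
  "0 \<le> f a u b u c - f a u b w c - (f a w b u c - f a w b w c)"
  "0 \<le> f a u b c u - f a u b c w - (f a w b c u - f a w b c w)"
  "0 \<le> f a b u u c - f a b u w c - (f a b w u c - f a b w w c)"
  "0 \<le> f a b u c u - f a b u c w - (f a b w c u - f a b w c w)"
  "0 \<le> f a b c u u - f a b c u w - (f a b c w u - f a b c w w)"
proof -
  have perm: "f a p b q c = f p q a b c" "f a b p c q = f p q a b c" "f p a q b c = f p q a b c" "f p a b q c = f p q a b c"
    "f p a b c q = f p q a b c" "f a p q b c = f p q a b c" "f a p b c q = f p q a b c" "f a b p q c = f p q a b c"
    "f a b c p q = f p q a b c" for p q
    by (rule f_perm)+
  show "0 \<le> f u u a b c - f u w a b c - (f w u a b c - f w w a b c)"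
    by (rule pair_convex)
  show "0 \<le> f u a u b c - f u a w b c - (f w a u b c - f w a w b c)"
    using pair_convex[of a b c] perm(3)[of u u] perm(3)[of u w] perm(3)[of w u] perm(3)[of w w] by linarith
  show "0 \<le> f u a b u c - f u a b w c - (f w a b u c - f w a b w c)"
    using pair_convex[of a b c] perm(4)[of u u] perm(4)[of u w] perm(4)[of w u] perm(4)[of w w] by linarith
  show "0 \<le> f u a b c u - f u a b c w - (f w a b c u - f w a b c w)"
    using pair_convex[of a b c] perm(5)[of u u] perm(5)[of u w] perm(5)[of w u] perm(5)[of w w] by linarith
  show "0 \<le> f a u u b c - f a u w b c - (f a w u b c - f a w w b c)"
    using pair_convex[of a b c] perm(6)[of u u] perm(6)[of u w] perm(6)[of w u] perm(6)[of w w] by linarith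
  show "0 \<le> f a u b u c - f a u b w c - (f a w b u c - f a w b w c)"
    using pair_convex[of a b c] perm(1)[of u u] perm(1)[of u w] perm(1)[of w u] perm(1)[of w w] by linarith
  show "0 \<le> f a u b c u - f a u b c w - (f a w b c u - f a w b c w)"
    using pair_convex[of a b c] perm(7)[of u u] perm(7)[of u w] perm(7)[of w u] perm(7)[of w w] by linarith
  show "0 \<le> f a b u u c - f a b u w c - (f a b w u c - f a b w w c)"
    using pair_convex[of a b c] perm(8)[of u u] perm(8)[of u w] perm(8)[of w u] perm(8)[of w w] by linarith
  show "0 \<le> f a b u c u - f a b u c w - (f a b w c u - f a b w c w)"
    using pair_convex[of a b c] perm(2)[of u u] perm(2)[of u w] perm(2)[of w u] perm(2)[of w w] by linarith
  show "0 \<le> f a b c u u - f a b c u w - (f a b c w u - f a b c w w)"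
    using pair_convex[of a b c] perm(9)[of u u] perm(9)[of u w] perm(9)[of w u] perm(9)[of w w] by linarith
qed

private lemma mixed_two:
  "0 \<le> mixed True True False False False"
  "0 \<le> mixed True False True False False"
  "0 \<le> mixed True False False True False"
  "0 \<le> mixed True False False False True"
  "0 \<le> mixed False True True False False"
  "0 \<le> mixed False True False True False"
  "0 \<le> mixed False True False False True"
  "0 \<le> mixed False False True True False"
  "0 \<le> mixed False False True False True"
  "0 \<le> mixed False False False True True"
  unfolding mixed_def op_def \<Delta>_def if_True if_False wsum_diff[symmetric]
  by (intro E_nonneg pair_convex_perm)+

text \<open>At most two of the five vertices of a counted tuple lie in \<open>{u, w}\<close>, so the density is quadratic in
  \<open>t\<close>; it is convex because a counted tuple through \<open>u\<close> and \<open>w\<close> stays counted when both become \<open>u\<close> or both \<open>w\<close>.\<close>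

private lemma dens_shift_quadratic:
  "\<exists>c1 c2. 0 \<le> c2 \<and> (\<forall>t. dens V (shift x u w t) R = dens V x R + t * c1 + t\<^sup>2 * c2)"
proof -
  define c1 where "c1 = mixed True False False False False + mixed False True False False False + mixed False False True False False
    + mixed False False False True False + mixed False False False False True"
  define c2 where "c2 = mixed True True False False False + mixed True False True False False + mixed True False False True False
    + mixed True False False False True + mixed False True True False False + mixed False True False True False
    + mixed False True False False True + mixed False False True True False + mixed False False True False True
    + mixed False False False True True"
  have "0 \<le> c2" unfolding c2_def by (intro add_nonneg_nonneg mixed_two)
  moreover have "dens V (shift x u w t) R = dens V x R + t * c1 + t\<^sup>2 * c2" for t
  proof -
    have 0: "dens V x R = mixed False False False False False"
      by (simp add: dens_def wsum5_def mixed_def op_def f_def)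
    have "dens V (shift x u w t) R = wsum V (shift x u w t) (\<lambda>a. wsum V (shift x u w t) (\<lambda>b. wsum V (shift x u w t)
      (\<lambda>c. wsum V (shift x u w t) (\<lambda>d. wsum V (shift x u w t) (\<lambda>e. f a b c d e)))))"
      by (simp add: dens_def wsum5_def f_def)
    also have "\<dots> = dens V x R + t * c1 + t\<^sup>2 * c2"
      unfolding shift_op op_add op_cmult mixed_def[symmetric] mixed_three 0 c1_def c2_def
      by (simp add: algebra_simps power2_eq_square)
    finally show ?thesis .
  qed
  ultimately show ?thesis by blast
qed

text \<open>A convex quadratic does not fall below its initial value in the direction of nonnegative
  initial slope. This holds for every \<open>t \<ge> 0\<close>, not only at the end of the move;
  \<open>global_stability\<close> needs the intermediate weightings as well.\<close>

lemma shift_direction: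
  "(\<forall>t\<ge>0. dens V x R \<le> dens V (shift x u w t) R) \<or> (\<forall>t\<ge>0. dens V x R \<le> dens V (shift x w u t) R)"
proof -
  obtain c1 c2 where c: "0 \<le> c2" "\<And>t. dens V (shift x u w t) R = dens V x R + t * c1 + t\<^sup>2 * c2"
    using dens_shift_quadratic by blast
  have sw: "shift x w u t = shift x u w (- t)" for t by (auto simp: shift_def fun_eq_iff)
  show ?thesis
  proof (cases "0 \<le> c1")
    case True
    then have "dens V x R \<le> dens V (shift x u w t) R" if "0 \<le> t" for t
      using that c by simp
    then show ?thesis by blast
  next
    case False
    then have "dens V x R \<le> dens V (shift x w u t) R" if "0 \<le> t" for t
    proof -
      have "t * c1 \<le> 0" "0 \<le> t\<^sup>2 * c2" using that c(1) False by (auto intro: mult_nonneg_nonpos)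
      then show ?thesis unfolding sw c(2) by simp
    qed
    then show ?thesis by blast
  qed
qed

end

lemma symmetrisation:
  assumes W: "weighting V x" and sym: "\<And>p q. R p q = R q p" and refl: "\<And>p. R p p"
    and uw: "u \<in> V" "w \<in> V" "u \<noteq> w" "R u w" "0 < x u" "0 < x w"
  shows "\<exists>p\<in>V. \<exists>q\<in>V. p \<noteq> q \<and> 0 < x p \<and> 0 < x q \<and> (\<forall>t\<ge>0. dens V x R \<le> dens V (shift x p q t) R)"
  using shift_direction[of V x R u w, OF W sym refl uw(1-4)]
proof
  assume "\<forall>t\<ge>0. dens V x R \<le> dens V (shift x u w t) R"
  then show ?thesis using uw by (intro bexI[of _ u] bexI[of _ w]) simp_all
next
  assume "\<forall>t\<ge>0. dens V x R \<le> dens V (shift x w u t) R"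
  then show ?thesis using uw by (intro bexI[of _ w] bexI[of _ u]) simp_all
qed

definition support :: "'a set \<Rightarrow> ('a \<Rightarrow> real) \<Rightarrow> 'a set" where
  "support V x = {v\<in>V. 0 < x v}"

lemma support_shift_less:
  assumes "finite V" "p \<in> V" "q \<in> V" "p \<noteq> q" "0 < x p" "0 < x q"
  shows "card (support V (shift x p q (x q))) < card (support V x)"
proof (rule psubset_card_mono)
  show "support V (shift x p q (x q)) \<subset> support V x"
    using assms by (auto simp: support_def shift_def)
qed (use assms in \<open>simp add: support_def\<close>)

text \<open>Vertices of weight 0 do not contribute, and on the support the relation is equality, so
  the vertices themselves act as parts.\<close>

lemma dens_clique:
  assumes W: "weighting V x" and refl: "\<And>p. R p p"
    and cl: "\<And>u w. u \<in> support V x \<Longrightarrow> w \<in> support V x \<Longrightarrow> R u w \<Longrightarrow> u = w"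
  shows "dens V x R = 10 * core V x"
proof -
  have cong: "wsum V x f = wsum V x g" if "\<And>v. v \<in> support V x \<Longrightarrow> f v = g v" for f g
    unfolding wsum_def
  proof (rule sum.cong)
    fix v assume v: "v \<in> V"
    show "x v * f v = x v * g v"
    proof (cases "x v = 0")
      case False
      then have "v \<in> support V x" using W v by (auto simp: support_def weighting_def order_less_le)
      then show ?thesis using that by simp
    qed simp
  qed simp
  have R: "R u w \<longleftrightarrow> u = w" if "u \<in> support V x" "w \<in> support V x" for u w
    using cl[OF that] refl by auto
  have "dens V x R = dens V x (=)"
    unfolding dens_def wsum5_def
    by (intro cong) (simp add: coinc_def R)
  then show ?thesis using dens_eq_core[OF W] by simp
qed

theorem dens_le:
  assumes W: "weighting V x" and sym: "\<And>p q. R p q = R q p" and refl: "\<And>p. R p p"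
  shows "dens V x R \<le> 525 / 1024"
  using W
proof (induction "card (support V x)" arbitrary: x rule: less_induct)
  case less
  have fin: "finite V" using less.prems by (simp add: weighting_def)
  show ?case
  proof (cases "\<exists>u\<in>support V x. \<exists>w\<in>support V x. R u w \<and> u \<noteq> w")
    case True
    then obtain u w where uw: "u \<in> V" "w \<in> V" "u \<noteq> w" "R u w" "0 < x u" "0 < x w" by (auto simp: support_def)
    obtain p q where pq: "p \<in> V" "q \<in> V" "p \<noteq> q" "0 < x p" "0 < x q"
      "\<forall>t\<ge>0. dens V x R \<le> dens V (shift x p q t) R"
      using symmetrisation[of V x R, OF less.prems sym refl uw] by (elim bexE conjE) simp
    have "dens V (shift x p q (x q)) R \<le> 525 / 1024"
      using support_shift_less[where x = x, OF fin pq(1-5)] weighting_shift[OF less.prems pq(1-3), of "x q"] pq(5)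
      by (intro less.hyps) auto
    moreover have "dens V x R \<le> dens V (shift x p q (x q)) R" using pq by simp
    ultimately show ?thesis by linarith
  next
    case False
    then have "dens V x R = 10 * core V x" by (intro dens_clique less.prems refl) blast
    then show ?thesis using core_le[OF less.prems] by simp
  qed
qed

text \<open>Each of the two nested averages changes by at most a constant times the moved weight.
  This limits how far one small step can lead away from an 8-partition.\<close>

lemma bdist_shift:
  assumes W: "weighting V x" and pq: "p \<in> V" "q \<in> V" "p \<noteq> q" and st: "0 \<le> s" "s \<le> t" "t \<le> x q"
  shows "bdist V (shift x p q s) R \<pi> \<le> bdist V (shift x p q t) R \<pi> + 4 * (t - s)"
proof -
  have fin: "finite V" using W by (simp add: weighting_def)
  let ?s = "shift x p q s" and ?t = "shift x p q t"
  define B where "B u v = (of_bool ((\<pi> u = \<pi> v) \<noteq> R u v) :: real)" for u v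
  have Ws: "weighting V ?s" and Wt: "weighting V ?t" using W pq st by (auto intro!: weighting_shift)
  have c: "wsum V ?s (\<lambda>_. c) = c" "wsum V ?t (\<lambda>_. c) = c" for c
    using Ws Wt by (auto simp: wsum_const weighting_def)
  have step: "wsum V ?s g \<le> wsum V ?t g + 2 * (t - s)" if g: "\<And>v. 0 \<le> g v" "\<And>v. g v \<le> 1" for g
  proof -
    have "wsum V ?s g - wsum V ?t g = (t - s) * (g q - g p)"
      using fin pq by (simp add: wsum_shift algebra_simps)
    also have "\<dots> \<le> (t - s) * 1" using st g[of q] g[of p] by (intro mult_left_mono) auto
    finally have "wsum V ?s g - wsum V ?t g \<le> (t - s) * 1" .
    moreover have "X - Y \<le> d * 1 \<Longrightarrow> 0 \<le> d \<Longrightarrow> X \<le> Y + 2 * d" for X Y d :: real by simp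
    ultimately show ?thesis using st by simp
  qed
  have b1: "0 \<le> B u v" "B u v \<le> 1" for u v by (auto simp: B_def)
  have b2: "0 \<le> wsum V ?t (B u)" "wsum V ?t (B u) \<le> 1" for u
  proof -
    show "0 \<le> wsum V ?t (B u)" using Wt b1 by (intro wsum_nonneg) (auto simp: weighting_def)
    have "wsum V ?t (B u) \<le> wsum V ?t (\<lambda>_. 1)" using Wt b1 by (intro wsum_mono) (auto simp: weighting_def)
    then show "wsum V ?t (B u) \<le> 1" by (simp add: c)
  qed
  have "bdist V ?s R \<pi> = wsum V ?s (\<lambda>u. wsum V ?s (B u))" by (simp add: bdist_def B_def[abs_def])
  also have "\<dots> \<le> wsum V ?s (\<lambda>u. wsum V ?t (B u) + 2 * (t - s))"
    using Ws step b1 by (intro wsum_mono) (auto simp: weighting_def)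
  also have "\<dots> = wsum V ?s (\<lambda>u. wsum V ?t (B u)) + 2 * (t - s)" by (simp add: wsum_add c)
  also have "\<dots> \<le> wsum V ?t (\<lambda>u. wsum V ?t (B u)) + 2 * (t - s) + 2 * (t - s)"
    using step[of "\<lambda>u. wsum V ?t (B u)"] b2 by simp
  also have "wsum V ?t (\<lambda>u. wsum V ?t (B u)) = bdist V ?t R \<pi>" by (simp add: bdist_def B_def[abs_def])
  finally show ?thesis by simp
qed

text \<open>The eight heavy vertices receive different colours and all others colour 0. Every
  misplaced pair then has a vertex outside \<open>J\<close>, where the total weight is at most
  \<open>8 * \<eta>\<close>.\<close>

lemma clique_near:
  assumes W: "weighting V x" and refl: "\<And>p. R p p"
    and cl: "\<And>u w. u \<in> support V x \<Longrightarrow> w \<in> support V x \<Longrightarrow> R u w \<Longrightarrow> u = w"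
    and J: "J \<subseteq> V" "card J = 8" "\<And>i. i \<in> J \<Longrightarrow> \<bar>x i - 1 / 8\<bar> < \<eta>" and \<eta>: "\<eta> \<le> 1 / 8"
  shows "\<exists>\<pi>. eight_part V \<pi> \<and> bdist V x R \<pi> \<le> 16 * \<eta>"
proof -
  have fin: "finite V" using W by (simp add: weighting_def)
  have finJ: "finite J" using J(1) fin by (rule finite_subset)
  obtain h where h: "bij_betw h J {..<8::nat}"
    using finite_same_card_bij[OF finJ, of "{..<8::nat}"] J(2) by auto
  define \<pi> where "\<pi> v = (if v \<in> J then h v else 0)" for v
  have 8: "eight_part V \<pi>" using h by (auto simp: eight_part_def \<pi>_def bij_betw_def)
  have sJ: "v \<in> support V x" if "v \<in> J" for v
    using J(1) J(3)[OF that] \<eta> that by (auto simp: support_def)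
  have bad: "(of_bool ((\<pi> u = \<pi> v) \<noteq> R u v) :: real) \<le> of_bool (u \<notin> J) + of_bool (v \<notin> J)" for u v
  proof (cases "u \<in> J \<and> v \<in> J")
    case True
    then have "(\<pi> u = \<pi> v) = (u = v)" using h by (auto simp: \<pi>_def bij_betw_def inj_on_eq_iff)
    moreover have "R u v = (u = v)" using cl[of u v] sJ True refl by auto
    ultimately show ?thesis by simp
  qed auto
  have "bdist V x R \<pi> \<le> wsum V x (\<lambda>u. wsum V x (\<lambda>v. of_bool (u \<notin> J) + of_bool (v \<notin> J)))"
    unfolding bdist_def using W bad by (intro wsum_mono) (auto simp: weighting_def)
  also have "\<dots> = 2 * wsum V x (\<lambda>v. of_bool (v \<notin> J))"
    using W by (simp add: wsum_add wsum_const weighting_def)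
  also have "wsum V x (\<lambda>v. of_bool (v \<notin> J)) = 1 - sum x J"
  proof -
    have "wsum V x (\<lambda>v. of_bool (v \<notin> J)) = sum x (V - J)"
      unfolding wsum_def using fin by (intro sum.mono_neutral_cong_right) auto
    then show ?thesis using W J fin by (simp add: sum_diff weighting_def)
  qed
  also have "1 - sum x J \<le> 8 * \<eta>"
  proof -
    have "(\<Sum>i\<in>J. 1 / 8 - \<eta>) \<le> sum x J" using J(3) by (intro sum_mono) (fastforce simp: abs_less_iff)
    then show ?thesis using J(2) by simp
  qed
  finally show ?thesis using 8 by (intro exI[of _ \<pi>]) simp
qed

theorem global_stability:
  obtains c where "0 < c"
    "\<And>(V :: 'a set) x R. weighting V x \<Longrightarrow> (\<And>u v. R u v = R v u) \<Longrightarrow> (\<And>u. R u u) \<Longrightarrow> 525 / 1024 - c \<le> dens V x R \<Longrightarrow>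
      \<exists>\<pi>. eight_part V \<pi> \<and> bdist V x R \<pi> / 20000 \<le> dens V x (\<lambda>u v. \<pi> u = \<pi> v) - dens V x R"
proof -
  obtain \<epsilon> where \<epsilon>: "0 < \<epsilon>" "\<epsilon> \<le> 1" and loc:
    "\<And>(V :: 'a set) x R \<pi>. weighting V x \<Longrightarrow> (\<And>u v. R u v = R v u) \<Longrightarrow> (\<And>u. R u u) \<Longrightarrow> eight_part V \<pi> \<Longrightarrow>
      bdist V x R \<pi> \<le> \<epsilon> \<Longrightarrow> 525 / 1024 - \<epsilon> \<le> dens V x R \<Longrightarrow>
      \<exists>\<pi>. eight_part V \<pi> \<and> bdist V x R \<pi> / 20000 \<le> dens V x (\<lambda>u v. \<pi> u = \<pi> v) - dens V x R"
    using local_structure[where 'a = 'a] by metis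
  obtain d where d: "d > 0" "\<And>(I :: 'a set) w. weighting I w \<Longrightarrow> core I w \<ge> 210 / 4096 - d \<Longrightarrow>
    (\<exists>J\<subseteq>I. card J = 8 \<and> (\<forall>i\<in>J. \<bar>w i - 1 / 8\<bar> < \<epsilon> / 16))"
    using core_stable[of "\<epsilon> / 16"] \<epsilon> by auto
  \<comment> \<open>By the local result and \<open>dens_le\<close>, a distance of at most
    \<open>\<epsilon>\<close> improves to at most
    \<open>20000 * c \<le> \<epsilon> / 2\<close>.\<close>
  define c where "c = min d (\<epsilon> / 40000)"
  have c: "0 < c" "c \<le> d" "c \<le> \<epsilon> / 40000" using d \<epsilon> by (auto simp: c_def)
  have near: "\<exists>\<pi>. eight_part V \<pi> \<and> bdist V x R \<pi> \<le> \<epsilon>"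
    if "weighting V x" and sym: "\<And>u v. R u v = R v u" and refl: "\<And>u. R u u" and "525 / 1024 - c \<le> dens V x R"
    for V :: "'a set" and x R
    using that(1,4)
  proof (induction "card (support V x)" arbitrary: x rule: less_induct)
    case less
    have W: "weighting V x" by fact
    have fin: "finite V" using W by (simp add: weighting_def)
    show ?case
    proof (cases "\<exists>u\<in>support V x. \<exists>w\<in>support V x. R u w \<and> u \<noteq> w")
      case False
      then have cl: "u = w" if "u \<in> support V x" "w \<in> support V x" "R u w" for u w using that by blast
      have "dens V x R = 10 * core V x" by (rule dens_clique[OF W refl cl])
      then have "core V x \<ge> 210 / 4096 - d" using less.prems(2) c by simp
      then obtain J where J: "J \<subseteq> V" "card J = 8" "\<forall>i\<in>J. \<bar>x i - 1 / 8\<bar> < \<epsilon> / 16" using d(2)[OF W] by blast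
      have "\<exists>\<pi>. eight_part V \<pi> \<and> bdist V x R \<pi> \<le> 16 * (\<epsilon> / 16)"
        using J \<epsilon> by (intro clique_near[OF W refl cl]) auto
      then show ?thesis by simp
    next
      case True
      then obtain u w where uw: "u \<in> V" "w \<in> V" "u \<noteq> w" "R u w" "0 < x u" "0 < x w" by (auto simp: support_def)
      obtain p q where pq: "p \<in> V" "q \<in> V" "p \<noteq> q" "0 < x p" "0 < x q"
        and up: "\<forall>t\<ge>0. dens V x R \<le> dens V (shift x p q t) R"
        using symmetrisation[of V x R, OF W sym refl uw] by (elim bexE conjE) simp
      define T where "T = x q"
      have Wt: "weighting V (shift x p q t)" if "0 \<le> t" "t \<le> T" for t
        using W pq that by (intro weighting_shift) (auto simp: T_def)
      have dt: "525 / 1024 - c \<le> dens V (shift x p q t) R" if "0 \<le> t" for t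
        using up that less.prems(2) by fastforce
      \<comment> \<open>The distance drops to \<open>\<epsilon> / 2\<close>, possibly for another
        partition, and a backward step of length \<open>\<epsilon> / 8\<close> adds at most
        \<open>4 * \<epsilon> / 8\<close>, so it returns to at most
        \<open>\<epsilon>\<close>.\<close>
      have propagate: "\<exists>\<pi>. eight_part V \<pi> \<and> bdist V (shift x p q s) R \<pi> \<le> \<epsilon>"
        if ex: "\<exists>\<pi>. eight_part V \<pi> \<and> bdist V (shift x p q t) R \<pi> \<le> \<epsilon>" and st: "0 \<le> s" "s \<le> t" "t \<le> T" "t - s \<le> \<epsilon> / 8" for s t
      proof -
        have t: "0 \<le> t" using st by simp
        obtain \<pi>0 where "eight_part V \<pi>0" "bdist V (shift x p q t) R \<pi>0 \<le> \<epsilon>" using ex by blast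
        moreover have "525 / 1024 - \<epsilon> \<le> dens V (shift x p q t) R" using dt[OF t] c \<epsilon> by simp
        ultimately obtain \<pi> where \<pi>: "eight_part V \<pi>" "bdist V (shift x p q t) R \<pi> / 20000
            \<le> dens V (shift x p q t) (\<lambda>u v. \<pi> u = \<pi> v) - dens V (shift x p q t) R"
          using loc[of V "shift x p q t" R \<pi>0, OF Wt[OF t st(3)] sym refl] by blast
        have "dens V (shift x p q t) (\<lambda>u v. \<pi> u = \<pi> v) \<le> 525 / 1024"
          by (rule dens_le[OF Wt[OF t st(3)]]) auto
        then have "bdist V (shift x p q t) R \<pi> \<le> \<epsilon> / 2" using \<pi>(2) dt[OF t] c by linarith
        moreover have "bdist V (shift x p q s) R \<pi> \<le> bdist V (shift x p q t) R \<pi> + 4 * (t - s)"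
          using W pq st by (intro bdist_shift) (auto simp: T_def)
        ultimately show ?thesis using \<pi>(1) st(4) by (intro exI[of _ \<pi>]) auto
      qed
      obtain n :: nat where n: "T / (\<epsilon> / 8) < real n" using reals_Archimedean2 by blast
      have T0: "0 < T" using pq by (simp add: T_def)
      have n0: "0 < n"
      proof (rule ccontr)
        assume "\<not> 0 < n"
        then show False using n T0 \<epsilon> by (simp add: divide_less_0_iff)
      qed
      define \<delta> where "\<delta> = T / real n"
      have \<delta>: "0 \<le> \<delta>" "\<delta> \<le> \<epsilon> / 8" "real n * \<delta> = T"
        using n n0 \<epsilon> T0 by (simp_all add: \<delta>_def field_simps)
      \<comment> \<open>The walk starts at \<open>T\<close>, where \<open>q\<close> has lost its
        weight and the induction hypothesis for the smaller support applies, and ends at 0, the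
        original weighting.\<close>
      have "\<exists>\<pi>. eight_part V \<pi> \<and> bdist V (shift x p q (T - real k * \<delta>)) R \<pi> \<le> \<epsilon>" if "k \<le> n" for k
        using that
      proof (induction k)
        case 0
        have "\<exists>\<pi>. eight_part V \<pi> \<and> bdist V (shift x p q T) R \<pi> \<le> \<epsilon>"
          using less.hyps[OF support_shift_less[where x = x, OF fin pq(1-5)]] Wt[of T] dt[of T] T0 by (simp add: T_def)
        then show ?case by simp
      next
        case (Suc k)
        have e: "real (Suc k) * \<delta> = real k * \<delta> + \<delta>" by (simp add: distrib_right)
        have "real (Suc k) * \<delta> \<le> real n * \<delta>"
          using Suc.prems \<delta> by (intro mult_right_mono) auto
        then have le: "real (Suc k) * \<delta> \<le> T" using \<delta> by simp
        have k0: "0 \<le> real k * \<delta>" using \<delta> by simp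
        show ?case
        proof (rule propagate[where t = "T - real k * \<delta>" and s = "T - real (Suc k) * \<delta>"])
          show "\<exists>\<pi>. eight_part V \<pi> \<and> bdist V (shift x p q (T - real k * \<delta>)) R \<pi> \<le> \<epsilon>"
            using Suc by simp
        qed (use e le k0 \<delta>(1,2) in linarith)+
      qed
      from this[of n] have "\<exists>\<pi>. eight_part V \<pi> \<and> bdist V (shift x p q 0) R \<pi> \<le> \<epsilon>" using \<delta> by simp
      then show ?thesis by (simp add: shift_def)
    qed
  qed
  have key: "\<exists>\<pi>. eight_part V \<pi> \<and> bdist V x R \<pi> / 20000 \<le> dens V x (\<lambda>u v. \<pi> u = \<pi> v) - dens V x R"
    if A: "weighting V x" "\<And>u v. R u v = R v u" "\<And>u. R u u" "525 / 1024 - c \<le> dens V x R" for V :: "'a set" and x R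
  proof -
    obtain \<pi> where "eight_part V \<pi>" "bdist V x R \<pi> \<le> \<epsilon>" using near[of V x R, OF A] by blast
    moreover have "525 / 1024 - \<epsilon> \<le> dens V x R" using A(4) c \<epsilon> by simp
    ultimately show ?thesis using loc[of V x R, OF A(1-3)] by blast
  qed
  from that[OF c(1)] show ?thesis using key by blast
qed

section \<open>Counting in graphs\<close>

definition K2111 :: "(nat \<times> nat) sgraph" where "K2111 = complete_multipartite [2, 1, 1, 1]"

definition two_sets :: "'a set \<Rightarrow> 'a set set" where
  "two_sets X = {e. e \<subseteq> X \<and> card e = 2}"

lemma two_sets_image:
  assumes "bij_betw \<sigma> A B"
  shows "(\<lambda>e. \<sigma> ` e) ` two_sets A = two_sets B"
proof (intro set_eqI iffI)
  fix e assume "e \<in> (\<lambda>e. \<sigma> ` e) ` two_sets A"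
  then obtain e' where "e' \<subseteq> A" "card e' = 2" "e = \<sigma> ` e'" by (auto simp: two_sets_def)
  then show "e \<in> two_sets B"
    using assms by (auto simp: two_sets_def bij_betw_def card_image inj_on_subset)
next
  fix e assume "e \<in> two_sets B"
  then have e: "e \<subseteq> B" "card e = 2" by (auto simp: two_sets_def)
  define e' where "e' = inv_into A \<sigma> ` e"
  have "\<sigma> ` e' = e"
    using e assms unfolding e'_def by (metis bij_betw_def image_inv_into_cancel)
  moreover have "e' \<subseteq> A" using e assms unfolding e'_def bij_betw_def by (auto intro: inv_into_into)
  moreover have "card e' = 2"
    using e assms unfolding e'_def bij_betw_def by (subst card_image) (auto intro: inj_on_inv_into)
  ultimately show "e \<in> (\<lambda>e. \<sigma> ` e) ` two_sets A" by (auto simp: two_sets_def)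
qed

lemma verts_K2111: "verts K2111 = {(0, 0), (0, 1), (1, 0), (2, 0), (3, 0)}"
  by (auto simp: K2111_def complete_multipartite_def Let_def lessThan_Suc numeral_eq_Suc less_Suc_eq)

lemma order_K2111: "order K2111 = 5"
  by (simp add: order_def verts_K2111)

lemma edges_K2111: "edges K2111 = two_sets (verts K2111) - {{(0, 0), (0, 1)}}"
proof -
  let ?P = "(\<lambda>i. {i} \<times> {..<[2, 1, 1, 1] ! i}) ` {..<length [2, 1, 1, 1 :: nat]}"
  have V: "verts K2111 = \<Union> ?P" by (simp only: K2111_def complete_multipartite_def Let_def sgraph.simps)
  have "edges K2111 = partite_edges ?P" by (simp only: K2111_def complete_multipartite_def Let_def sgraph.simps)
  also have "\<dots> = {{u, v} | u v. u \<in> verts K2111 \<and> v \<in> verts K2111 \<and> fst u \<noteq> fst v}"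
    unfolding V partite_edges_def by fastforce
  also have "\<dots> = two_sets (verts K2111) - {{(0, 0), (0, 1)}}"
  proof (intro set_eqI iffI)
    fix e assume "e \<in> {{u, v} | u v. u \<in> verts K2111 \<and> v \<in> verts K2111 \<and> fst u \<noteq> fst v}"
    then obtain u v where "e = {u, v}" "u \<in> verts K2111" "v \<in> verts K2111" "fst u \<noteq> fst v" by blast
    then show "e \<in> two_sets (verts K2111) - {{(0, 0), (0, 1)}}"
      by (auto simp: two_sets_def card_insert_if doubleton_eq_iff)
  next
    fix e assume e: "e \<in> two_sets (verts K2111) - {{(0, 0), (0, 1)}}"
    then obtain u v where uv: "e = {u, v}" "u \<noteq> v" by (auto simp: two_sets_def card_2_iff)
    then have in_V: "u \<in> verts K2111" "v \<in> verts K2111" using e by (auto simp: two_sets_def)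
    then have "fst u \<noteq> fst v" using e uv unfolding verts_K2111 by (auto simp: insert_commute)
    then show "e \<in> {{u, v} | u v. u \<in> verts K2111 \<and> v \<in> verts K2111 \<and> fst u \<noteq> fst v}" using uv in_V by blast
  qed
  finally show ?thesis .
qed

definition nonedges :: "'a sgraph \<Rightarrow> 'a set \<Rightarrow> 'a set set" where
  "nonedges G X = two_sets X - edges G"

text \<open>The pattern is \<open>K_5\<close> minus one edge. An isomorphism only has to send its
  missing pair to the missing pair; the other three vertices may be matched arbitrarily.\<close>

lemma isomorphic_K5m_iff:
  fixes G :: "'a sgraph"
  assumes G: "simple_graph G" and X: "card X = 5"
  shows "isomorphic K2111 (induced G X) \<longleftrightarrow> card (nonedges G X) = 1"
proof -
  let ?V = "verts K2111" and ?e = "{(0::nat, 0::nat), (0, 1)}"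
  have finX: "finite X" using X by (simp add: card_ge_0_finite)
  have E: "edges (induced G X) = two_sets X - nonedges G X"
    using G by (auto simp: induced_def nonedges_def two_sets_def simple_graph_def)
  have sub: "nonedges G X \<subseteq> two_sets X" by (auto simp: nonedges_def)
  have map: "map_edges \<sigma> K2111 = two_sets X - {\<sigma> ` ?e}" if "bij_betw \<sigma> ?V X" for \<sigma>
  proof -
    have inj: "inj_on (\<lambda>e. \<sigma> ` e) (two_sets ?V)"
      using that by (intro inj_onI) (auto simp: two_sets_def bij_betw_def inj_on_image_eq_iff)
    have "?e \<in> two_sets ?V" unfolding verts_K2111 by (auto simp: two_sets_def)
    then have "(\<lambda>e. \<sigma> ` e) ` (two_sets ?V - {?e}) = (\<lambda>e. \<sigma> ` e) ` two_sets ?V - (\<lambda>e. \<sigma> ` e) ` {?e}"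
      using inj by (intro inj_on_image_set_diff[of _ "two_sets ?V"]) auto
    then show ?thesis unfolding map_edges_def edges_K2111 two_sets_image[OF that] by simp
  qed
  show ?thesis
  proof
    assume "isomorphic K2111 (induced G X)"
    then obtain \<sigma> where \<sigma>: "bij_betw \<sigma> ?V X" "map_edges \<sigma> K2111 = edges (induced G X)"
      by (auto simp: isomorphic_def induced_def)
    have "?e \<in> two_sets ?V" unfolding verts_K2111 by (auto simp: two_sets_def)
    then have "\<sigma> ` ?e \<in> two_sets X" unfolding two_sets_image[OF \<sigma>(1), symmetric] by (rule imageI)
    moreover have "two_sets X - {\<sigma> ` ?e} = two_sets X - nonedges G X" using map[OF \<sigma>(1)] \<sigma>(2) E by simp
    ultimately have "nonedges G X = {\<sigma> ` ?e}" using sub by blast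
    then show "card (nonedges G X) = 1" by simp
  next
    assume "card (nonedges G X) = 1"
    then obtain e where e: "nonedges G X = {e}" by (auto simp: card_1_singleton_iff)
    then have "e \<in> two_sets X" using sub by auto
    then obtain a b where ab: "e = {a, b}" "a \<noteq> b" "a \<in> X" "b \<in> X" by (auto simp: two_sets_def card_2_iff)
    have "card (?V - ?e) = card (X - {a, b})"
      using X ab finX unfolding verts_K2111 by (simp add: card_Diff_subset)
    then obtain \<tau> where \<tau>: "bij_betw \<tau> (?V - ?e) (X - {a, b})"
      using finite_same_card_bij[of "?V - ?e" "X - {a, b}"] finX unfolding verts_K2111 by auto
    define \<sigma> where "\<sigma> = (\<lambda>v. if v = (0, 0) then a else if v = (0, 1) then b else \<tau> v)"
    have "bij_betw \<sigma> (?V - ?e) (X - {a, b})"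
      using \<tau> by (subst bij_betw_cong[of _ \<sigma> \<tau>]) (auto simp: \<sigma>_def)
    moreover have "bij_betw \<sigma> ?e {a, b}"
      using ab by (auto simp: bij_betw_def \<sigma>_def inj_on_def)
    ultimately have "bij_betw \<sigma> ((?V - ?e) \<union> ?e) ((X - {a, b}) \<union> {a, b})"
      by (rule bij_betw_combine) auto
    moreover have "(?V - ?e) \<union> ?e = ?V" unfolding verts_K2111 by auto
    moreover have "(X - {a, b}) \<union> {a, b} = X" using ab by auto
    ultimately have bij: "bij_betw \<sigma> ?V X" by simp
    have "\<sigma> ` ?e = e" by (auto simp: \<sigma>_def ab)
    then have "map_edges \<sigma> K2111 = edges (induced G X)" using map[OF bij] E e by simp
    then show "isomorphic K2111 (induced G X)" using bij by (auto simp: isomorphic_def induced_def)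
  qed
qed

definition nonadj :: "'a sgraph \<Rightarrow> 'a \<Rightarrow> 'a \<Rightarrow> bool" where
  "nonadj G u v \<longleftrightarrow> {u, v} \<notin> edges G"

lemma nonadj_sym: "nonadj G u v = nonadj G v u"
  by (simp add: nonadj_def insert_commute)

lemma nonadj_refl: "simple_graph G \<Longrightarrow> nonadj G u u"
  by (auto simp: nonadj_def simple_graph_def)

lemma two_sets_5:
  "two_sets {a, b, c, d, e} = {{a, b}, {a, c}, {a, d}, {a, e}, {b, c}, {b, d}, {b, e}, {c, d}, {c, e}, {d, e}}"
  if "distinct [a, b, c, d, e]"
proof (intro set_eqI iffI)
  fix z assume "z \<in> two_sets {a, b, c, d, e}"
  then obtain u v where "z = {u, v}" "u \<noteq> v" "u \<in> {a, b, c, d, e}" "v \<in> {a, b, c, d, e}"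
    by (auto simp: two_sets_def card_2_iff)
  then show "z \<in> {{a, b}, {a, c}, {a, d}, {a, e}, {b, c}, {b, d}, {b, e}, {c, d}, {c, e}, {d, e}}"
    by (elim insertE emptyE) (auto simp: doubleton_eq_iff)
next
  fix z assume "z \<in> {{a, b}, {a, c}, {a, d}, {a, e}, {b, c}, {b, d}, {b, e}, {c, d}, {c, e}, {d, e}}"
  then show "z \<in> two_sets {a, b, c, d, e}" using that by (auto simp: two_sets_def)
qed

lemma coinc_nonadj:
  assumes "distinct [a, b, c, d, e]"
  shows "coinc (nonadj G) a b c d e = card (nonedges G {a, b, c, d, e})"
proof -
  have fin: "finite (two_sets {a, b, c, d, e})" unfolding two_sets_5[OF assms] by simp
  have "card (nonedges G {a, b, c, d, e}) = (\<Sum>z\<in>two_sets {a, b, c, d, e}. of_bool (z \<notin> edges G))"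
    using fin by (simp add: nonedges_def Diff_eq Collect_neg_eq)
  also have "\<dots> = coinc (nonadj G) a b c d e"
    unfolding two_sets_5[OF assms] coinc_def nonadj_def
    using assms by (simp add: doubleton_eq_iff del: sum_of_bool_eq)
  finally show ?thesis by simp
qed

lemma sum_lists_Suc:
  assumes "finite V"
  shows "(\<Sum>xs\<in>{xs. set xs \<subseteq> V \<and> length xs = Suc n}. f xs)
    = (\<Sum>a\<in>V. \<Sum>ys\<in>{ys. set ys \<subseteq> V \<and> length ys = n}. f (a # ys))"
proof -
  have eq: "{xs. set xs \<subseteq> V \<and> length xs = Suc n} = (\<lambda>(a, ys). a # ys) ` (V \<times> {ys. set ys \<subseteq> V \<and> length ys = n})"
    by (auto simp: length_Suc_conv)
  have "inj_on (\<lambda>(a, ys). a # ys) (V \<times> {ys. set ys \<subseteq> V \<and> length ys = n})"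
    by (auto simp: inj_on_def)
  then show ?thesis unfolding eq by (simp add: sum.reindex sum.cartesian_product case_prod_unfold)
qed

lemma sum5_lists:
  fixes f :: "'a list \<Rightarrow> real"
  assumes "finite V"
  shows "wsum5 V (\<lambda>_. 1) (\<lambda>a b c d e. f [a, b, c, d, e]) = sum f {xs. set xs \<subseteq> V \<and> length xs = 5}"
proof -
  have 0: "{ys. set ys \<subseteq> V \<and> length ys = 0} = {[]}" by auto
  have 5: "5 = Suc (Suc (Suc (Suc (Suc 0))))" by simp
  show ?thesis unfolding 5 sum_lists_Suc[OF assms] 0 by (simp add: wsum5_def wsum_def)
qed

text \<open>Each suitable vertex set occurs once for each of its \<open>5! = 120\<close>
  orderings.\<close>

lemma distinct_tuple_count:
  assumes G: "simple_graph G"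
  shows "wsum5 (verts G) (\<lambda>_. 1) (\<lambda>a b c d e. of_bool (distinct [a, b, c, d, e] \<and> coinc (nonadj G) a b c d e = 1))
    = 120 * real (ind_count K2111 G)"
proof -
  let ?V = "verts G"
  have fin: "finite ?V" using G by (simp add: simple_graph_def)
  define \<X> where "\<X> = {X. X \<subseteq> ?V \<and> card X = 5 \<and> card (nonedges G X) = 1}"
  have "ind_count K2111 G = card {X. X \<subseteq> ?V \<and> card X = 5 \<and> isomorphic K2111 (induced G X)}"
    by (simp only: ind_count_def order_K2111)
  also have "{X. X \<subseteq> ?V \<and> card X = 5 \<and> isomorphic K2111 (induced G X)} = \<X>"
    using isomorphic_K5m_iff[OF G] unfolding \<X>_def by auto
  finally have X: "ind_count K2111 G = card \<X>" .
  have fX: "finite \<X>" by (rule finite_subset[of _ "Pow ?V"]) (use fin in \<open>auto simp: \<X>_def\<close>)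
  have finX: "finite X" if "X \<in> \<X>" for X
    using that fin finite_subset unfolding \<X>_def by blast
  define f :: "'a list \<Rightarrow> real" where "f xs = of_bool (distinct xs \<and> card (nonedges G (set xs)) = 1)" for xs
  have "of_bool (distinct [a, b, c, d, e] \<and> coinc (nonadj G) a b c d e = 1) = f [a, b, c, d, e]" for a b c d e
  proof (cases "distinct [a, b, c, d, e]")
    case True
    then show ?thesis using coinc_nonadj[OF True, of G] unfolding f_def by (simp only: list.set)
  next
    case False
    then show ?thesis unfolding f_def by (simp only: simp_thms of_bool_eq)
  qed
  then have "wsum5 ?V (\<lambda>_. 1) (\<lambda>a b c d e. of_bool (distinct [a, b, c, d, e] \<and> coinc (nonadj G) a b c d e = 1))
    = wsum5 ?V (\<lambda>_. 1) (\<lambda>a b c d e. f [a, b, c, d, e])"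
    by (simp only:)
  also have "\<dots> = sum f {xs. set xs \<subseteq> ?V \<and> length xs = 5}" by (rule sum5_lists[OF fin])
  also have "\<dots> = real (card {xs \<in> {xs. set xs \<subseteq> ?V \<and> length xs = 5}. distinct xs \<and> card (nonedges G (set xs)) = 1})"
    unfolding f_def using fin by (simp add: finite_lists_length_eq Int_def)
  also have "{xs \<in> {xs. set xs \<subseteq> ?V \<and> length xs = 5}. distinct xs \<and> card (nonedges G (set xs)) = 1}
    = (\<Union>X\<in>\<X>. permutations_of_set X)"
    by (auto simp: \<X>_def permutations_of_set_def distinct_card)
  also have "card \<dots> = (\<Sum>X\<in>\<X>. card (permutations_of_set X))"
  proof (rule card_UN_disjoint)
    show "\<forall>X\<in>\<X>. finite (permutations_of_set X)" by simp
    show "\<forall>X\<in>\<X>. \<forall>Y\<in>\<X>. X \<noteq> Y \<longrightarrow> permutations_of_set X \<inter> permutations_of_set Y = {}"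
      by (auto simp: permutations_of_set_def)
  qed (fact fX)
  also have "\<dots> = (\<Sum>X\<in>\<X>. 120)"
  proof (rule sum.cong)
    fix X assume "X \<in> \<X>"
    then show "card (permutations_of_set X) = 120"
      using finX[of X] by (simp add: \<X>_def fact_numeral)
  qed simp
  finally show ?thesis by (simp add: X)
qed

text \<open>The homomorphism density of \<open>K_4\<close> in the adjacency graph: for reflexive
  \<open>R\<close> the four vertices are automatically distinct.\<close>

definition k4_dens :: "'a set \<Rightarrow> ('a \<Rightarrow> real) \<Rightarrow> ('a \<Rightarrow> 'a \<Rightarrow> bool) \<Rightarrow> real" where
  "k4_dens V x R = wsum V x (\<lambda>a. wsum V x (\<lambda>b. wsum V x (\<lambda>c. wsum V x (\<lambda>d. of_bool (c6 R a b c d = 0)))))"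

text \<open>Since \<open>R\<close> is reflexive, a repeated vertex already uses up the one allowed
  pair, so the four vertices left after removing the repetition are pairwise adjacent.\<close>

lemma coinc_1_split:
  assumes sym: "\<And>u v. R u v = R v u" and refl: "\<And>u. R u u"
  shows "of_bool (coinc R a b c d e = 1) = (of_bool (distinct [a, b, c, d, e] \<and> coinc R a b c d e = 1) +
    (of_bool (a = b \<and> c6 R a c d e = 0) + of_bool (a = c \<and> c6 R a b d e = 0)
    + of_bool (a = d \<and> c6 R a b c e = 0) + of_bool (a = e \<and> c6 R a b c d = 0) + of_bool (b = c \<and> c6 R b a d e = 0)
    + of_bool (b = d \<and> c6 R b a c e = 0) + of_bool (b = e \<and> c6 R b a c d = 0) + of_bool (c = d \<and> c6 R c a b e = 0)
    + of_bool (c = e \<and> c6 R c a b d = 0) + of_bool (d = e \<and> c6 R d a b c = 0)) :: real)"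
proof (cases "distinct [a, b, c, d, e]")
  case True
  then show ?thesis by auto
next
  case False
  have nz: "c6 R p p r s \<noteq> 0" "c6 R p q p s \<noteq> 0" "c6 R p q r p \<noteq> 0" "c6 R p q q s \<noteq> 0" "c6 R p q r q \<noteq> 0"
    "c6 R p q r r \<noteq> 0" for p q r s
    using refl by (simp_all add: c6_def)
  have s: "coinc R p p r s t = 1 \<longleftrightarrow> c6 R p r s t = 0" for p r s t
    using refl by (auto simp: coinc_def c6_def)
  note perm = coinc_perm(1-9)[where R = R and a = a and b = b and c = c and d = d and e = e, OF sym]
  consider "a = b" | "a = c" | "a = d" | "a = e" | "b = c" | "b = d" | "b = e" | "c = d" | "c = e" | "d = e"
    using False by auto
  then show ?thesis
  proof cases
    case 1
    then have "coinc R a b c d e = 1 \<longleftrightarrow> c6 R a c d e = 0" using s[of a c d e] by simp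
    then show ?thesis using 1 by (simp add: nz nz[unfolded neq0_conv])
  next
    case 2
    then have "coinc R a b c d e = 1 \<longleftrightarrow> c6 R a b d e = 0" using s[of a b d e] perm(1) by simp
    then show ?thesis using 2 by (simp add: nz nz[unfolded neq0_conv])
  next
    case 3
    then have "coinc R a b c d e = 1 \<longleftrightarrow> c6 R a b c e = 0" using s[of a b c e] perm(2) by simp
    then show ?thesis using 3 by (simp add: nz nz[unfolded neq0_conv])
  next
    case 4
    then have "coinc R a b c d e = 1 \<longleftrightarrow> c6 R a b c d = 0" using s[of a b c d] perm(3) by simp
    then show ?thesis using 4 by (simp add: nz nz[unfolded neq0_conv])
  next
    case 5
    then have "coinc R a b c d e = 1 \<longleftrightarrow> c6 R b a d e = 0" using s[of b a d e] perm(4) by simp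
    then show ?thesis using 5 by (simp add: nz nz[unfolded neq0_conv])
  next
    case 6
    then have "coinc R a b c d e = 1 \<longleftrightarrow> c6 R b a c e = 0" using s[of b a c e] perm(5) by simp
    then show ?thesis using 6 by (simp add: nz nz[unfolded neq0_conv])
  next
    case 7
    then have "coinc R a b c d e = 1 \<longleftrightarrow> c6 R b a c d = 0" using s[of b a c d] perm(6) by simp
    then show ?thesis using 7 by (simp add: nz nz[unfolded neq0_conv])
  next
    case 8
    then have "coinc R a b c d e = 1 \<longleftrightarrow> c6 R c a b e = 0" using s[of c a b e] perm(7) by simp
    then show ?thesis using 8 by (simp add: nz nz[unfolded neq0_conv])
  next
    case 9
    then have "coinc R a b c d e = 1 \<longleftrightarrow> c6 R c a b d = 0" using s[of c a b d] perm(8) by simp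
    then show ?thesis using 9 by (simp add: nz nz[unfolded neq0_conv])
  next
    case 10
    then have "coinc R a b c d e = 1 \<longleftrightarrow> c6 R d a b c = 0" using s[of d a b c] perm(9) by simp
    then show ?thesis using 10 by (simp add: nz nz[unfolded neq0_conv])
  qed
qed

text \<open>The correction term counts the tuples in which exactly one vertex is repeated.\<close>

lemma dens_uniform:
  assumes fin: "finite V" and n: "card V = n" "n > 0" and sym: "\<And>u v. R u v = R v u" and refl: "\<And>u. R u u"
  shows "dens V (\<lambda>_. 1 / real n) R = wsum5 V (\<lambda>_. 1) (\<lambda>a b c d e. of_bool (distinct [a, b, c, d, e] \<and> coinc R a b c d e = 1)) / real n ^ 5
    + 10 / real n * k4_dens V (\<lambda>_. 1 / real n) R"
proof -
  let ?x = "\<lambda>_ :: 'a. 1 / real n"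
  define F where "F a b c d e = (of_bool (a = b \<and> c6 R a c d e = 0) :: real)" for a b c d e
  have scale: "wsum V ?x f = wsum V (\<lambda>_. 1) f / real n" for f
    by (simp add: wsum_def sum_divide_distrib)
  have "dens V ?x R = wsum5 V ?x (\<lambda>a b c d e. of_bool (distinct [a, b, c, d, e] \<and> coinc R a b c d e = 1) +
    (F a b c d e + F a c b d e + F a d b c e + F a e b c d + F b c a d e
     + F b d a c e + F b e a c d + F c d a b e + F c e a b d + F d e a b c))"
    unfolding dens_def coinc_1_split[OF sym refl] F_def ..
  also have "\<dots> = wsum5 V ?x (\<lambda>a b c d e. of_bool (distinct [a, b, c, d, e] \<and> coinc R a b c d e = 1)) + 10 * wsum5 V ?x F"
    unfolding wsum5_add wsum5_pair[of V ?x F] by simp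
  also have "wsum5 V ?x F = k4_dens V ?x R / real n"
  proof -
    have "wsum V ?x (\<lambda>b. wsum V ?x (\<lambda>c. wsum V ?x (\<lambda>d. wsum V ?x (\<lambda>e. F a b c d e)))) =
      wsum V ?x (\<lambda>c. wsum V ?x (\<lambda>d. wsum V ?x (\<lambda>e. of_bool (c6 R a c d e = 0)))) / real n" if "a \<in> V" for a
    proof -
      have "wsum V ?x (\<lambda>b. wsum V ?x (\<lambda>c. wsum V ?x (\<lambda>d. wsum V ?x (\<lambda>e. F a b c d e)))) =
        wsum V ?x (\<lambda>b. of_bool (b = a) * wsum V ?x (\<lambda>c. wsum V ?x (\<lambda>d. wsum V ?x (\<lambda>e. of_bool (c6 R a c d e = 0)))))"
        by (rule wsum_cong) (auto simp: F_def wsum_def)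
      then show ?thesis by (simp only: wsum_eq[OF fin that] times_divide_eq_left mult_1)
    qed
    then have "wsum5 V ?x F = wsum V ?x (\<lambda>a. wsum V ?x (\<lambda>c. wsum V ?x (\<lambda>d. wsum V ?x (\<lambda>e. of_bool (c6 R a c d e = 0)))) / real n)"
      unfolding wsum5_def by (rule wsum_cong)
    then show ?thesis by (simp add: wsum_divide k4_dens_def)
  qed
  also have "wsum5 V ?x (\<lambda>a b c d e. of_bool (distinct [a, b, c, d, e] \<and> coinc R a b c d e = 1))
    = wsum5 V (\<lambda>_. 1) (\<lambda>a b c d e. of_bool (distinct [a, b, c, d, e] \<and> coinc R a b c d e = 1)) / real n ^ 5"
    unfolding wsum5_def scale wsum_divide by (simp add: eval_nat_numeral)
  finally show ?thesis by simp
qed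

lemma falling_choose_5: "120 * real (n choose 5) = real n * (real n - 1) * (real n - 2) * (real n - 3) * (real n - 4)"
proof -
  have "real (n choose 5) = real n gchoose 5" by (simp add: binomial_gbinomial)
  also have "\<dots> = (\<Prod>i<5. real n - real i) / 120"
    by (simp add: gbinomial_prod_rev fact_numeral atLeast0LessThan)
  finally show ?thesis by (simp add: eval_nat_numeral mult.assoc)
qed

definition uniform :: "nat \<Rightarrow> 'a \<Rightarrow> real" where "uniform n = (\<lambda>_. 1 / real n)"

definition ratio5 :: "nat \<Rightarrow> real" where "ratio5 n = real n ^ 5 / (120 * real (n choose 5))"

text \<open>An exact identity for every \<open>n \<ge> 5\<close>; both the limit and the comparison
  of graphs of equal order rest on it.\<close>

theorem ind_density_eq:
  assumes G: "simple_graph G" and n: "order G = n" "n \<ge> 5"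
  shows "ind_density K2111 G = ratio5 n * (dens (verts G) (uniform n) (nonadj G) - 10 / real n * k4_dens (verts G) (uniform n) (nonadj G))"
proof -
  have "dens (verts G) (\<lambda>_. 1 / real n) (nonadj G) = 120 * real (ind_count K2111 G) / real n ^ 5
    + 10 / real n * k4_dens (verts G) (\<lambda>_. 1 / real n) (nonadj G)"
    unfolding distinct_tuple_count[OF G, symmetric]
    by (rule dens_uniform) (use G n in \<open>auto simp: simple_graph_def order_def nonadj_sym intro: nonadj_refl\<close>)
  then have "dens (verts G) (uniform n) (nonadj G) - 10 / real n * k4_dens (verts G) (uniform n) (nonadj G)
    = 120 * real (ind_count K2111 G) / real n ^ 5"
    by (simp add: uniform_def)
  then show ?thesis using n by (simp add: ind_density_def order_K2111 ratio5_def)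
qed

lemma weighting_uniform: "finite V \<Longrightarrow> card V = n \<Longrightarrow> n > 0 \<Longrightarrow> weighting V (uniform n)"
  by (simp add: weighting_def uniform_def)

lemma k4_dens_nonneg: "weighting V x \<Longrightarrow> 0 \<le> k4_dens V x R"
  unfolding k4_dens_def by (intro wsum_nonneg) (auto simp: weighting_def)

text \<open>One of six pairs must change. Consequently the correction terms of two graphs at
  distance \<open>b\<close> on the same vertex set differ by at most
  \<open>60 / n * b\<close>.\<close>

lemma k4_dens_diff:
  assumes W: "weighting V x"
  shows "k4_dens V x A - k4_dens V x B \<le> 6 * wsum V x (\<lambda>u. wsum V x (\<lambda>v. of_bool (A u v \<noteq> B u v)))"
proof -
  have [simp]: "wsum V x (\<lambda>_. c) = c" for c using W by (simp add: wsum_const weighting_def)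
  have "of_bool (c6 A a b c d = 0) \<le> real (c6 (\<lambda>u v. A u v \<noteq> B u v) a b c d) + of_bool (c6 B a b c d = 0)" for a b c d
  proof (cases "c6 (\<lambda>u v. A u v \<noteq> B u v) a b c d = 0")
    case True
    then have "c6 A a b c d = c6 B a b c d" by (simp add: c6_def)
    then show ?thesis by simp
  qed auto
  then have "k4_dens V x A \<le> wsum V x (\<lambda>a. wsum V x (\<lambda>b. wsum V x (\<lambda>c. wsum V x (\<lambda>d.
    real (c6 (\<lambda>u v. A u v \<noteq> B u v) a b c d) + of_bool (c6 B a b c d = 0)))))"
    unfolding k4_dens_def using W by (intro wsum_mono) (auto simp: weighting_def)
  also have "\<dots> = wsum V x (\<lambda>a. wsum V x (\<lambda>b. wsum V x (\<lambda>c. wsum V x (\<lambda>d.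
    real (c6 (\<lambda>u v. A u v \<noteq> B u v) a b c d))))) + k4_dens V x B"
    by (simp only: wsum_add k4_dens_def)
  also have "wsum V x (\<lambda>a. wsum V x (\<lambda>b. wsum V x (\<lambda>c. wsum V x (\<lambda>d.
    real (c6 (\<lambda>u v. A u v \<noteq> B u v) a b c d))))) = 6 * wsum V x (\<lambda>u. wsum V x (\<lambda>v. of_bool (A u v \<noteq> B u v)))"
    by (simp add: c6_def wsum_add wsum_cmult wsum_multc)
  finally show ?thesis by simp
qed

lemma k4_dens_le_1:
  assumes W: "weighting V x"
  shows "k4_dens V x R \<le> 1"
proof -
  have [simp]: "wsum V x (\<lambda>_. c) = c" for c using W by (simp add: wsum_const weighting_def)
  have "k4_dens V x R \<le> wsum V x (\<lambda>a. wsum V x (\<lambda>b. wsum V x (\<lambda>c. wsum V x (\<lambda>d. 1))))"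
    unfolding k4_dens_def using W by (intro wsum_mono) (auto simp: weighting_def)
  then show ?thesis by simp
qed

section \<open>Graphs, limits and maximisers\<close>

lemma ratio5_tendsto: "ratio5 \<longlonglongrightarrow> 1"
  unfolding ratio5_def falling_choose_5 by real_asymp

lemma ratio5_ge_1:
  assumes "n \<ge> 5"
  shows "1 \<le> ratio5 n"
proof -
  have n: "real n \<ge> 5" using assms by simp
  have "120 * real (n choose 5) \<le> real n * real n * real n * real n * real n"
    unfolding falling_choose_5 using n by (intro mult_mono mult_nonneg_nonneg) auto
  moreover have "0 < 120 * real (n choose 5)" using assms by simp
  ultimately show ?thesis by (simp add: ratio5_def eval_nat_numeral divide_simps mult_ac)
qed

definition partite_graph :: "'a set \<Rightarrow> ('a \<Rightarrow> 'b) \<Rightarrow> 'a sgraph" where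
  "partite_graph V \<pi> = \<lparr>verts = V, edges = {{u, v} | u v. u \<in> V \<and> v \<in> V \<and> \<pi> u \<noteq> \<pi> v}\<rparr>"

text \<open>Only labels that occur are used, because the parts of a partition must be
  nonempty.\<close>

definition fibres :: "'a set \<Rightarrow> ('a \<Rightarrow> 'b) \<Rightarrow> 'a set set" where
  "fibres V \<pi> = (\<lambda>i. {v \<in> V. \<pi> v = i}) ` \<pi> ` V"

lemma verts_partite_graph [simp]: "verts (partite_graph V \<pi>) = V"
  by (simp add: partite_graph_def)

lemma partite_graph_complete:
  assumes "finite V"
  shows "complete_partite_with (partite_graph V \<pi>) (fibres V \<pi>)"
  unfolding complete_partite_with_def
proof (intro conjI)
  show "partition_on (verts (partite_graph V \<pi>)) (fibres V \<pi>)"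
    by (auto simp: partition_on_def fibres_def disjoint_def)
  show "edges (partite_graph V \<pi>) = partite_edges (fibres V \<pi>)"
    unfolding partite_graph_def partite_edges_def fibres_def by fastforce
qed (use assms in simp)

lemma complete_partite_simple:
  assumes "complete_partite_with G P"
  shows "simple_graph G"
proof -
  have P: "partition_on (verts G) P" using assms by (simp add: complete_partite_with_def)
  have "e \<subseteq> verts G \<and> card e = 2" if e: "e \<in> partite_edges P" for e
  proof -
    obtain u v A B where uv: "e = {u, v}" "A \<in> P" "B \<in> P" "A \<noteq> B" "u \<in> A" "v \<in> B"
      using e unfolding partite_edges_def by blast
    then have "u \<noteq> v" using partition_onD2[OF P] by (auto simp: disjoint_def)
    then show ?thesis using uv partition_onD1[OF P] by auto
  qed
  then show ?thesis using assms by (auto simp: simple_graph_def complete_partite_with_def)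
qed

lemma nonadj_partite_graph:
  assumes "u \<in> V" "v \<in> V"
  shows "nonadj (partite_graph V \<pi>) u v \<longleftrightarrow> \<pi> u = \<pi> v"
  using assms by (auto simp: nonadj_def partite_graph_def doubleton_eq_iff)

lemma partite_graph_order:
  assumes "finite V"
  shows "simple_graph (partite_graph V \<pi>)" "order (partite_graph V \<pi>) = card V"
  using complete_partite_simple[OF partite_graph_complete[OF assms]] by (simp_all add: order_def)

definition part_of :: "'a set set \<Rightarrow> 'a \<Rightarrow> 'a set" where
  "part_of P v = (THE A. A \<in> P \<and> v \<in> A)"

lemma part_of_eq:
  assumes "partition_on V P" "A \<in> P" "v \<in> A"
  shows "part_of P v = A"
  unfolding part_of_def
proof (rule the_equality)
  fix B assume "B \<in> P \<and> v \<in> B"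
  then show "B = A" using partition_onD2[OF assms(1)] assms(2,3) by (auto simp: disjoint_def)
qed (use assms in simp)

lemma dens_cong:
  assumes "\<And>u v. u \<in> V \<Longrightarrow> v \<in> V \<Longrightarrow> R u v = R' u v"
  shows "dens V x R = dens V x R'"
  unfolding dens_def wsum5_def coinc_def using assms by (intro wsum_cong) simp

lemma k4_dens_cong:
  assumes "\<And>u v. u \<in> V \<Longrightarrow> v \<in> V \<Longrightarrow> R u v = R' u v"
  shows "k4_dens V x R = k4_dens V x R'"
  unfolding k4_dens_def c6_def using assms by (intro wsum_cong) simp

lemma part_weight_uniform:
  assumes "finite V"
  shows "part_weight V (uniform n) \<pi> i = real (card {v \<in> V. \<pi> v = i}) / real n"
  using assms by (simp add: part_weight_def wsum_def uniform_def Int_def flip: sum_divide_distrib)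

text \<open>Each part serves as its own label, so the relative part sizes form a weighting of the
  set \<open>P\<close>.\<close>

lemma dens_complete_partite:
  assumes C: "complete_partite_with G P" and n: "order G = n" "n > 0"
  shows "dens (verts G) (uniform n) (nonadj G) = 10 * core P (\<lambda>A. real (card A) / real n)"
    and "weighting P (\<lambda>A. real (card A) / real n)"
proof -
  let ?V = "verts G" and ?p = "part_of P"
  have fin: "finite ?V" and P: "partition_on ?V P" and E: "edges G = partite_edges P"
    using C by (auto simp: complete_partite_with_def)
  have finP: "finite P" using P fin by (rule finite_elements[rotated])
  have mem: "?p v \<in> P \<and> v \<in> ?p v" if "v \<in> ?V" for v
    using that part_of_eq[OF P] partition_onD1[OF P] by blast
  have na: "nonadj G u v \<longleftrightarrow> ?p u = ?p v" if "u \<in> ?V" "v \<in> ?V" for u v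
  proof
    assume "nonadj G u v"
    then show "?p u = ?p v" using mem[OF that(1)] mem[OF that(2)] unfolding nonadj_def E partite_edges_def by blast
  next
    assume eq: "?p u = ?p v"
    show "nonadj G u v"
      unfolding nonadj_def E partite_edges_def
    proof
      assume "{u, v} \<in> {{u, v} |u v. \<exists>A\<in>P. \<exists>B\<in>P. A \<noteq> B \<and> u \<in> A \<and> v \<in> B}"
      then obtain a b A B where "{u, v} = {a, b}" "A \<in> P" "B \<in> P" "A \<noteq> B" "a \<in> A" "b \<in> B" by blast
      then show False using part_of_eq[OF P, of A a] part_of_eq[OF P, of B b] eq by (auto simp: doubleton_eq_iff)
    qed
  qed
  have W: "weighting ?V (uniform n)" using fin n by (intro weighting_uniform) (auto simp: order_def)
  have sub: "?p ` ?V \<subseteq> P" using mem by auto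
  have pw: "part_weight ?V (uniform n) ?p A = real (card A) / real n" if "A \<in> P" for A
  proof -
    have "{v \<in> ?V. ?p v = A} = A"
      using part_of_eq[OF P that] mem partition_onD1[OF P] that by blast
    then show ?thesis using fin by (simp add: part_weight_uniform)
  qed
  have "dens ?V (uniform n) (nonadj G) = dens ?V (uniform n) (\<lambda>u v. ?p u = ?p v)"
    by (rule dens_cong) (rule na)
  also have "\<dots> = 10 * core P (part_weight ?V (uniform n) ?p)" by (rule dens_part_core[OF W finP sub])
  also have "core P (part_weight ?V (uniform n) ?p) = core P (\<lambda>A. real (card A) / real n)"
    by (rule core_cong) (rule pw)
  finally show "dens ?V (uniform n) (nonadj G) = 10 * core P (\<lambda>A. real (card A) / real n)" .
  show "weighting P (\<lambda>A. real (card A) / real n)"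
    using weighting_part[OF W finP sub] pw by (simp add: weighting_def)
qed

text \<open>The identity is an admissible bijection, and each edge of the symmetric difference gives
  two ordered pairs, matching the factor 2 in \<open>edit_dist\<close>. Finiteness of
  \<open>M\<close> makes \<open>Min\<close> meaningful.\<close>

lemma edit_dist_le:
  assumes G: "simple_graph G" and H: "simple_graph H" and V: "verts G = V" "verts H = V" and n: "card V = n" "n > 0"
  shows "edit_dist G H \<le> wsum V (uniform n) (\<lambda>u. wsum V (uniform n) (\<lambda>v. of_bool (nonadj G u v \<noteq> nonadj H u v)))"
proof -
  have fin: "finite V" using G V by (simp add: simple_graph_def)
  define S where "S = sym_diff (edges H) (edges G)"
  define M where "M = {card (sym_diff (edges H) (map_edges \<sigma> G)) | \<sigma>. bij_betw \<sigma> (verts G) (verts H)}"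
  have "M \<subseteq> {..card (Pow V)}"
  proof
    fix m assume "m \<in> M"
    then obtain \<sigma> where m: "m = card (sym_diff (edges H) (map_edges \<sigma> G))" and \<sigma>: "bij_betw \<sigma> V V" using V by (auto simp: M_def)
    have "map_edges \<sigma> G \<subseteq> Pow V"
    proof
      fix e assume "e \<in> map_edges \<sigma> G"
      then obtain e' where e': "e' \<in> edges G" "e = \<sigma> ` e'" by (auto simp: map_edges_def)
      then have "e' \<subseteq> V" using G V by (auto simp: simple_graph_def)
      then show "e \<in> Pow V" using e' \<sigma> by (auto simp: bij_betw_def)
    qed
    moreover have "edges H \<subseteq> Pow V" using H V by (auto simp: simple_graph_def)
    ultimately have "m \<le> card (Pow V)" unfolding m using fin by (intro card_mono) auto
    then show "m \<in> {..card (Pow V)}" by simp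
  qed
  then have "finite M" by (rule finite_subset) simp
  moreover have "card S \<in> M"
    unfolding M_def S_def using V by (auto intro!: exI[of _ id] simp: map_edges_def)
  ultimately have "Min M \<le> card S" by simp
  then have ed: "edit_dist G H \<le> 2 / (real n)\<^sup>2 * real (card S)"
    unfolding edit_dist_def M_def[symmetric] using V n by (simp add: order_def divide_right_mono)
  have S_le: "2 * card S \<le> card {(u, v) \<in> V \<times> V. nonadj G u v \<noteq> nonadj H u v}"
  proof -
    define T where "T e = {(u, v). {u, v} = (e :: 'a set)}" for e
    have S2: "\<exists>a b. e = {a, b} \<and> a \<noteq> b \<and> a \<in> V \<and> b \<in> V" if "e \<in> S" for e
    proof -
      have "e \<subseteq> V" "card e = 2" using that G H V unfolding S_def simple_graph_def by auto
      then show ?thesis by (auto simp: card_2_iff)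
    qed
    have cT: "finite (T e) \<and> card (T e) = 2" if "e \<in> S" for e
    proof -
      obtain a b where "e = {a, b}" "a \<noteq> b" using S2[OF \<open>e \<in> S\<close>] by blast
      then have "T e = {(a, b), (b, a)}" by (auto simp: T_def doubleton_eq_iff)
      then show ?thesis using \<open>a \<noteq> b\<close> by simp
    qed
    have finS: "finite S"
      by (rule finite_subset[of _ "Pow V"]) (use G H V fin in \<open>auto simp: S_def simple_graph_def\<close>)
    have "card (\<Union>e\<in>S. T e) = (\<Sum>e\<in>S. card (T e))"
    proof (rule card_UN_disjoint[OF finS])
      show "\<forall>e\<in>S. finite (T e)" using cT by blast
      show "\<forall>e\<in>S. \<forall>e'\<in>S. e \<noteq> e' \<longrightarrow> T e \<inter> T e' = {}" by (auto simp: T_def)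
    qed
    also have "\<dots> = 2 * card S" using cT by simp
    finally have "2 * card S = card (\<Union>e\<in>S. T e)" ..
    also have "\<dots> \<le> card {(u, v) \<in> V \<times> V. nonadj G u v \<noteq> nonadj H u v}"
    proof (rule card_mono)
      show "finite {(u, v) \<in> V \<times> V. nonadj G u v \<noteq> nonadj H u v}"
        by (rule finite_subset[of _ "V \<times> V"]) (use fin in auto)
      show "(\<Union>e\<in>S. T e) \<subseteq> {(u, v) \<in> V \<times> V. nonadj G u v \<noteq> nonadj H u v}"
      proof
        fix t assume "t \<in> (\<Union>e\<in>S. T e)"
        then obtain u v where t: "t = (u, v)" "{u, v} \<in> S" by (auto simp: T_def)
        then have "u \<in> V \<and> v \<in> V" using S2[OF t(2)] by (auto simp: doubleton_eq_iff)
        moreover have "nonadj G u v \<noteq> nonadj H u v" using t(2) by (auto simp: S_def nonadj_def)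
        ultimately show "t \<in> {(u, v) \<in> V \<times> V. nonadj G u v \<noteq> nonadj H u v}" using t by simp
      qed
    qed
    finally show ?thesis .
  qed
  note ed
  also have "2 / (real n)\<^sup>2 * real (card S) = real (2 * card S) / (real n)\<^sup>2" by simp
  also have "\<dots> \<le> real (card {(u, v) \<in> V \<times> V. nonadj G u v \<noteq> nonadj H u v}) / (real n)\<^sup>2"
    using S_le by (intro divide_right_mono of_nat_mono) auto
  also have "\<dots> = wsum V (uniform n) (\<lambda>u. wsum V (uniform n) (\<lambda>v. of_bool (nonadj G u v \<noteq> nonadj H u v)))"
  proof -
    have "real (card {(u, v) \<in> V \<times> V. nonadj G u v \<noteq> nonadj H u v})
      = (\<Sum>z\<in>V \<times> V. of_bool (case z of (u, v) \<Rightarrow> nonadj G u v \<noteq> nonadj H u v))"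
    proof -
      have "{(u, v) \<in> V \<times> V. nonadj G u v \<noteq> nonadj H u v} = (V \<times> V) \<inter> {z. case z of (u, v) \<Rightarrow> nonadj G u v \<noteq> nonadj H u v}"
        by auto
      moreover have "finite (V \<times> V)" using fin by simp
      ultimately show ?thesis by (simp only: sum_of_bool_eq)
    qed
    also have "\<dots> = (\<Sum>u\<in>V. \<Sum>v\<in>V. of_bool (nonadj G u v \<noteq> nonadj H u v))"
      by (simp only: sum.cartesian_product' case_prod_conv)
    finally show ?thesis
      by (simp add: wsum_def uniform_def power2_eq_square flip: sum_divide_distrib)
  qed
  finally show ?thesis .
qed

section \<open>Extremal values of the induced density\<close>

lemma ind_count_le:
  assumes "G \<in> graphs_of_order n"
  shows "ind_count F G \<le> 2 ^ n"
proof -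
  have fin: "finite (verts G)" "card (verts G) = n" using assms by (auto simp: graphs_of_order_def simple_graph_def order_def)
  have "ind_count F G \<le> card (Pow (verts G))"
    unfolding ind_count_def using fin by (intro card_mono) auto
  then show ?thesis using fin by (simp add: card_Pow)
qed

lemma finite_ind_count: "finite (ind_count F ` graphs_of_order n)"
  by (rule finite_subset[of _ "{..2 ^ n}"]) (use ind_count_le in auto)

lemma finite_ind_density: "finite (ind_density F ` graphs_of_order n)"
proof -
  have "ind_density F ` graphs_of_order n \<subseteq> (\<lambda>k. real k / real (n choose order F)) ` ind_count F ` graphs_of_order n"
    by (auto simp: ind_density_def graphs_of_order_def)
  then show ?thesis using finite_ind_count by (rule finite_subset[OF _ finite_imageI])
qed

lemma ind_density_le_max:
  assumes "G \<in> graphs_of_order n"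
  shows "ind_density F G \<le> param_max (ind_density F) n"
  unfolding param_max_def using assms finite_ind_density by (intro Max_ge) auto

lemma ind_density_le_ratio:
  assumes "G \<in> graphs_of_order n"
  shows "ind_density F G \<le> max_ind_ratio F n"
proof -
  have "ind_count F G \<le> max_ind_count F n"
    unfolding max_ind_count_def using assms finite_ind_count by (intro Max_ge) auto
  then show ?thesis
    using assms by (simp add: ind_density_def max_ind_ratio_def graphs_of_order_def divide_right_mono)
qed

lemma ind_density_upper:
  assumes "G \<in> graphs_of_order n" "n \<ge> 5"
  shows "ind_density K2111 G \<le> ratio5 n * dens (verts G) (uniform n) (nonadj G)"
    and "ind_density K2111 G \<le> ratio5 n * (525 / 1024)"
proof -
  have G: "simple_graph G" "order G = n" using assms by (auto simp: graphs_of_order_def)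
  then have W: "weighting (verts G) (uniform n)"
    using assms by (intro weighting_uniform) (auto simp: simple_graph_def order_def)
  have r: "0 \<le> ratio5 n" using ratio5_ge_1[OF assms(2)] by linarith
  have "0 \<le> 10 / real n * k4_dens (verts G) (uniform n) (nonadj G)"
    using k4_dens_nonneg[OF W] by simp
  then show 1: "ind_density K2111 G \<le> ratio5 n * dens (verts G) (uniform n) (nonadj G)"
    unfolding ind_density_eq[OF G assms(2)] using r by (intro mult_left_mono) linarith+
  have "dens (verts G) (uniform n) (nonadj G) \<le> 525 / 1024"
    by (rule dens_le[OF W nonadj_sym nonadj_refl[OF G(1)]])
  then have "ratio5 n * dens (verts G) (uniform n) (nonadj G) \<le> ratio5 n * (525 / 1024)"
    using r by (rule mult_left_mono)
  then show "ind_density K2111 G \<le> ratio5 n * (525 / 1024)" using 1 by linarith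
qed

section \<open>The balanced complete 8-partite graphs and the limit value\<close>

definition turan8 :: "nat \<Rightarrow> nat sgraph" where
  "turan8 n = partite_graph {..<n} (\<lambda>i. i mod 8)"

lemma turan8_in: "turan8 n \<in> graphs_of_order n"
  by (simp add: turan8_def graphs_of_order_def partite_graph_order)

text \<open>This is the ceiling of \<open>(n - j) / 8\<close>; adding 7 first keeps the subtraction
  of natural numbers from truncating.\<close>

lemma card_residue_class:
  assumes "j < 8"
  shows "card {i \<in> {..<n}. i mod 8 = j} = (n + 7 - j) div 8"
proof (induction n)
  case 0
  then show ?case using assms by simp
next
  case (Suc n)
  have "{i \<in> {..<Suc n}. i mod 8 = j} = (if n mod 8 = j then insert n {i \<in> {..<n}. i mod 8 = j} else {i \<in> {..<n}. i mod 8 = j})"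
    by (auto simp: less_Suc_eq)
  then have "card {i \<in> {..<Suc n}. i mod 8 = j} = (n + 7 - j) div 8 + (if n mod 8 = j then 1 else 0)"
    using Suc by simp
  moreover have "(Suc n + 7 - j) div 8 = (n + 7 - j) div 8 + (if n mod 8 = j then 1 else 0)"
  proof -
    define q r where "q = n div 8" and "r = n mod 8"
    have n: "n = 8 * q + r" "r < 8" by (simp_all add: q_def r_def)
    have d: "(8 * q + s) div 8 = q + (if s < 8 then 0 else 1)" if "s < 16" for s
      using that by (intro div_nat_eqI) auto
    have "Suc n + 7 - j = 8 * q + (r + 8 - j)" "n + 7 - j = 8 * q + (r + 7 - j)"
      using n(1) assms by simp_all
    then show ?thesis
      using n(2) assms by (simp only: d) (auto simp: d r_def[symmetric])
  qed
  ultimately show ?case by simp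
qed

lemma turan8_tendsto: "(\<lambda>n. ind_density K2111 (turan8 n)) \<longlonglongrightarrow> 525 / 1024"
proof -
  define w where "w n i = part_weight {..<n} (uniform n) (\<lambda>i. i mod 8) i" for n i :: nat
  define k where "k n = k4_dens {..<n} (uniform n) (nonadj (turan8 n))" for n
  have wi: "(\<lambda>n. w n j) \<longlonglongrightarrow> 1 / 8" if "j < 8" for j
  proof -
    have w_eq: "w n j = real ((n + 7 - j) div 8) / real n" for n
      by (simp only: w_def part_weight_uniform[OF finite_lessThan] card_residue_class[OF that])
    have b: "real n / 8 - 1 \<le> real ((n + 7 - j) div 8)" "real ((n + 7 - j) div 8) \<le> real n / 8 + 1" for n
      using that by linarith+
    show ?thesis
    proof (rule tendsto_sandwich)
      show "\<forall>\<^sub>F n in sequentially. (real n / 8 - 1) / real n \<le> w n j"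
        unfolding w_eq using b by (intro always_eventually allI divide_right_mono) auto
      show "\<forall>\<^sub>F n in sequentially. w n j \<le> (real n / 8 + 1) / real n"
        unfolding w_eq using b by (intro always_eventually allI divide_right_mono) auto
      show "(\<lambda>n. (real n / 8 - 1) / real n) \<longlonglongrightarrow> 1 / 8" by real_asymp
      show "(\<lambda>n. (real n / 8 + 1) / real n) \<longlonglongrightarrow> 1 / 8" by real_asymp
    qed
  qed
  have "(\<lambda>n. core {..<8} (w n)) \<longlonglongrightarrow> core {..<8::nat} (\<lambda>_. 1 / 8)"
    unfolding core_def core_poly_def psum_def by (intro tendsto_intros wi) auto
  also have "core {..<8::nat} (\<lambda>_. 1 / 8) = 210 / 4096"
    by (subst core_uniform[of "{..<8}" "{..<8}" 8]) auto
  finally have core: "(\<lambda>n. core {..<8} (w n)) \<longlonglongrightarrow> 210 / 4096" .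
  have W: "weighting {..<n} (uniform n)" if "n \<ge> 5" for n using that by (intro weighting_uniform) auto
  have k0: "(\<lambda>n. 10 / real n * k n) \<longlonglongrightarrow> 0"
  proof (rule tendsto_sandwich)
    show "\<forall>\<^sub>F n in sequentially. 0 \<le> 10 / real n * k n"
      using eventually_ge_at_top[of 5] by eventually_elim (simp add: k_def k4_dens_nonneg W)
    show "\<forall>\<^sub>F n in sequentially. 10 / real n * k n \<le> 10 / real n"
      using eventually_ge_at_top[of 5]
    proof eventually_elim
      case (elim n)
      then show ?case using k4_dens_le_1[OF W[OF elim]] unfolding k_def by (intro mult_left_le) auto
    qed
    show "(\<lambda>n. 10 / real n) \<longlonglongrightarrow> 0" by real_asymp
  qed simp
  have "(\<lambda>n. ratio5 n * (10 * core {..<8} (w n) - 10 / real n * k n)) \<longlonglongrightarrow> 1 * (10 * (210 / 4096) - 0)"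
    by (intro tendsto_intros ratio5_tendsto core k0)
  moreover have "\<forall>\<^sub>F n in sequentially. ratio5 n * (10 * core {..<8} (w n) - 10 / real n * k n) = ind_density K2111 (turan8 n)"
    using eventually_ge_at_top[of 5]
  proof eventually_elim
    case (elim n)
    have V: "verts (turan8 n) = {..<n}" by (simp add: turan8_def)
    have "dens {..<n} (uniform n) (nonadj (turan8 n)) = dens {..<n} (uniform n) (\<lambda>u v. u mod 8 = v mod 8)"
      by (rule dens_cong) (simp add: turan8_def nonadj_partite_graph)
    also have "\<dots> = 10 * core {..<8} (w n)"
      unfolding w_def by (rule dens_part_core[OF W[OF elim]]) auto
    finally show ?case
      using ind_density_eq[of "turan8 n" n] turan8_in[of n] elim by (simp add: V k_def graphs_of_order_def)
  qed
  ultimately have "(\<lambda>n. ind_density K2111 (turan8 n)) \<longlonglongrightarrow> 1 * (10 * (210 / 4096) - 0)"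
    by (rule Lim_transform_eventually)
  moreover have "1 * (10 * (210 / 4096) - 0) = (525 / 1024 :: real)" by simp
  ultimately show ?thesis by (simp only:)
qed

lemma upper_tendsto: "(\<lambda>n. ratio5 n * (525 / 1024)) \<longlonglongrightarrow> 525 / 1024"
  using tendsto_mult_right[OF ratio5_tendsto, of "525 / 1024"] by simp

lemma param_max_tendsto: "param_max (ind_density K2111) \<longlonglongrightarrow> 525 / 1024"
proof (rule tendsto_sandwich[OF _ _ turan8_tendsto upper_tendsto])
  show "\<forall>\<^sub>F n in sequentially. ind_density K2111 (turan8 n) \<le> param_max (ind_density K2111) n"
    by (intro always_eventually allI ind_density_le_max turan8_in)
  show "\<forall>\<^sub>F n in sequentially. param_max (ind_density K2111) n \<le> ratio5 n * (525 / 1024)"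
    using eventually_ge_at_top[of 5]
  proof eventually_elim
    case (elim n)
    have "param_max (ind_density K2111) n \<in> ind_density K2111 ` graphs_of_order n"
      unfolding param_max_def using turan8_in finite_ind_density by (intro Max_in) auto
    then show ?case using ind_density_upper(2) elim by auto
  qed
qed

lemma max_ind_ratio_tendsto: "max_ind_ratio K2111 \<longlonglongrightarrow> 525 / 1024"
proof (rule tendsto_sandwich[OF _ _ turan8_tendsto upper_tendsto])
  show "\<forall>\<^sub>F n in sequentially. ind_density K2111 (turan8 n) \<le> max_ind_ratio K2111 n"
    by (intro always_eventually allI ind_density_le_ratio turan8_in)
  show "\<forall>\<^sub>F n in sequentially. max_ind_ratio K2111 n \<le> ratio5 n * (525 / 1024)"
    using eventually_ge_at_top[of 5]
  proof eventually_elim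
    case (elim n)
    have "max_ind_count K2111 n \<in> ind_count K2111 ` graphs_of_order n"
      unfolding max_ind_count_def using turan8_in finite_ind_count by (intro Max_in) auto
    then obtain G where "G \<in> graphs_of_order n" "max_ind_count K2111 n = ind_count K2111 G" by auto
    moreover from this have "max_ind_ratio K2111 n = ind_density K2111 G"
      by (simp add: max_ind_ratio_def ind_density_def graphs_of_order_def)
    ultimately show ?case using ind_density_upper(2) elim by auto
  qed
qed

theorem perfectly_stable_K2111: "perfectly_stable (ind_density K2111)"
proof -
  obtain c where c: "0 < c" and gs:
    "\<And>(V :: nat set) x R. weighting V x \<Longrightarrow> (\<And>u v. R u v = R v u) \<Longrightarrow> (\<And>u. R u u) \<Longrightarrow> 525 / 1024 - c \<le> dens V x R \<Longrightarrow>
      \<exists>\<pi>. eight_part V \<pi> \<and> bdist V x R \<pi> / 20000 \<le> dens V x (\<lambda>u v. \<pi> u = \<pi> v) - dens V x R"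
    by (rule global_stability[where 'a = nat]) blast
  have "(\<lambda>n. ratio5 n * (525 / 1024 - c)) \<longlonglongrightarrow> 525 / 1024 - c"
    using tendsto_mult_right[OF ratio5_tendsto, of "525 / 1024 - c"] by simp
  then have "\<forall>\<^sub>F n in sequentially. ratio5 n * (525 / 1024 - c) < 525 / 1024 - c / 2"
    using c by (intro order_tendstoD) auto
  moreover have "\<forall>\<^sub>F n in sequentially. 525 / 1024 - c / 4 < ind_density K2111 (turan8 n)"
    using c by (intro order_tendstoD[OF turan8_tendsto]) auto
  ultimately have "\<forall>\<^sub>F n in sequentially. ratio5 n * (525 / 1024 - c) < 525 / 1024 - c / 2 \<and> 525 / 1024 - c / 4 < ind_density K2111 (turan8 n)"
    by (rule eventually_conj)
  then obtain n0 where n0: "\<And>n. n \<ge> n0 \<Longrightarrow> ratio5 n * (525 / 1024 - c) < 525 / 1024 - c / 2"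
    "\<And>n. n \<ge> n0 \<Longrightarrow> 525 / 1024 - c / 4 < ind_density K2111 (turan8 n)"
    unfolding eventually_sequentially by blast
  \<comment> \<open>One constant serves as threshold for \<open>n\<close> and as factor:
    \<open>n0\<close> for the limits, \<open>4 / c\<close> for graphs far from optimal, and
    \<open>2400000 = 60 * 40000\<close> for the correction term.\<close>
  define C where "C = real n0 + 4 / c + 2400000"
  have "0 < 4 / c" using c by simp
  then have C: "real n0 \<le> C" "4 / c \<le> C" "2400000 \<le> C" "0 < C" unfolding C_def by linarith+
  have "\<exists>H\<in>graphs_of_order n. complete_partite H \<and> edit_dist G H \<le> C * (param_max (ind_density K2111) n - ind_density K2111 G)"
    if n: "real n \<ge> C" and G: "G \<in> graphs_of_order n" for n G
  proof -
    let ?V = "verts G" and ?x = "uniform n :: nat \<Rightarrow> real" and ?R = "nonadj G"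
    have nn: "n0 \<le> n" "5 \<le> n" "2400000 \<le> real n" using n C by linarith+
    have sG: "simple_graph G" "order G = n" using G by (auto simp: graphs_of_order_def)
    have fin: "finite ?V" "card ?V = n" using sG by (auto simp: simple_graph_def order_def)
    have W: "weighting ?V ?x" using fin nn by (intro weighting_uniform) auto
    have H: "partite_graph ?V \<pi> \<in> graphs_of_order n" "complete_partite (partite_graph ?V \<pi>)" for \<pi> :: "nat \<Rightarrow> nat"
      using partite_graph_order[OF fin(1), of \<pi>] partite_graph_complete[OF fin(1), of \<pi>] fin
      by (auto simp: graphs_of_order_def complete_partite_def)
    have ed: "edit_dist G (partite_graph ?V \<pi>) \<le> bdist ?V ?x ?R \<pi>" for \<pi> :: "nat \<Rightarrow> nat"
    proof -
      have "edit_dist G (partite_graph ?V \<pi>) \<le> wsum ?V ?x (\<lambda>u. wsum ?V ?x (\<lambda>v. of_bool (?R u v \<noteq> nonadj (partite_graph ?V \<pi>) u v)))"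
        using sG partite_graph_order[OF fin(1)] fin nn by (intro edit_dist_le) auto
      also have "\<dots> = bdist ?V ?x ?R \<pi>"
        unfolding bdist_def by (intro wsum_cong arg_cong[where f = of_bool]) (auto simp: nonadj_partite_graph)
      finally show ?thesis .
    qed
    show ?thesis
    proof (cases "525 / 1024 - c \<le> dens ?V ?x ?R")
      case True
      then obtain \<pi> where \<pi>: "eight_part ?V \<pi>" "bdist ?V ?x ?R \<pi> / 20000 \<le> dens ?V ?x (\<lambda>u v. \<pi> u = \<pi> v) - dens ?V ?x ?R"
        using gs[of ?V ?x ?R, OF W nonadj_sym nonadj_refl[OF sG(1)]] by blast
      let ?H = "partite_graph ?V \<pi>"
      define b where "b = bdist ?V ?x ?R \<pi>"
      have b0: "0 \<le> b" unfolding b_def bdist_def using W by (intro wsum_nonneg) (auto simp: weighting_def)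
      have dH: "dens ?V ?x (nonadj ?H) = dens ?V ?x (\<lambda>u v. \<pi> u = \<pi> v)"
        and kH: "k4_dens ?V ?x (nonadj ?H) = k4_dens ?V ?x (\<lambda>u v. \<pi> u = \<pi> v)"
        by (auto intro!: dens_cong k4_dens_cong simp: nonadj_partite_graph)
      have k: "k4_dens ?V ?x (nonadj ?H) - k4_dens ?V ?x ?R \<le> 6 * b"
        unfolding kH b_def bdist_def by (rule k4_dens_diff[OF W])
      have sH: "simple_graph ?H" "order ?H = n" using H(1)[of \<pi>] by (auto simp: graphs_of_order_def)
      define q where "q = (dens ?V ?x (nonadj ?H) - dens ?V ?x ?R) - 10 / real n * (k4_dens ?V ?x (nonadj ?H) - k4_dens ?V ?x ?R)"
      have diff: "ind_density K2111 ?H - ind_density K2111 G = ratio5 n * q"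
        unfolding ind_density_eq[OF sG nn(2)] ind_density_eq[OF sH nn(2)] verts_partite_graph q_def
        by (simp add: algebra_simps)
      have "10 / real n * (k4_dens ?V ?x (nonadj ?H) - k4_dens ?V ?x ?R) \<le> 10 / real n * (6 * b)"
        using k by (intro mult_left_mono) auto
      also have "\<dots> = b * (60 / real n)" by simp
      \<comment> \<open>The correction consumes at most half of the gain
        \<open>b / 20000\<close>.\<close>
      also have "\<dots> \<le> b * (1 / 40000)"
        using b0 nn(3) by (intro mult_left_mono) (auto simp: field_simps)
      finally have q: "b / 40000 \<le> q" using \<pi>(2) unfolding q_def dH b_def by linarith
      have "1 * q \<le> ratio5 n * q" using ratio5_ge_1[OF nn(2)] q b0 by (intro mult_right_mono) auto
      then have bq: "b / 40000 \<le> ind_density K2111 ?H - ind_density K2111 G" using q diff by simp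
      moreover have "ind_density K2111 ?H \<le> param_max (ind_density K2111) n" by (rule ind_density_le_max[OF H(1)])
      ultimately have "b / 40000 \<le> param_max (ind_density K2111) n - ind_density K2111 G" by linarith
      then have "b \<le> 40000 * (param_max (ind_density K2111) n - ind_density K2111 G)" by simp
      also have "\<dots> \<le> C * (param_max (ind_density K2111) n - ind_density K2111 G)"
        using C ind_density_le_max[OF G, of K2111] by (intro mult_right_mono) auto
      finally show ?thesis using ed[of \<pi>] H[of \<pi>] unfolding b_def by force
    next
      case False
      \<comment> \<open>Far from the optimum the loss is at least \<open>c / 4\<close>, and
        \<open>C * (c / 4) \<ge> 1\<close> covers the distance to any complete partite graph; the
        one with a single part is taken.\<close>
      have "ind_density K2111 G \<le> ratio5 n * dens ?V ?x ?R" by (rule ind_density_upper(1)[OF G nn(2)])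
      also have "\<dots> \<le> ratio5 n * (525 / 1024 - c)"
        using False ratio5_ge_1[OF nn(2)] by (intro mult_left_mono) auto
      also have "\<dots> < 525 / 1024 - c / 2" by (rule n0(1)[OF nn(1)])
      finally have "c / 4 \<le> param_max (ind_density K2111) n - ind_density K2111 G"
        using n0(2)[OF nn(1)] ind_density_le_max[OF turan8_in, of K2111 n] by linarith
      then have "C * (c / 4) \<le> C * (param_max (ind_density K2111) n - ind_density K2111 G)"
        using C by (intro mult_left_mono) auto
      moreover have "1 \<le> C * (c / 4)" using C(2) c by (simp add: field_simps)
      moreover have "bdist ?V ?x ?R (\<lambda>_. 0) \<le> 1"
      proof -
        have [simp]: "wsum ?V ?x (\<lambda>_. r) = r" for r using W by (simp add: wsum_const weighting_def)
        have "bdist ?V ?x ?R (\<lambda>_. 0) \<le> wsum ?V ?x (\<lambda>u. wsum ?V ?x (\<lambda>v. 1))"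
          unfolding bdist_def using W by (intro wsum_mono) (auto simp: weighting_def)
        then show ?thesis by simp
      qed
      ultimately have "edit_dist G (partite_graph ?V (\<lambda>_. 0 :: nat)) \<le> C * (param_max (ind_density K2111) n - ind_density K2111 G)"
        using ed[of "\<lambda>_. 0"] by linarith
      then show ?thesis using H[of "\<lambda>_. 0"] by blast
    qed
  qed
  then show ?thesis unfolding perfectly_stable_def using C(4) by blast
qed

section \<open>Part sizes and the unique maximiser\<close>

text \<open>In descending order, an entry below \<open>t\<close> at position \<open>i\<close> would
  leave at most \<open>i\<close> entries that reach \<open>t\<close>.\<close>

lemma nth_rev_sorted_ge:
  fixes M :: "nat multiset"
  assumes "i < size {#k \<in># M. t \<le> k#}"
  shows "i < size M" "t \<le> rev (sorted_list_of_multiset M) ! i"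
proof -
  define xs where "xs = sorted_list_of_multiset M"
  define ks where "ks = rev xs"
  have M: "mset ks = M" by (simp add: ks_def xs_def)
  have len: "i < length (filter (\<lambda>k. t \<le> k) ks)"
    using assms by (metis M mset_filter size_mset)
  then show i: "i < size M" using length_filter_le[of "\<lambda>k. t \<le> k" ks] M by (metis dual_order.strict_trans1 size_mset)
  then have il: "i < length ks" using M by (metis size_mset)
  have mono: "ks ! k \<le> ks ! j" if "j \<le> k" "k < length ks" for j k
    using that unfolding ks_def xs_def
    by (simp add: rev_nth sorted_nth_mono)
  show "t \<le> rev (sorted_list_of_multiset M) ! i"
  proof (rule ccontr)
    assume "\<not> ?thesis"
    then have lt: "ks ! i < t" by (simp add: ks_def xs_def)
    have "filter (\<lambda>k. t \<le> k) (drop i ks) = []"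
    proof (rule filter_False, rule ballI)
      fix k assume "k \<in> set (drop i ks)"
      then obtain m where m: "m < length ks - i" "k = ks ! (i + m)" by (auto simp: in_set_conv_nth)
      then have "k \<le> ks ! i" using mono[of i "i + m"] by auto
      then show "\<not> t \<le> k" using lt by simp
    qed
    then have "filter (\<lambda>k. t \<le> k) ks = filter (\<lambda>k. t \<le> k) (take i ks)"
      by (metis append_Nil2 append_take_drop_id filter_append)
    then have "length (filter (\<lambda>k. t \<le> k) ks) \<le> i"
      using length_filter_le[of "\<lambda>k. t \<le> k" "take i ks"] il by simp
    then show False using len by simp
  qed
qed

lemma part_size_ge:
  assumes "finite P" "J \<subseteq> P" "i < card J" "\<And>A. A \<in> J \<Longrightarrow> t \<le> card A"
  shows "t \<le> part_size P i"
proof -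
  let ?M = "image_mset card (mset_set P)"
  have "size {#k \<in># ?M. t \<le> k#} = card {A \<in> P. t \<le> card A}"
    using assms(1) by (simp add: filter_mset_image_mset)
  moreover have "card J \<le> card {A \<in> P. t \<le> card A}" using assms by (intro card_mono) auto
  ultimately have "i < size {#k \<in># ?M. t \<le> k#}" using assms(3) by simp
  note n = nth_rev_sorted_ge[OF this]
  have "i < length (rev (sorted_list_of_multiset ?M))" using n(1) by (metis length_rev mset_sorted_list_of_multiset size_mset)
  then show ?thesis using n(2) by (simp add: part_size_def Let_def)
qed

lemma part_size_le:
  assumes "finite P" "\<And>A. A \<in> P \<Longrightarrow> card A \<le> t"
  shows "part_size P i \<le> t"
proof -
  define ks where "ks = rev (sorted_list_of_multiset (image_mset card (mset_set P)))"
  have "ks ! i \<le> t" if "i < length ks"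
  proof -
    have "ks ! i \<in> set ks" using that by simp
    also have "set ks = card ` P" using assms(1) by (simp add: ks_def)
    finally show ?thesis using assms(2) by auto
  qed
  then show ?thesis by (simp add: part_size_def Let_def flip: ks_def)
qed

lemma part_size_eq_cards:
  assumes "finite P" "\<And>A. A \<in> P \<Longrightarrow> card A = m"
  shows "part_size P i = (if i < card P then m else 0)"
proof -
  have "image_mset card (mset_set P) = image_mset (\<lambda>_. m) (mset_set P)"
    using assms by (intro image_mset_cong) simp
  also have "\<dots> = mset (replicate (card P) m)" by (simp add: image_mset_const_eq)
  finally have "sorted_list_of_multiset (image_mset card (mset_set P)) = replicate (card P) m"
    by (simp only: sorted_list_of_multiset_mset sorted_replicate sorted_sort_id)
  then show ?thesis by (simp add: part_size_def Let_def)
qed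

definition eighths :: "nat \<Rightarrow> real" where "eighths = (\<lambda>i. if i < 8 then 1 / 8 else 0)"

lemma eighths_sums: "eighths sums 1"
proof -
  have "eighths sums (\<Sum>i<8. eighths i)" by (rule sums_finite) (auto simp: eighths_def)
  then show ?thesis by (simp add: eighths_def)
qed

lemma param_lim_K2111: "param_lim (ind_density K2111) = 525 / 1024"
  unfolding param_lim_def using param_max_tendsto by (rule limI)

lemma maximiser_eighths: "maximiser (ind_density K2111) eighths"
  unfolding maximiser_def
proof (intro conjI)
  show "decseq eighths" by (auto simp: decseq_def eighths_def)
  show "\<forall>i. 0 \<le> eighths i" by (simp add: eighths_def)
  show "summable eighths" using eighths_sums by (rule sums_summable)
  show "(\<Sum>i. eighths i) \<le> 1" using eighths_sums by (simp add: sums_unique[symmetric])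
  \<comment> \<open>At multiples of 8 all parts have equal size, so the ratios are exactly
    \<open>1 / 8\<close>; \<open>Suc\<close> keeps the order positive.\<close>
  define H where "H m = turan8 (8 * Suc m)" for m
  define P where "P m = fibres {..<8 * Suc m} (\<lambda>i. i mod 8)" for m
  have P: "finite (P m)" "card (P m) = 8" "\<And>A. A \<in> P m \<Longrightarrow> card A = Suc m" for m
  proof -
    show "finite (P m)" by (simp add: P_def fibres_def)
    have im: "(\<lambda>i. i mod 8) ` {..<8 * Suc m} = {..<8::nat}"
    proof (intro set_eqI iffI)
      fix j assume "j \<in> {..<8::nat}"
      then show "j \<in> (\<lambda>i. i mod 8) ` {..<8 * Suc m}" by (intro image_eqI[of _ _ j]) auto
    qed auto
    have c: "card {v \<in> {..<8 * Suc m}. v mod 8 = j} = Suc m" if "j < 8" for j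
      unfolding card_residue_class[OF that] using that by simp
    show "card A = Suc m" if "A \<in> P m" for A
      using that c unfolding P_def fibres_def im by auto
    have "inj_on (\<lambda>j. {v \<in> {..<8 * Suc m}. v mod 8 = j}) {..<8}"
    proof (rule inj_onI)
      fix j k :: nat assume jk: "j \<in> {..<8}" "k \<in> {..<8}" "{v \<in> {..<8 * Suc m}. v mod 8 = j} = {v \<in> {..<8 * Suc m}. v mod 8 = k}"
      have "j \<in> {v \<in> {..<8 * Suc m}. v mod 8 = j}" using jk(1) by simp
      then show "j = k" unfolding jk(3) using jk by simp
    qed
    then show "card (P m) = 8" unfolding P_def fibres_def im by (simp add: card_image)
  qed
  have ordH: "order (H m) = 8 * Suc m" for m
    by (simp add: H_def turan8_def partite_graph_order)
  show "\<exists>(H :: nat \<Rightarrow> nat sgraph) P. (\<forall>n. complete_partite_with (H n) (P n)) \<and> filterlim (\<lambda>n. order (H n)) at_top sequentially \<and>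
     (\<lambda>n. ind_density K2111 (H n)) \<longlonglongrightarrow> param_lim (ind_density K2111) \<and>
     (\<forall>i. (\<lambda>n. real (part_size (P n) i) / real (order (H n))) \<longlonglongrightarrow> eighths i)"
  proof (intro exI conjI allI)
    show "complete_partite_with (H m) (P m)" for m
      unfolding H_def turan8_def P_def by (rule partite_graph_complete) simp
    have fl: "filterlim (\<lambda>m. 8 * Suc m) at_top sequentially"
      by (intro filterlim_subseq strict_monoI) simp
    then show "filterlim (\<lambda>m. order (H m)) at_top sequentially" by (simp only: ordH)
    show "(\<lambda>m. ind_density K2111 (H m)) \<longlonglongrightarrow> param_lim (ind_density K2111)"
      unfolding H_def param_lim_K2111 by (rule filterlim_compose[OF turan8_tendsto fl])
    show "(\<lambda>m. real (part_size (P m) i) / real (order (H m))) \<longlonglongrightarrow> eighths i" for i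
    proof -
      have "real (part_size (P m) i) / real (order (H m)) = eighths i" for m
      proof -
        have "part_size (P m) i = (if i < card (P m) then Suc m else 0)"
          by (rule part_size_eq_cards) (use P in auto)
        then show ?thesis unfolding P(2) ordH eighths_def by simp
      qed
      then show ?thesis by simp
    qed
  qed
qed

text \<open>Along the sequence \<open>core\<close> tends to its maximum, so
  \<open>core_stable\<close> gives eight parts of weight near \<open>1 / 8\<close>. This pins the
  first eight limits, and the bound on the total leaves nothing for the others.\<close>

lemma maximiser_unique:
  assumes "maximiser (ind_density K2111) x"
  shows "x = eighths"
proof -
  from assms obtain H :: "nat \<Rightarrow> nat sgraph" and P where
    x: "\<And>i. 0 \<le> x i" "summable x" "(\<Sum>i. x i) \<le> 1"
    and C: "\<And>m. complete_partite_with (H m) (P m)" and ord: "filterlim (\<lambda>m. order (H m)) at_top sequentially"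
    and lim: "(\<lambda>m. ind_density K2111 (H m)) \<longlonglongrightarrow> 525 / 1024"
    and sz: "\<And>i. (\<lambda>m. real (part_size (P m) i) / real (order (H m))) \<longlonglongrightarrow> x i"
    unfolding maximiser_def param_lim_K2111 by blast
  define n where "n m = order (H m)" for m
  define w where "w m A = real (card A) / real (n m)" for m and A :: "nat set"
  have fl: "filterlim n at_top sequentially" using ord by (simp add: n_def[abs_def])
  have n5: "\<forall>\<^sub>F m in sequentially. 5 \<le> n m" using fl by (simp add: filterlim_at_top)
  have rt: "(\<lambda>m. ratio5 (n m)) \<longlonglongrightarrow> 1" by (rule filterlim_compose[OF ratio5_tendsto fl])
  have near: "\<forall>\<^sub>F m in sequentially. \<bar>real (part_size (P m) i) / real (n m) - 1 / 8\<bar> \<le> \<eta>"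
    if i: "i < 8" and \<eta>: "0 < \<eta>" "\<eta> \<le> 1 / 100" for i \<eta>
  proof -
    obtain c where c: "0 < c" "\<And>(I :: nat set set) w. weighting I w \<Longrightarrow> core I w \<ge> 210 / 4096 - c \<Longrightarrow>
      (\<exists>J\<subseteq>I. card J = 8 \<and> (\<forall>i\<in>J. \<bar>w i - 1 / 8\<bar> < \<eta>))"
      using core_stable[OF \<eta>(1)] by blast
    have "(\<lambda>m. ind_density K2111 (H m) / (ratio5 (n m) * 10)) \<longlonglongrightarrow> 525 / 1024 / (1 * 10)"
      by (intro tendsto_intros lim rt) simp
    then have "\<forall>\<^sub>F m in sequentially. 210 / 4096 - c < ind_density K2111 (H m) / (ratio5 (n m) * 10)"
      using c(1) by (intro order_tendstoD) auto
    then show ?thesis using n5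
    proof eventually_elim
      case (elim m)
      have n0: "0 < n m" using elim(2) by simp
      have fin: "finite (P m)"
        using C[of m] by (auto simp: complete_partite_with_def intro: finite_elements)
      have W: "weighting (P m) (w m)" and d: "dens (verts (H m)) (uniform (n m)) (nonadj (H m)) = 10 * core (P m) (w m)"
        using dens_complete_partite[OF C[of m], of "n m"] n0 by (simp_all add: n_def w_def[abs_def])
      have "H m \<in> graphs_of_order (n m)"
        using complete_partite_simple[OF C[of m]] by (simp add: graphs_of_order_def n_def)
      then have "ind_density K2111 (H m) \<le> ratio5 (n m) * (10 * core (P m) (w m))"
        using ind_density_upper(1)[of "H m" "n m"] elim(2) d by simp
      moreover have "0 < ratio5 (n m)" using ratio5_ge_1[OF elim(2)] by linarith
      ultimately have "ind_density K2111 (H m) / (ratio5 (n m) * 10) \<le> core (P m) (w m)"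
        by (simp add: field_simps)
      then have "core (P m) (w m) \<ge> 210 / 4096 - c" using elim(1) by linarith
      then obtain J where J: "J \<subseteq> P m" "card J = 8" "\<And>A. A \<in> J \<Longrightarrow> \<bar>w m A - 1 / 8\<bar> < \<eta>"
        using c(2)[OF W] by blast
      have finJ: "finite J" using J(1) fin by (rule finite_subset)
      have wnn: "0 \<le> w m A" for A by (simp add: w_def)
      have up: "w m A \<le> 1 / 8 + \<eta>" if "A \<in> P m" for A
      proof (cases "A \<in> J")
        case True
        then show ?thesis using J(3)[OF True] by linarith
      next
        case False
        \<comment> \<open>The parts in \<open>J\<close> leave at most \<open>8 * \<eta>\<close> for
          any other part, which is below \<open>1 / 8\<close> because
          \<open>\<eta> \<le> 1 / 100\<close>.\<close>
        have "(\<Sum>B\<in>J. 1 / 8 - \<eta>) \<le> sum (w m) J" using J(3) by (intro sum_mono) (fastforce simp: abs_less_iff)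
        then have "1 - 8 * \<eta> \<le> sum (w m) J" using J(2) by simp
        moreover have "sum (w m) (insert A J) \<le> sum (w m) (P m)"
          using J(1) that fin wnn by (intro sum_mono2) auto
        then have "w m A + sum (w m) J \<le> 1" using False finJ W by (simp add: weighting_def)
        ultimately show ?thesis using \<eta> by linarith
      qed
      have "real (part_size (P m) i) \<le> (1 / 8 + \<eta>) * real (n m)"
      proof -
        have "part_size (P m) i \<le> nat \<lfloor>(1 / 8 + \<eta>) * real (n m)\<rfloor>"
        proof (rule part_size_le[OF fin])
          fix A assume "A \<in> P m"
          then have "real (card A) \<le> (1 / 8 + \<eta>) * real (n m)" using up n0 by (simp add: w_def field_simps)
          then show "card A \<le> nat \<lfloor>(1 / 8 + \<eta>) * real (n m)\<rfloor>" by linarith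
        qed
        moreover have "0 \<le> (1 / 8 + \<eta>) * real (n m)" using \<eta> by simp
        ultimately show ?thesis by linarith
      qed
      moreover have "(1 / 8 - \<eta>) * real (n m) \<le> real (part_size (P m) i)"
      proof -
        have "nat \<lceil>(1 / 8 - \<eta>) * real (n m)\<rceil> \<le> part_size (P m) i"
        proof (rule part_size_ge[OF fin J(1)])
          show "i < card J" using i J(2) by simp
          fix A assume "A \<in> J"
          then have "1 / 8 - \<eta> \<le> w m A" using J(3)[of A] by linarith
          then have "(1 / 8 - \<eta>) * real (n m) \<le> real (card A)" using n0 by (simp add: w_def field_simps)
          then show "nat \<lceil>(1 / 8 - \<eta>) * real (n m)\<rceil> \<le> card A" by linarith
        qed
        then show ?thesis by linarith
      qed
      ultimately show ?case using n0 by (simp add: abs_le_iff field_simps)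
    qed
  qed
  have xi: "x i = 1 / 8" if i: "i < 8" for i
  proof -
    have "(\<lambda>m. real (part_size (P m) i) / real (n m)) \<longlonglongrightarrow> 1 / 8"
    proof (rule tendstoI)
      fix e :: real assume "0 < e"
      define \<eta> where "\<eta> = min (e / 2) (1 / 100)"
      have \<eta>: "0 < \<eta>" "\<eta> \<le> 1 / 100" "\<eta> < e" using \<open>0 < e\<close> by (auto simp: \<eta>_def)
      show "\<forall>\<^sub>F m in sequentially. dist (real (part_size (P m) i) / real (n m)) (1 / 8) < e"
        using near[OF i \<eta>(1,2)] by eventually_elim (use \<eta>(3) in \<open>simp add: dist_real_def\<close>)
    qed
    then show ?thesis using sz[of i] LIMSEQ_unique unfolding n_def by blast
  qed
  have "x i = 0" if i: "\<not> i < 8" for i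
  proof -
    \<comment> \<open>The first eight entries already exhaust the total 1.\<close>
    have "sum x (insert i {..<8}) \<le> (\<Sum>i. x i)" by (rule sum_le_suminf[OF x(2)]) (auto simp: x(1))
    moreover have "sum x {..<8} = (\<Sum>i<8::nat. 1 / 8)" by (rule sum.cong) (auto simp: xi)
    then have "sum x (insert i {..<8}) = x i + 1" using i by simp
    ultimately show ?thesis using x(1)[of i] x(3) by linarith
  qed
  then show ?thesis using xi by (intro ext) (simp add: eighths_def)
qed

text \<open>Convergence is stated on its own because \<open>lim\<close> also denotes some value for
  a divergent sequence.\<close>

theorem theorem1p8:
  shows "perfectly_stable (ind_density (complete_multipartite [2, 1, 1, 1])) \<and>
    convergent (max_ind_ratio (complete_multipartite [2, 1, 1, 1])) \<and>
    inducibility (complete_multipartite [2, 1, 1, 1]) = 525 / 1024 \<and>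
    {x. maximiser (ind_density (complete_multipartite [2, 1, 1, 1])) x} = {\<lambda>i. if i < 8 then 1 / 8 else 0}"
  unfolding K2111_def[symmetric] eighths_def[symmetric]
proof (intro conjI)
  show "perfectly_stable (ind_density K2111)" by (rule perfectly_stable_K2111)
  show "convergent (max_ind_ratio K2111)" using max_ind_ratio_tendsto by (rule convergentI)
  show "inducibility K2111 = 525 / 1024" unfolding inducibility_def using max_ind_ratio_tendsto by (rule limI)
  show "{x. maximiser (ind_density K2111) x} = {eighths}" using maximiser_eighths maximiser_unique by blast
qed

end
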